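(* Let $G\colon\mathcal{P}(X)\to\mathbb{R}\cup\{+\infty\}$ be bounded below and lower semicontinuous with respect to weak convergence, and let $P$ be a Borel probability measure on $\mathcal{P}(X)$ (with the topology of weak convergence) such that $$\inf_{\nu\in\mathcal{P}(X)}\Bigl(\int J(\mu,\nu)\,dP(\mu)+G(\nu)\Bigr)<\infty.$$ Then there exists a $G$-regularized Fréchet barycenter of $P$. Moreover, any minimizing sequence $\{\nu_n\}_{n\in\mathbb{N}}\subset\mathcal{P}(X)$, i.e. such that $$\int J(\mu,\nu_n)\,dP(\mu)+G(\nu_n)\to\inf_{\nu\in\mathcal{P}(X)}\Bigl(\int J(\mu,\nu)\,dP(\mu)+G(\nu)\Bigr),$$ is precompact in the topology $\tau_J$, and every partial limit of it is a $G$-regularized Fréchet barycenter of $P$. In particular, the set $\mathrm{Bar}_G(P)$ of all $G$-regularized Fréchet barycenters of $P$ is compact in $\tau_J$.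
   Context: Setting. $(X,\rho)$ is a Radon space: a separable metric space such that for every Borel probability measure $\mu$ on $X$ and every $\epsilon>0$ there is a compact set $D$ with $\mu(X\setminus D)<\epsilon$. $\mathcal{P}(X)$ is the set of Borel probability measures on $X$. The cost function $c\colon X\times X\to[0,\infty)$ is continuous and consistent: for any $x\in X$ and $\{x_n\}\subset X$, $c(x,x_n)\to0$ iff $c(x_n,x)\to0$ iff $x_n\to x$. Growth assumption: there are constants $A,B\ge0$ such that for all $x,y,z\in X$ the number $c(x,y)$ is at most each of $A+B(c(x,z)+c(y,z))$, $A+B(c(x,z)+c(z,y))$, $A+B(c(z,x)+c(y,z))$, $A+B(c(z,x)+c(z,y))$. Compactness assumption: for some (and therefore any) $x_0\in X$ and all $r\ge 0$ the set $\{y\in X: c(x_0,y)\le r\}$ is compact. Transportation cost: $J(\mu,\nu)=\inf_{\gamma\in\Pi(\mu,\nu)}\int c(x,y)\,d\gamma(x,y)\in[0,\infty]$, where $\Pi(\mu,\nu)$ is the set of Borel probability measures on $X\times X$ with first marginal $\mu$ and second marginal $\nu$; $J$ is lower semicontinuous, hence Borel, with respect to weak convergence. The balls $\{\nu: J(\mu,\nu)<r\}$, $\mu\in\mathcal{P}(X)$, $r>0$, form a basis of a topology $\tau_J$ on $\mathcal{P}(X)$; $\nu_n\to\nu^*$ in $\tau_J$ is equivalent to $J(\nu_n,\nu^* )\to0$ and $J(\nu^*,\nu_n)\to0$. A $G$-regularized Fréchet barycenter of $P$ is any $\nu\in\mathcal{P}(X)$ minimizing $\nu\mapsto\int J(\mu,\nu)\,dP(\mu)+G(\nu)$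 over $\mathcal{P}(X)$. Precompact means having compact closure; a partial limit is the limit of a $\tau_J$-convergent subsequence. *)

theory Defs
  imports "HOL-Probability.Probability"
begin

definition borel_probs :: "'a::topological_space measure set" where
  "borel_probs = space (prob_algebra borel)"

text \<open>The topology of weak convergence: the coarsest topology on the Borel probability measures
  that makes integration of every bounded continuous real function continuous.\<close>

definition weak_topology :: "'a::topological_space measure topology" where
  "weak_topology = topology_generated_by
     {{\<nu> \<in> borel_probs. integral\<^sup>L \<nu> f \<in> U} | f U.
        continuous_on UNIV (f :: 'a \<Rightarrow> real) \<and> bounded (range f) \<and> open U}"

definition borel_measure_of :: "'b topology \<Rightarrow> 'b measure" where
  "borel_measure_of T = sigma (topspace T) {U. openin T U}"

definition lower_semicontinuous_map :: "'b topology \<Rightarrow> ('b \<Rightarrow> ereal) \<Rightarrow> bool" where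
  "lower_semicontinuous_map T f \<longleftrightarrow> (\<forall>a. openin T {x \<in> topspace T. a < f x})"

definition consistent_cost :: "('a::topological_space \<Rightarrow> 'a \<Rightarrow> real) \<Rightarrow> bool" where
  "consistent_cost c \<longleftrightarrow>
     (\<forall>x xs. ((\<lambda>n. c x (xs n)) \<longlonglongrightarrow> 0 \<longleftrightarrow> (\<lambda>n. c (xs n) x) \<longlonglongrightarrow> 0) \<and>
             ((\<lambda>n. c (xs n) x) \<longlonglongrightarrow> 0 \<longleftrightarrow> xs \<longlonglongrightarrow> x))"

definition couplings ::
  "'a::topological_space measure \<Rightarrow> 'a measure \<Rightarrow> ('a \<times> 'a) measure set" where
  "couplings \<mu> \<nu> =
     {\<gamma> \<in> borel_probs. distr \<gamma> borel fst = \<mu> \<and> distr \<gamma> borel snd = \<nu>}"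

definition transport_cost ::
  "('a::topological_space \<Rightarrow> 'a \<Rightarrow> real) \<Rightarrow> 'a measure \<Rightarrow> 'a measure \<Rightarrow> ennreal" where
  "transport_cost c \<mu> \<nu> =
     (INF \<gamma>\<in>couplings \<mu> \<nu>. \<integral>\<^sup>+ (x, y). ennreal (c x y) \<partial>\<gamma>)"

text \<open>The balls are used here as a subbase.  For the costs under consideration they form a base,
  and then the topology they generate is the one having them as a base.\<close>

definition transport_topology ::
  "('a::topological_space \<Rightarrow> 'a \<Rightarrow> real) \<Rightarrow> 'a measure topology" where
  "transport_topology c = topology_generated_by
     {{\<nu> \<in> borel_probs. transport_cost c \<mu> \<nu> < ennreal r} | \<mu> r. \<mu> \<in> borel_probs \<and> r > 0}"

definition barycenter_objective ::
  "('a::topological_space \<Rightarrow> 'a \<Rightarrow> real) \<Rightarrow> ('a measure \<Rightarrow> ereal) \<Rightarrow> 'a measure measure \<Rightarrow>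
     'a measure \<Rightarrow> ereal" where
  "barycenter_objective c G P \<nu> = enn2ereal (\<integral>\<^sup>+ \<mu>. transport_cost c \<mu> \<nu> \<partial>P) + G \<nu>"

definition barycenters ::
  "('a::topological_space \<Rightarrow> 'a \<Rightarrow> real) \<Rightarrow> ('a measure \<Rightarrow> ereal) \<Rightarrow> 'a measure measure \<Rightarrow>
     'a measure set" where
  "barycenters c G P =
     {\<nu> \<in> borel_probs. \<forall>\<nu>' \<in> borel_probs.
        barycenter_objective c G P \<nu> \<le> barycenter_objective c G P \<nu>'}"

definition precompact_in :: "'b topology \<Rightarrow> 'b set \<Rightarrow> bool" where
  "precompact_in T S \<longleftrightarrow> S \<subseteq> topspace T \<and> compactin T (T closure_of S)"

end

theory Submission
  imports Defs
begin

text \<open>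
  Along a minimizing sequence \<open>\<nu>\<^sub>n\<close> Fatou's lemma provides a measure \<open>\<mu>\<close> with \<open>J \<mu> \<nu>\<^sub>n\<close> bounded on a
  subsequence.  Since cost balls are compact, that subsequence is tight, and by Prokhorov's theorem it has a weak
  limit \<open>\<nu>\<close>, which is a barycenter because the objective is weakly lower semicontinuous.  As both summands of
  the objective are lower semicontinuous, their values converge separately, and Fatou's lemma again gives a
  \<open>\<mu>\<close> with \<open>J \<mu> \<nu>\<^sub>n \<rightarrow> J \<mu> \<nu> < \<infinity>\<close> along a subsequence.  The optimal plans from \<open>\<mu>\<close> to \<open>\<nu>\<^sub>n\<close> then converge weakly
  together with their costs.  Cutting \<open>X \<times> X\<close> into small cells and coupling the plans cell by cell turns this
  into \<open>J \<nu> \<nu>\<^sub>n \<rightarrow> 0\<close>; gluing plans along \<open>\<nu>\<close> shows that \<open>J \<mu>' \<nu>\<^sub>n\<close> is eventually below any bound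
  exceeding \<open>J \<mu>' \<nu>\<close>, for every \<open>\<mu>'\<close>.  Hence on the set of barycenters the metrizable weak topology is finer than
  \<open>\<tau>\<^sub>J\<close>, so compactness passes from the former to the latter.
\<close>

section \<open>Weak convergence\<close>

text \<open>The costs need not satisfy a triangle inequality: if \<open>A > 0\<close>, the growth
  condition never yields a small bound, so smallness can come only from consistency, continuity and
  compact balls. Estimates therefore treat two regimes separately: small costs by continuity, on
  cells of small cost or through an envelope, and large costs by the growth condition together with
  integrability.

  Convergence in \<open>\<tau>\<^sub>J\<close> is tested on balls around every centre, not only
  around the limit, so control of the cost from the limit has to be transferred to all other
  centres. The plans built for this are explicit densities with respect to product measures,
  expressed through partitions of unity.

  Compactness in \<open>\<tau>\<^sub>J\<close> is obtained from open covers rather than from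
  sequences: the barycenters are a continuous image of a weakly compact set, and every open set
  containing them contains a tail of each minimizing sequence.\<close>

definition weakly_conv :: "(nat \<Rightarrow> 'a::topological_space measure) \<Rightarrow> 'a measure \<Rightarrow> bool" where
  "weakly_conv s l \<longleftrightarrow> (\<forall>f::'a \<Rightarrow> real. continuous_on UNIV f \<and> bounded (range f) \<longrightarrow>
     (\<lambda>n. integral\<^sup>L (s n) f) \<longlonglongrightarrow> integral\<^sup>L l f)"

lemma borel_probs_iff: "\<mu> \<in> borel_probs \<longleftrightarrow> prob_space \<mu> \<and> sets \<mu> = sets borel"
  by (auto simp: borel_probs_def space_prob_algebra)

lemma borel_probs_prob: "\<mu> \<in> borel_probs \<Longrightarrow> prob_space \<mu>"
  and borel_probs_sets: "\<mu> \<in> borel_probs \<Longrightarrow> sets \<mu> = sets borel"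
  by (auto simp: borel_probs_iff)

lemma borel_probs_space: "\<mu> \<in> borel_probs \<Longrightarrow> space \<mu> = UNIV"
  by (metis borel_probs_sets sets_eq_imp_space_eq space_borel)

lemma borel_probs_measurable: "\<mu> \<in> borel_probs \<Longrightarrow> measurable \<mu> N = measurable borel N"
  by (metis borel_probs_sets measurable_cong_sets)

lemma distr_borel_probs:
  assumes "\<mu> \<in> borel_probs" "f \<in> borel_measurable borel"
  shows "distr \<mu> borel f \<in> borel_probs"
proof -
  interpret prob_space \<mu> using assms borel_probs_prob by blast
  show ?thesis
    using assms by (auto simp: borel_probs_iff borel_probs_measurable intro!: prob_space_distr)
qed

lemma integrable_bdd_continuous:
  fixes f :: "'a::topological_space \<Rightarrow> real"
  assumes "\<mu> \<in> borel_probs" "continuous_on UNIV f" "bounded (range f)"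
  shows "integrable \<mu> f"
proof -
  interpret prob_space \<mu> using assms(1) borel_probs_prob by blast
  obtain b where "\<And>x. norm (f x) \<le> b"
    using assms(3) by (auto simp: bounded_iff)
  then show ?thesis
    using assms by (intro integrable_const_bound[where B=b])
      (auto simp: borel_probs_measurable intro: borel_measurable_continuous_onI)
qed

lemma weakly_conv_subseq: "weakly_conv s l \<Longrightarrow> strict_mono r \<Longrightarrow> weakly_conv (s \<circ> r) l"
  unfolding weakly_conv_def using LIMSEQ_subseq_LIMSEQ[of _ _ r] by (fastforce simp: o_def)

lemma weakly_conv_distr:
  fixes g :: "'a::topological_space \<Rightarrow> 'b::topological_space"
  assumes "weakly_conv s l" "continuous_on UNIV g" "\<And>n. s n \<in> borel_probs" "l \<in> borel_probs"
  shows "weakly_conv (\<lambda>n. distr (s n) borel g) (distr l borel g)"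
  unfolding weakly_conv_def
proof safe
  fix f :: "'b \<Rightarrow> real" assume f: "continuous_on UNIV f" "bounded (range f)"
  have g: "g \<in> borel_measurable borel"
    using assms(2) by (rule borel_measurable_continuous_onI)
  have *: "integral\<^sup>L (distr \<mu> borel g) f = integral\<^sup>L \<mu> (f \<circ> g)" if "\<mu> \<in> borel_probs" for \<mu>
    unfolding o_def using f g that
    by (intro integral_distr) (auto simp: borel_probs_measurable intro: borel_measurable_continuous_onI)
  have "continuous_on UNIV (f \<circ> g)" "bounded (range (f \<circ> g))"
    using f continuous_on_compose[OF assms(2) continuous_on_subset[OF f(1)]]
    by (auto intro: bounded_subset)
  then show "(\<lambda>n. integral\<^sup>L (distr (s n) borel g) f) \<longlonglongrightarrow> integral\<^sup>L (distr l borel g) f"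
    using assms by (simp add: * weakly_conv_def)
qed

text \<open>A subbase suffices to test limits, since the condition on a neighbourhood survives
  finite intersections and arbitrary unions. The condition \<open>l \<in> \<Union>S\<close> says
  that \<open>l\<close> is a point of the generated space.\<close>

lemma limitin_topology_generated_by:
  "limitin (topology_generated_by S) f l F \<longleftrightarrow>
     l \<in> \<Union>S \<and> (\<forall>U\<in>S. l \<in> U \<longrightarrow> eventually (\<lambda>x. f x \<in> U) F)"
proof safe
  assume "limitin (topology_generated_by S) f l F"
  then show "l \<in> \<Union>S" "\<And>U. U \<in> S \<Longrightarrow> l \<in> U \<Longrightarrow> eventually (\<lambda>x. f x \<in> U) F"
    unfolding limitin_def by (auto intro: topology_generated_by_Basis)
next
  fix X assume S: "\<forall>U\<in>S. l \<in> U \<longrightarrow> eventually (\<lambda>x. f x \<in> U) F" and X: "X \<in> S" "l \<in> X"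
  have "l \<in> U \<longrightarrow> eventually (\<lambda>x. f x \<in> U) F" if "generate_topology_on S U" for U
    using that
  proof induction
    case (UN K)
    show ?case
    proof
      assume "l \<in> \<Union>K"
      then obtain X where "X \<in> K" "eventually (\<lambda>x. f x \<in> X) F" using UN by blast
      then show "eventually (\<lambda>x. f x \<in> \<Union>K) F" by (auto elim: eventually_mono)
    qed
  next
    case (Int a b)
    then show ?case by (auto intro: eventually_conj)
  qed (use S in auto)
  then show "limitin (topology_generated_by S) f l F"
    using X by (auto simp: limitin_def openin_topology_generated_by_iff)
qed

lemma topspace_weak_topology [simp]: "topspace weak_topology = borel_probs"
proof -
  have "{\<nu> \<in> borel_probs. integral\<^sup>L \<nu> (\<lambda>x. 0::real) \<in> UNIV} = (borel_probs :: 'a measure set)"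
    by auto
  moreover have "continuous_on UNIV (\<lambda>x::'a. 0::real)" "bounded (range (\<lambda>x::'a. 0::real))" by auto
  ultimately show ?thesis
    unfolding weak_topology_def topology_generated_by_topspace by (intro equalityI subsetI) blast+
qed

lemma limitin_weak_topology:
  assumes "\<And>n. s n \<in> borel_probs" "l \<in> borel_probs"
  shows "limitin weak_topology s l sequentially \<longleftrightarrow> weakly_conv s l"
proof
  assume lim: "limitin weak_topology s l sequentially"
  show "weakly_conv s l" unfolding weakly_conv_def
  proof (safe, rule topological_tendstoI)
    fix f :: "'a \<Rightarrow> real" and U
    assume "continuous_on UNIV f" "bounded (range f)" "open U" "integral\<^sup>L l f \<in> U"
    then have "openin weak_topology {\<nu> \<in> borel_probs. integral\<^sup>L \<nu> f \<in> U}"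
      unfolding weak_topology_def by (intro topology_generated_by_Basis) blast
    with lim show "\<forall>\<^sub>F x in sequentially. integral\<^sup>L (s x) f \<in> U"
      using \<open>integral\<^sup>L l f \<in> U\<close> assms unfolding limitin_def by force
  qed
next
  assume w: "weakly_conv s l"
  have "l \<in> topspace weak_topology" using assms by simp
  then show "limitin weak_topology s l sequentially"
    unfolding weak_topology_def limitin_topology_generated_by
    using w assms by (auto simp: weakly_conv_def topological_tendstoD)
qed

text \<open>The case distinction is needed because \<open>infdist x {} = 0\<close>.\<close>

definition hat :: "'a::metric_space set \<Rightarrow> nat \<Rightarrow> 'a \<Rightarrow> real" where
  "hat U N x = (if U = UNIV then 1 else min 1 (real N * infdist x (- U)))"

lemma hat_continuous: "continuous_on S (hat U N)"
  by (cases "U = UNIV") (auto simp: hat_def[abs_def] intro!: continuous_intros)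

lemma hat_nonneg: "0 \<le> hat U N x" and hat_le_1: "hat U N x \<le> 1"
  by (auto simp: hat_def infdist_nonneg)

lemma hat_eq_0: "x \<notin> U \<Longrightarrow> hat U N x = 0"
  by (auto simp: hat_def)

lemma hat_eq_1:
  assumes "open U" "x \<in> U" obtains N where "hat U N x = 1"
proof (cases "U = UNIV")
  case False
  then have "infdist x (- U) > 0"
    using assms in_closed_iff_infdist_zero[of "- U" x] infdist_nonneg[of x "- U"] by fastforce
  then obtain N :: nat where "1 \<le> real N * infdist x (- U)"
    by (metis ex_less_of_nat_mult less_eq_real_def)
  then show ?thesis using that[of N] by (simp add: hat_def)
qed (use that in \<open>auto simp: hat_def\<close>)

text \<open>The integrals of countably many functions determine the weak topology: every bounded continuous
  \<open>f \<ge> 0\<close> is the increasing limit of finite maxima of rational multiples of hats over basic open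
  sets, so \<open>\<integral>f d\<nu>\<close> is the supremum of the integrals of those maxima that lie below \<open>f\<close>.\<close>

lemma countable_lower_approximation:
  obtains G :: "('a::{metric_space, second_countable_topology} \<Rightarrow> real) set"
  where "countable G" "\<And>g. g \<in> G \<Longrightarrow> continuous_on UNIV g \<and> bounded (range g)"
    "\<And>f \<nu> a. continuous_on UNIV f \<Longrightarrow> bounded (range f) \<Longrightarrow> (\<And>x. f x \<ge> 0) \<Longrightarrow> \<nu> \<in> borel_probs \<Longrightarrow>
        a < integral\<^sup>L \<nu> f \<Longrightarrow> \<exists>g\<in>G. (\<forall>x. g x \<le> f x) \<and> a < integral\<^sup>L \<nu> g"
proof -
  obtain \<B> :: "'a set set" where \<B>: "countable \<B>" "topological_basis \<B>"
    using ex_countable_basis by blast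
  define H where "H = (\<lambda>(U, N, q) x. real_of_rat q * hat U N x) ` (\<B> \<times> UNIV \<times> {q. q \<ge> 0})"
  define G where "G = (\<lambda>F x. Max ((\<lambda>h. h x) ` F)) ` {F. finite F \<and> F \<subseteq> H \<and> F \<noteq> {}}"
  have H: "countable H"
    unfolding H_def using \<B>(1) by (intro countable_image countable_SIGMA) auto
  have "countable {F. finite F \<and> F \<subseteq> H}"
    by (rule countable_Collect_finite_subset[OF H])
  then have 1: "countable G"
    unfolding G_def by (intro countable_image) (auto elim: countable_subset[rotated])
  have cH: "continuous_on UNIV h" if "h \<in> H" for h
    using that by (auto simp: H_def intro!: continuous_intros hat_continuous)
  have bH: "\<exists>b. \<forall>x. 0 \<le> h x \<and> h x \<le> b" if h: "h \<in> H" for h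
  proof -
    obtain U N q where "q \<ge> 0" "h = (\<lambda>x. real_of_rat q * hat U N x)" using h by (auto simp: H_def)
    then show ?thesis
      using hat_nonneg[of U N] hat_le_1[of U N]
      by (intro exI[of _ "real_of_rat q"]) (auto intro: mult_left_le)
  qed
  have fin: "continuous_on UNIV (\<lambda>x. Max ((\<lambda>h. h x) ` F)) \<and> bounded (range (\<lambda>x. Max ((\<lambda>h. h x) ` F)))"
    if "finite F" "F \<noteq> {}" "F \<subseteq> H" for F
    using that
  proof (induction F rule: finite_ne_induct)
    case (singleton h)
    then obtain b where "\<forall>x. 0 \<le> h x \<and> h x \<le> b" using bH by blast
    then have "bounded (range h)" by (auto simp: bounded_iff intro!: exI[of _ b])
    with singleton cH show ?case by simp
  next
    case (insert h F)
    have eq: "Max ((\<lambda>h. h x) ` insert h F) = max (h x) (Max ((\<lambda>h. h x) ` F))" for x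
      using insert by simp
    obtain b where b: "\<forall>x. 0 \<le> h x \<and> h x \<le> b" using bH insert by blast
    obtain d where d: "\<And>x. \<bar>Max ((\<lambda>h. h x) ` F)\<bar> \<le> d"
      using insert by (auto simp: bounded_iff)
    have "\<bar>max (h x) (Max ((\<lambda>h. h x) ` F))\<bar> \<le> \<bar>b\<bar> + \<bar>d\<bar>" for x
      using b[rule_format, of x] d[of x] by linarith
    then have "bounded (range (\<lambda>x. max (h x) (Max ((\<lambda>h. h x) ` F))))"
      by (auto simp: bounded_iff intro!: exI[of _ "\<bar>b\<bar> + \<bar>d\<bar>"])
    moreover have "continuous_on UNIV (\<lambda>x. max (h x) (Max ((\<lambda>h. h x) ` F)))"
      using insert cH by (auto intro!: continuous_on_max)
    ultimately show ?case unfolding eq by blast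
  qed
  have 3: "\<exists>g\<in>G. (\<forall>x. g x \<le> f x) \<and> a < integral\<^sup>L \<nu> g"
    if f: "continuous_on UNIV f" "bounded (range f)" "\<And>x. f x \<ge> 0" and \<nu>: "\<nu> \<in> borel_probs"
      and a: "a < integral\<^sup>L \<nu> f" for f :: "'a \<Rightarrow> real" and \<nu> a
  proof -
    interpret prob_space \<nu> using \<nu> borel_probs_prob by blast
    define K where "K = {h\<in>H. \<forall>x. h x \<le> f x}"
    obtain U0 where U0: "U0 \<in> \<B>"
      using \<B>(2) topological_basisE[of \<B> UNIV undefined] by blast
    have "(\<lambda>x. 0) \<in> H"
      \<comment> \<open>The zero function is the multiple by \<open>q = 0\<close> of any hat; it
        keeps \<open>K\<close> nonempty and serves the points where \<open>f x - r\<close> is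
        negative.\<close>
      unfolding H_def using U0 by (intro image_eqI[of _ _ "(U0, 0, 0)"]) auto
    then have K0: "(\<lambda>x. 0) \<in> K" using f(3) by (auto simp: K_def)
    have cK: "countable K" using H unfolding K_def by (auto elim: countable_subset[rotated])
    have rK: "range (from_nat_into K) = K" using cK K0 by (intro range_from_nat_into) auto
    define F where "F n = from_nat_into K ` {..n}" for n
    define g where "g n x = Max ((\<lambda>h. h x) ` F n)" for n x
    have F: "finite (F n)" "F n \<noteq> {}" "F n \<subseteq> K" for n
      using rK by (auto simp: F_def)
    have gG: "g n \<in> G" for n
      unfolding G_def using F[of n] by (intro image_eqI[of _ _ "F n"]) (auto simp: g_def K_def)
    have gle: "g n x \<le> f x" for n x
      unfolding g_def using F[of n] by (auto simp: K_def)
    have gge: "h x \<le> g n x" if "h \<in> F n" for n x h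
      unfolding g_def using F[of n] that by (intro Max_ge) auto
    obtain b where b: "\<And>x. \<bar>f x\<bar> \<le> b" using f(2) by (auto simp: bounded_iff)
    have g0: "0 \<le> g n x" for n x
    proof -
      obtain h where "h \<in> F n" using F by blast
      then have "h \<in> H" "h x \<le> g n x" using gge F(3)[of n] by (auto simp: K_def)
      then show ?thesis using bH[of h] order_trans by blast
    qed
    have lim: "(\<lambda>n. g n x) \<longlonglongrightarrow> f x" for x
    proof (rule LIMSEQ_I)
      fix r :: real assume r: "0 < r"
      have "\<exists>h\<in>K. f x - r < h x"
      proof (cases "f x - r < 0")
        case False
        then obtain q where q: "f x - r < real_of_rat q" "real_of_rat q < f x"
          using of_rat_dense[of "f x - r" "f x"] r by auto
        have q0: "q \<ge> 0" using q(1) False by (metis linorder_not_less of_rat_less_0_iff less_trans)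
        \<comment> \<open>On a basic neighbourhood where \<open>f\<close> exceeds \<open>q\<close>,
          the hat scaled by \<open>q\<close> stays below \<open>f\<close>, and for a steep enough
          hat it equals \<open>q\<close> at \<open>x\<close>.\<close>
        have "open {y. real_of_rat q < f y}"
          using f(1) by (intro open_Collect_less continuous_on_const) auto
        then obtain U where U: "U \<in> \<B>" "x \<in> U" "U \<subseteq> {y. real_of_rat q < f y}"
          using q(2) \<B>(2) topological_basisE by (metis mem_Collect_eq)
        then obtain N where N: "hat U N x = 1"
          using hat_eq_1 topological_basis_open[OF \<B>(2)] by metis
        have "real_of_rat q * hat U N y \<le> f y" for y
        proof (cases "y \<in> U")
          case True
          have "real_of_rat q * hat U N y \<le> real_of_rat q"
            using hat_le_1[of U N y] q0 by (intro mult_left_le) auto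
          then show ?thesis using True U(3) by auto
        qed (simp add: hat_eq_0 f(3))
        then have "(\<lambda>y. real_of_rat q * hat U N y) \<in> K"
          using U(1) q0 by (auto simp: K_def H_def intro!: image_eqI[of _ _ "(U, N, q)"])
        with N q show ?thesis by (intro bexI[of _ "\<lambda>y. real_of_rat q * hat U N y"]) auto
      qed (use K0 in force)
      then obtain h where h: "h \<in> K" "f x - r < h x" by blast
      then obtain m where m: "from_nat_into K m = h" using rK by (metis imageE)
      have "norm (g n x - f x) < r" if "n \<ge> m" for n
      proof -
        have "h \<in> F n" using m that by (auto simp: F_def)
        then show ?thesis using gge[of h n x] gle[of n x] h by auto
      qed
      then show "\<exists>no. \<forall>n\<ge>no. norm (g n x - f x) < r" by blast
    qed
    have "(\<lambda>n. integral\<^sup>L \<nu> (g n)) \<longlonglongrightarrow> integral\<^sup>L \<nu> f"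
    proof (rule integral_dominated_convergence[where w="\<lambda>_. b"])
      show "f \<in> borel_measurable \<nu>"
        using f \<nu> by (auto simp: borel_probs_measurable intro: borel_measurable_continuous_onI)
      show "g n \<in> borel_measurable \<nu>" for n
      proof -
        have "continuous_on UNIV (g n)"
          using fin[of "F n"] F[of n] by (auto simp: g_def K_def)
        then show ?thesis using \<nu> by (auto simp: borel_probs_measurable intro: borel_measurable_continuous_onI)
      qed
      show "AE x in \<nu>. norm (g n x) \<le> b" for n
        using g0 gle b by (intro AE_I2) (smt (verit) real_norm_def)
    qed (auto simp: lim)
    then have "eventually (\<lambda>n. a < integral\<^sup>L \<nu> (g n)) sequentially"
      using a by (rule order_tendstoD)
    then obtain n where "a < integral\<^sup>L \<nu> (g n)" by (auto simp: eventually_sequentially)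
    then show ?thesis using gG gle by blast
  qed
  have 2: "continuous_on UNIV g \<and> bounded (range g)" if "g \<in> G" for g
    using that fin by (auto simp: G_def)
  show ?thesis using that[OF 1 2 3] by blast
qed

section \<open>Uniqueness of weak limits and metrizability of the weak topology\<close>

lemma integral_hat_tendsto:
  fixes U :: "'a::metric_space set"
  assumes \<kappa>: "\<kappa> \<in> borel_probs" and U: "open U"
  shows "(\<lambda>n. integral\<^sup>L \<kappa> (hat U n)) \<longlonglongrightarrow> measure \<kappa> U"
proof -
  interpret prob_space \<kappa> using \<kappa> borel_probs_prob by blast
  have "(\<lambda>n. integral\<^sup>L \<kappa> (hat U n)) \<longlonglongrightarrow> integral\<^sup>L \<kappa> (indicator U)"
  proof (rule integral_dominated_convergence[where w="\<lambda>_. 1"])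
    show "indicat_real U \<in> borel_measurable \<kappa>" "\<And>n. hat U n \<in> borel_measurable \<kappa>"
      using assms by (auto simp: borel_probs_measurable intro: borel_measurable_continuous_onI hat_continuous)
    show "AE x in \<kappa>. (\<lambda>n. hat U n x) \<longlonglongrightarrow> indicator U x"
    proof (rule AE_I2)
      fix x
      show "(\<lambda>n. hat U n x) \<longlonglongrightarrow> indicator U x"
      proof (cases "x \<in> U")
        case True
        then obtain N where N: "hat U N x = 1" using hat_eq_1[OF U] by metis
        have "hat U n x = 1" if "n \<ge> N" for n
        proof (rule antisym[OF hat_le_1])
          have "hat U N x \<le> hat U n x"
            using that by (auto simp: hat_def min_def infdist_nonneg mult_right_mono intro: order_trans)
          with N show "1 \<le> hat U n x" by simp
        qed
        then show ?thesis using True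
          by (intro tendsto_eventually) (auto simp: eventually_sequentially)
      qed (simp add: hat_eq_0)
    qed
  qed (auto simp: hat_nonneg hat_le_1)
  then show ?thesis using assms by (simp add: borel_probs_sets)
qed

text \<open>Integrals of hats recover the measures of open sets, which form an intersection-stable
  generator of the Borel sets.\<close>

lemma borel_probs_eqI:
  fixes \<mu> \<nu> :: "'a::metric_space measure"
  assumes \<mu>: "\<mu> \<in> borel_probs" and \<nu>: "\<nu> \<in> borel_probs"
    and eq: "\<And>f::'a \<Rightarrow> real. continuous_on UNIV f \<Longrightarrow> bounded (range f) \<Longrightarrow> integral\<^sup>L \<mu> f = integral\<^sup>L \<nu> f"
  shows "\<mu> = \<nu>"
proof -
  interpret M: prob_space \<mu> using \<mu> borel_probs_prob by blast
  interpret N: prob_space \<nu> using \<nu> borel_probs_prob by blast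
  have bd: "bounded (range (hat U n))" for U :: "'a set" and n
    using hat_nonneg[of U n] hat_le_1[of U n] by (auto simp: bounded_iff intro!: exI[of _ 1])
  have op: "measure \<mu> U = measure \<nu> U" if "open U" for U
    using integral_hat_tendsto[OF \<mu> that] integral_hat_tendsto[OF \<nu> that] eq[OF hat_continuous bd]
    by (auto intro: LIMSEQ_unique)
  show ?thesis
  proof (rule measure_eqI_generator_eq[where E="{U. open U}" and \<Omega>=UNIV and A="\<lambda>_. UNIV"])
    show "Int_stable {U::'a set. open U}" by (auto simp: Int_stable_def)
    show "sets \<mu> = sigma_sets UNIV {U. open U}" "sets \<nu> = sigma_sets UNIV {U. open U}"
      using \<mu> \<nu> by (simp_all add: borel_probs_sets borel_def)
    show "emeasure \<mu> X = emeasure \<nu> X" if "X \<in> {U. open U}" for X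
      using that op by (simp add: M.emeasure_eq_measure N.emeasure_eq_measure)
  qed (auto)
qed

text \<open>Recording the integrals of the countable family \<open>G\<close> maps the measures into
  a countable product of real lines. This map \<open>E\<close> is a homeomorphism onto its image:
  its coordinates are weakly continuous, and its inverse is continuous because a strict lower bound
  on the integral of any bounded continuous function is already enforced by a single
  coordinate.\<close>

lemma metrizable_weak_topology:
  "metrizable_space (weak_topology :: 'a::{metric_space, second_countable_topology} measure topology)"
proof -
  obtain G :: "('a \<Rightarrow> real) set" where G: "countable G"
    and Gc: "\<And>g. g \<in> G \<Longrightarrow> continuous_on UNIV g \<and> bounded (range g)"
    and Gl: "\<And>f \<nu> a. continuous_on UNIV f \<Longrightarrow> bounded (range f) \<Longrightarrow> (\<And>x. f x \<ge> 0) \<Longrightarrow> \<nu> \<in> borel_probs \<Longrightarrow>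
        a < integral\<^sup>L \<nu> f \<Longrightarrow> \<exists>g\<in>G. (\<forall>x. g x \<le> f x) \<and> a < integral\<^sup>L \<nu> g"
    using countable_lower_approximation by metis
  define E where "E \<nu> = restrict (\<lambda>g. integral\<^sup>L \<nu> g) G" for \<nu> :: "'a measure"
  define T where "T = subtopology (product_topology (\<lambda>_. euclideanreal) G) (E ` borel_probs)"
  have mT: "metrizable_space T"
    unfolding T_def using G
    by (intro metrizable_space_subtopology) (auto simp: metrizable_space_product_topology
        intro: metrizable_space_euclidean countable_subset)
  have topT: "topspace T = E ` borel_probs"
    by (auto simp: T_def E_def)
  \<comment> \<open>After a shift by the bound \<open>b\<close> the function is nonnegative. One
    \<open>g\<close> in the family then lies below it with integral above \<open>a + b\<close>, and
    keeping that one coordinate above \<open>a + b\<close> is an open condition.\<close>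
  have ge: "\<exists>W. openin T W \<and> E \<nu> \<in> W \<and> (\<forall>\<kappa>\<in>borel_probs. E \<kappa> \<in> W \<longrightarrow> a < integral\<^sup>L \<kappa> f)"
    if f: "continuous_on UNIV f" "bounded (range f)" and \<nu>: "\<nu> \<in> borel_probs" and a: "a < integral\<^sup>L \<nu> f"
    for f :: "'a \<Rightarrow> real" and a \<nu>
  proof -
    obtain b where b: "\<And>x. \<bar>f x\<bar> \<le> b" using f(2) by (auto simp: bounded_iff)
    have shift: "integral\<^sup>L \<kappa> (\<lambda>x. f x + b) = integral\<^sup>L \<kappa> f + b" if "\<kappa> \<in> borel_probs" for \<kappa>
    proof -
      interpret prob_space \<kappa> using that borel_probs_prob by blast
      show ?thesis using integrable_bdd_continuous[OF that f] by (simp add: prob_space)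
    qed
    have c: "continuous_on UNIV (\<lambda>x. f x + b)" "bounded (range (\<lambda>x. f x + b))"
      using f by (auto intro!: continuous_intros bounded_plus_comp)
    have "\<And>x. f x + b \<ge> 0" using b by (smt (verit))
    then obtain g where g: "g \<in> G" "\<And>x. g x \<le> f x + b" "a + b < integral\<^sup>L \<nu> g"
      using Gl[OF c, of \<nu> "a + b"] \<nu> a shift by auto
    define W where "W = {e \<in> topspace T. e g \<in> {a + b<..}}"
    have "continuous_map T euclideanreal (\<lambda>e. e g)"
      unfolding T_def by (intro continuous_map_from_subtopology continuous_map_product_projection g)
    then have "openin T W"
      unfolding W_def by (rule openin_continuous_map_preimage) auto
    moreover have "E \<nu> \<in> W" using g \<nu> by (auto simp: W_def topT E_def)
    moreover have "a < integral\<^sup>L \<kappa> f" if \<kappa>: "\<kappa> \<in> borel_probs" and "E \<kappa> \<in> W" for \<kappa>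
    proof -
      have "a + b < integral\<^sup>L \<kappa> g" using that g by (auto simp: W_def E_def)
      also have "\<dots> \<le> integral\<^sup>L \<kappa> (\<lambda>x. f x + b)"
        using \<kappa> g Gc c by (intro integral_mono integrable_bdd_continuous) auto
      finally show ?thesis using shift \<kappa> by simp
    qed
    ultimately show ?thesis by blast
  qed
  have inj: "inj_on E borel_probs"
  proof (rule inj_onI, rule borel_probs_eqI)
    fix \<mu> \<nu> :: "'a measure" and f :: "'a \<Rightarrow> real"
    assume *: "\<mu> \<in> borel_probs" "\<nu> \<in> borel_probs" "E \<mu> = E \<nu>" "continuous_on UNIV f" "bounded (range f)"
    have "\<not> integral\<^sup>L \<kappa> f < integral\<^sup>L \<kappa>' f" if "\<kappa> \<in> borel_probs" "\<kappa>' \<in> borel_probs" "E \<kappa> = E \<kappa>'" for \<kappa> \<kappa>'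
      using ge[of f \<kappa>' "integral\<^sup>L \<kappa> f"] * that by force
    then show "integral\<^sup>L \<mu> f = integral\<^sup>L \<nu> f" using * by (metis linorder_less_linear)
  qed auto
  define E' where "E' = inv_into borel_probs E"
  have E': "E' (E \<nu>) = \<nu>" if "\<nu> \<in> borel_probs" for \<nu>
    using inj that by (simp add: E'_def)
  have cE: "continuous_map weak_topology T E"
    unfolding T_def continuous_map_in_subtopology continuous_map_componentwise
  proof (intro conjI ballI)
    fix g assume g: "g \<in> G"
    have "continuous_map weak_topology euclideanreal (\<lambda>\<nu>. integral\<^sup>L \<nu> g)"
      unfolding continuous_map_def
    proof safe
      fix U :: "real set" assume "openin euclideanreal U"
      then have "open U" by simp
      then show "openin weak_topology {x \<in> topspace weak_topology. integral\<^sup>L x g \<in> U}"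
        unfolding topspace_weak_topology unfolding weak_topology_def
        using Gc[OF g]
        by (intro topology_generated_by_Basis CollectI exI[of _ g] exI[of _ U]) auto
    qed auto
    then show "continuous_map weak_topology euclideanreal (\<lambda>x. E x g)"
      using g by (simp add: E_def)
  qed (auto simp: E_def)
  have cE': "continuous_map T weak_topology E'"
    unfolding weak_topology_def continuous_on_generated_topo_iff
  proof safe
    fix f :: "'a \<Rightarrow> real" and U :: "real set"
    assume f: "continuous_on UNIV f" "bounded (range f)" and U: "open U"
    show "openin T (E' -` {\<nu> \<in> borel_probs. integral\<^sup>L \<nu> f \<in> U} \<inter> topspace T)"
    proof (subst openin_subopen, safe)
      fix e assume e: "e \<in> topspace T" "E' e \<in> borel_probs" "integral\<^sup>L (E' e) f \<in> U"
      define \<nu> where "\<nu> = E' e"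
      have \<nu>: "\<nu> \<in> borel_probs" "e = E \<nu>" "integral\<^sup>L \<nu> f \<in> U"
        using e E' by (auto simp: \<nu>_def topT)
      obtain r where r: "r > 0" "ball (integral\<^sup>L \<nu> f) r \<subseteq> U"
        using U \<nu>(3) open_contains_ball by blast
      obtain W where W: "openin T W" "E \<nu> \<in> W"
        "\<And>\<kappa>. \<kappa>\<in>borel_probs \<Longrightarrow> E \<kappa> \<in> W \<Longrightarrow> integral\<^sup>L \<nu> f - r < integral\<^sup>L \<kappa> f"
        using ge[OF f \<nu>(1), of "integral\<^sup>L \<nu> f - r"] r by auto
      \<comment> \<open>The bound from above is the bound from below for the negated
        function.\<close>
      have f': "continuous_on UNIV (\<lambda>x. - f x)" "bounded (range (\<lambda>x. - f x))"
        using f by (auto intro!: continuous_intros simp: bounded_iff)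
      obtain W' where W': "openin T W'" "E \<nu> \<in> W'"
        "\<And>\<kappa>. \<kappa>\<in>borel_probs \<Longrightarrow> E \<kappa> \<in> W' \<Longrightarrow> - integral\<^sup>L \<nu> f - r < - integral\<^sup>L \<kappa> f"
        using ge[OF f' \<nu>(1), of "- integral\<^sup>L \<nu> f - r"] r by auto
      have "W \<inter> W' \<subseteq> E' -` {\<nu> \<in> borel_probs. integral\<^sup>L \<nu> f \<in> U} \<inter> topspace T"
      proof
        fix x assume x: "x \<in> W \<inter> W'"
        then have "x \<in> topspace T" using W(1) openin_subset by blast
        then obtain \<kappa> where \<kappa>: "x = E \<kappa>" "\<kappa> \<in> borel_probs" by (auto simp: topT)
        then have "integral\<^sup>L \<kappa> f \<in> ball (integral\<^sup>L \<nu> f) r"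
          using W(3)[of \<kappa>] W'(3)[of \<kappa>] x by (auto simp: dist_real_def)
        then show "x \<in> E' -` {\<nu> \<in> borel_probs. integral\<^sup>L \<nu> f \<in> U} \<inter> topspace T"
          using \<kappa> r E' by (auto simp: topT)
      qed
      then show "\<exists>W. openin T W \<and> e \<in> W \<and> W \<subseteq> E' -` {\<nu> \<in> borel_probs. integral\<^sup>L \<nu> f \<in> U} \<inter> topspace T"
        using W W' \<nu> by (intro exI[of _ "W \<inter> W'"]) auto
    qed
  next
    fix x assume "x \<in> topspace T"
    then have "E' x \<in> topspace weak_topology" using E' by (auto simp: topT)
    then show "E' x \<in> \<Union>{{\<nu> \<in> borel_probs. integral\<^sup>L \<nu> f \<in> U} | f U.
        continuous_on UNIV (f :: 'a \<Rightarrow> real) \<and> bounded (range f) \<and> open U}"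
      unfolding weak_topology_def topology_generated_by_topspace .
  qed
  have "homeomorphic_maps (weak_topology :: 'a measure topology) T E E'"
    unfolding homeomorphic_maps_def using cE cE' E' by (auto simp: topT)
  then have "(weak_topology :: 'a measure topology) homeomorphic_space T"
    unfolding homeomorphic_space_def by blast
  then show ?thesis using mT homeomorphic_metrizable_space by blast
qed

section \<open>Prokhorov's theorem\<close>

text \<open>With the digits 0 and 2, two reals closer than \<open>3\<^sup>-\<^sup>k\<close> have the same first \<open>k\<close> digits.  A point will be
  coded by its memberships in the sets of a countable base.\<close>

definition ternary :: "(nat \<Rightarrow> bool) \<Rightarrow> real" where
  "ternary b = (\<Sum>k. (if b k then 2 else 0) * (1/3) ^ Suc k)"

text \<open>The sum is the most that the digits from position \<open>m\<close> on can contribute to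
  a value of \<open>ternary\<close>.\<close>

lemma sums_ternary_tail: "(\<lambda>k. 2 * (1/3::real) ^ Suc (k + m)) sums ((1/3) ^ m)"
proof -
  have "(\<lambda>k. (2 * (1/3) ^ Suc m) * (1/3::real) ^ k) sums ((2 * (1/3) ^ Suc m) * (1 / (1 - 1/3)))"
    by (intro sums_mult geometric_sums) auto
  then show ?thesis by (simp add: power_add mult_ac)
qed

lemma summable_ternary: "summable (\<lambda>k. (if b k then 2 else 0) * (1/3::real) ^ Suc k)"
proof (rule summable_comparison_test')
  show "summable (\<lambda>k. 2 * (1/3::real) ^ Suc (k + 0))"
    using sums_ternary_tail by (rule sums_summable)
qed auto

lemma ternary_bounds: "0 \<le> ternary b" "ternary b \<le> 1"
proof -
  show "0 \<le> ternary b" unfolding ternary_def by (intro suminf_nonneg summable_ternary) auto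
  have "ternary b \<le> (\<Sum>k. 2 * (1/3::real) ^ Suc k)"
    unfolding ternary_def using summable_ternary[of "\<lambda>_. True"]
    by (intro suminf_le summable_ternary) auto
  then show "ternary b \<le> 1" using sums_ternary_tail[of 0] by (simp add: sums_iff)
qed

text \<open>The first differing digit, at position \<open>m \<le> k\<close>, separates the values by
  \<open>2 * (1/3) ^ Suc m\<close>, and all later digits together can make up for at most half of
  that.\<close>

lemma ternary_digits:
  assumes "\<bar>ternary b - ternary d\<bar> < (1/3) ^ Suc k"
  shows "b k = d k"
proof (rule ccontr)
  assume neq: "b k \<noteq> d k"
  define m where "m = (LEAST k. b k \<noteq> d k)"
  have m: "b m \<noteq> d m" unfolding m_def using neq by (rule LeastI)
  have least: "b l = d l" if "l < m" for l
    using not_less_Least[of l "\<lambda>k. b k \<noteq> d k"] that by (auto simp: m_def)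
  have mk: "m \<le> k" unfolding m_def using neq by (rule Least_le)
  have main: "(1/3) ^ Suc m \<le> ternary b - ternary d"
    if m: "b m" "\<not> d m" and least: "\<And>l. l < m \<Longrightarrow> b l = d l" for b d
  proof -
    define e where "e l = (if b l then 2 else 0) * (1/3::real) ^ Suc l - (if d l then 2 else 0) * (1/3) ^ Suc l" for l
    have sm: "summable e"
      unfolding e_def by (intro summable_diff summable_ternary)
    have "ternary b - ternary d = suminf e"
      unfolding ternary_def e_def by (intro suminf_diff summable_ternary)
    also have "\<dots> = (\<Sum>l. e (l + Suc m)) + sum e {..<Suc m}"
      by (rule suminf_split_initial_segment[OF sm])
    also have "sum e {..<Suc m} = 2 * (1/3) ^ Suc m"
      using m least by (simp add: e_def)
    finally have "ternary b - ternary d = (\<Sum>l. e (l + Suc m)) + 2 * (1/3) ^ Suc m" .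
    moreover have "(\<Sum>l. - (2 * (1/3::real) ^ Suc (l + Suc m))) \<le> (\<Sum>l. e (l + Suc m))"
    proof (rule suminf_le)
      show "summable (\<lambda>l. - (2 * (1/3::real) ^ Suc (l + Suc m)))"
        using sums_ternary_tail[of "Suc m"] by (intro summable_minus) (auto simp: sums_iff)
      show "summable (\<lambda>l. e (l + Suc m))" using sm by (rule summable_ignore_initial_segment)
    qed (auto simp: e_def)
    moreover have "(\<Sum>l. - (2 * (1/3::real) ^ Suc (l + Suc m))) = - ((1/3) ^ Suc m)"
      using sums_minus[OF sums_ternary_tail[of "Suc m"]] by (simp add: sums_iff)
    ultimately show ?thesis by simp
  qed
  have "(1/3) ^ Suc m \<le> \<bar>ternary b - ternary d\<bar>"
  proof (cases "b m")
    case True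
    then have "(1/3) ^ Suc m \<le> ternary b - ternary d" using m least by (intro main) auto
    then show ?thesis by linarith
  next
    case False
    then have "(1/3) ^ Suc m \<le> ternary d - ternary b" using m least by (intro main) auto
    then show ?thesis by linarith
  qed
  moreover have "(1/3::real) ^ Suc k \<le> (1/3) ^ Suc m"
    using mk by (intro power_decreasing) auto
  ultimately show False using assms by linarith
qed

lemma real_distribution_distr:
  assumes "\<mu> \<in> borel_probs" "\<phi> \<in> borel_measurable borel"
  shows "real_distribution (distr \<mu> borel \<phi>)"
  using distr_borel_probs[OF assms]
  by (auto simp: borel_probs_iff real_distribution_def real_distribution_axioms_def)

text \<open>The measures are coded on \<open>[0,1]\<close>, where Helly's theorem yields a limit.  Coding is only Borel, but on the
  closure of the code of a compact set it has a continuous inverse, whose graph is the closure of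
  the graph of the coding; by tightness the limit is carried by such sets and can be decoded.\<close>

theorem prokhorov:
  fixes s :: "nat \<Rightarrow> 'a::{metric_space, second_countable_topology} measure"
  assumes s: "\<And>n. s n \<in> borel_probs"
    and tight: "\<And>e. e > 0 \<Longrightarrow> \<exists>K. compact K \<and> (\<forall>n. measure (s n) (- K) \<le> e)"
  obtains r l where "strict_mono r" "l \<in> borel_probs" "weakly_conv (s \<circ> r) l"
proof -
  obtain \<B> :: "'a set set" where \<B>: "countable \<B>" "topological_basis \<B>"
    using ex_countable_basis by blast
  have Bne: "\<B> \<noteq> {}"
    using \<B>(2) topological_basisE[of \<B> UNIV undefined] by blast
  define C where "C = from_nat_into \<B>"
  have rC: "range C = \<B>" unfolding C_def using \<B> Bne by (intro range_from_nat_into)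
  have oC: "open (C k)" for k using rC topological_basis_open[OF \<B>(2)] by blast
  define \<phi> where "\<phi> x = ternary (\<lambda>k. x \<in> C k)" for x
  have m\<phi>[measurable]: "\<phi> \<in> borel_measurable borel"
  proof -
    have [measurable]: "C k \<in> sets borel" for k using oC by simp
    show ?thesis unfolding \<phi>_def ternary_def by measurable
  qed
  \<comment> \<open>The code comes first because the closure will be read as the graph of the
    decoding map \<open>g\<close>, possibly defined on more codes than those attained.\<close>
  define R0 where "R0 = closure (range (\<lambda>u. (\<phi> u, u)))"
  have near: "\<exists>u. \<phi> u \<in> W \<and> u \<in> V" if "(t, x) \<in> R0" "open W" "open V" "t \<in> W" "x \<in> V" for t x W V
  proof -
    have "(W \<times> V) \<inter> range (\<lambda>u. (\<phi> u, u)) \<noteq> {}"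
      using that open_Int_closure_eq_empty[OF open_Times[OF that(2,3)]] unfolding R0_def by blast
    then show ?thesis by blast
  qed
  \<comment> \<open>If \<open>x \<noteq> y\<close>, a basic set \<open>C k\<close> around
    \<open>x\<close> lies in a ball whose closure misses \<open>y\<close>. Graph points near
    \<open>(t, x)\<close> and \<open>(t, y)\<close> have codes closer than
    \<open>(1/3) ^ Suc k\<close>, so they agree on membership in \<open>C k\<close>, although one is
    inside and the other outside.\<close>
  have uniq: "x = y" if x: "(t, x) \<in> R0" and y: "(t, y) \<in> R0" for t x y
  proof (rule ccontr)
    assume "x \<noteq> y"
    define V where "V = ball x (dist x y / 2)"
    have V: "open V" "x \<in> V" "y \<notin> closure V"
      using \<open>x \<noteq> y\<close> closure_minimal[OF ball_subset_cball closed_cball, of x "dist x y / 2"] by (auto simp: V_def)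
    obtain k where k: "x \<in> C k" "C k \<subseteq> V"
      using V(1,2) \<B>(2) rC topological_basisE by (metis imageE)
    define e where "e = (1/3::real) ^ Suc k / 2"
    have e: "e > 0" by (simp add: e_def)
    obtain u where u: "dist t (\<phi> u) < e" "u \<in> C k"
      using near[OF x open_ball oC[of k], of t e] k e by auto
    have "open (- closure V)" "y \<in> - closure V" using V by auto
    then obtain v where v: "dist t (\<phi> v) < e" "v \<notin> closure V"
      using near[OF y open_ball, of "- closure V" t e] e by auto
    have "v \<notin> C k" using v k closure_subset by blast
    have "\<bar>\<phi> u - \<phi> v\<bar> < (1/3) ^ Suc k"
      using u(1) v(1) unfolding e_def dist_real_def by linarith
    then have "(u \<in> C k) = (v \<in> C k)" unfolding \<phi>_def by (rule ternary_digits)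
    with u \<open>v \<notin> C k\<close> show False by blast
  qed
  have memR0: "(\<phi> x, x) \<in> R0" for x unfolding R0_def by (rule subsetD[OF closure_subset]) simp
  obtain K where K: "\<And>m::nat. compact (K m)" "\<And>m n. measure (s n) (- K m) \<le> 1 / Suc m"
  proof -
    have "\<forall>m::nat. \<exists>K. compact K \<and> (\<forall>n. measure (s n) (- K) \<le> 1 / Suc m)"
      by (intro allI tight) simp
    then show ?thesis using that by metis
  qed
  have Kb: "K m \<in> sets borel" for m using K(1) by (simp add: borel_closed compact_imp_closed)
  define g where "g t = (THE x. (t, x) \<in> R0)" for t
  have g: "g t = x" if "(t, x) \<in> R0" for t x
    unfolding g_def using that uniq by blast
  \<comment> \<open>All codes lie in \<open>{0..1}\<close>, so this is the projection of a compact
    part of the closed graph; it contains the codes of the points of \<open>K m\<close>.\<close>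
  define D where "D m = fst ` (R0 \<inter> ({0..1} \<times> K m))" for m
  have Rc: "compact (R0 \<inter> ({0..1} \<times> Z))" if "compact Z" for Z
    unfolding R0_def using that by (intro closed_Int_compact compact_Times) auto
  have D: "compact (D m)" for m
    unfolding D_def using K(1) by (intro compact_continuous_image Rc continuous_on_fst continuous_on_id)
  have \<phi>D: "\<phi> x \<in> D m" if "x \<in> K m" for x m
    unfolding D_def using that memR0 ternary_bounds
    by (intro image_eqI[of _ _ "(\<phi> x, x)"]) (auto simp: \<phi>_def)
  \<comment> \<open>A map with closed graph and values in a compact set is continuous: the preimage
    of a closed set is again the projection of a compact part of \<open>R0\<close>.\<close>
  have cg: "continuous_on (D m) g" for m
    unfolding continuous_on_closed_vimage[OF compact_imp_closed[OF D]]
  proof safe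
    fix B :: "'a set" assume B: "closed B"
    have "g -` B \<inter> D m = fst ` (R0 \<inter> ({0..1} \<times> (K m \<inter> B)))"
    proof (intro equalityI subsetI)
      fix t assume "t \<in> g -` B \<inter> D m"
      then obtain x where "(t, x) \<in> R0" "t \<in> {0..1}" "x \<in> K m" "g t \<in> B" by (auto simp: D_def)
      then show "t \<in> fst ` (R0 \<inter> ({0..1} \<times> (K m \<inter> B)))"
        using g by (intro image_eqI[of _ _ "(t, x)"]) auto
    next
      fix t assume "t \<in> fst ` (R0 \<inter> ({0..1} \<times> (K m \<inter> B)))"
      then obtain x where "(t, x) \<in> R0" "t \<in> {0..1}" "x \<in> K m" "x \<in> B" by auto
      then show "t \<in> g -` B \<inter> D m" using g by (auto simp: D_def intro!: image_eqI[of _ _ "(t, x)"])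
    qed
    moreover have "compact (fst ` (R0 \<inter> ({0..1} \<times> (K m \<inter> B))))"
      using K(1) B by (intro compact_continuous_image Rc continuous_on_fst continuous_on_id compact_Int_closed)
    ultimately show "closed (g -` B \<inter> D m)" using compact_imp_closed by metis
  qed
  define M where "M n = distr (s n) borel \<phi>" for n
  have M: "real_distribution (M n)" for n
    unfolding M_def using s by (intro real_distribution_distr) auto
  have M_pr: "M n \<in> borel_probs" for n
    unfolding M_def using s by (intro distr_borel_probs) auto
  have "tight M"
    unfolding tight_def
  proof (intro conjI allI impI M, rule exI[of _ "-1"], rule exI[of _ 1], intro conjI allI)
    fix e :: real and n assume e: "0 < e"
    interpret prob_space "s n" using s borel_probs_prob by blast
    have "measure (M n) {-1<..1} = measure (s n) (\<phi> -` {-1<..1} \<inter> space (s n))"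
      unfolding M_def using s by (intro measure_distr) (auto simp: borel_probs_measurable)
    also have "\<phi> -` {-1<..1} \<inter> space (s n) = space (s n)"
      using less_le_trans[OF _ ternary_bounds(1), of "-1"] ternary_bounds(2) by (auto simp: \<phi>_def)
    finally show "1 - e < measure (M n) {-1<..1}" using e by (simp add: prob_space)
  qed auto
  then obtain r N where r: "strict_mono r" and N: "real_distribution N" and wc: "weak_conv_m (M \<circ> id \<circ> r) N"
    using tight_imp_convergent_subsubsequence[of M id] by (auto simp: strict_mono_def)
  interpret N: real_distribution N by fact
  have conv: "(\<lambda>n. integral\<^sup>L (M (r n)) f) \<longlonglongrightarrow> integral\<^sup>L N f"
    if f: "continuous_on UNIV f" "\<And>x. \<bar>f x\<bar> \<le> b" for f :: "real \<Rightarrow> real" and b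
    using weak_conv_imp_integral_bdd_continuous_conv[of "M \<circ> r" N f b] wc f M N
    by (auto simp: continuous_on_eq_continuous_at)
  have N_pr: "N \<in> borel_probs" by (auto simp: borel_probs_iff N.prob_space_axioms)
  \<comment> \<open>Hats over the open set \<open>- D m\<close> vanish at the codes of the points of
    \<open>K m\<close>, so the tightness bound passes to the limit on the line.\<close>
  have ND: "measure N (- D m) \<le> 1 / Suc m" for m
  proof -
    have "(\<lambda>k. integral\<^sup>L N (hat (- D m) k)) \<longlonglongrightarrow> measure N (- D m)"
      using N_pr D by (intro integral_hat_tendsto) (auto simp: compact_imp_closed)
    moreover have "integral\<^sup>L N (hat (- D m) k) \<le> 1 / Suc m" for k
    proof (rule LIMSEQ_le_const2[OF conv[of _ 1]])
      show "\<exists>N. \<forall>n\<ge>N. integral\<^sup>L (M (r n)) (hat (- D m) k) \<le> 1 / Suc m"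
      proof (intro exI allI impI)
        fix n
        interpret prob_space "s (r n)" using s borel_probs_prob by blast
        have "integral\<^sup>L (M (r n)) (hat (- D m) k) = integral\<^sup>L (s (r n)) (\<lambda>x. hat (- D m) k (\<phi> x))"
          unfolding M_def using s
          by (intro integral_distr) (auto simp: borel_probs_measurable hat_continuous
              intro: borel_measurable_continuous_onI)
        also have "\<dots> \<le> integral\<^sup>L (s (r n)) (indicator (- K m))"
        proof (rule integral_mono')
          show "integrable (s (r n)) (indicat_real (- K m))"
            using Kb[of m] s[of "r n"]
            by (intro integrable_real_indicator) (auto simp: borel_probs_sets emeasure_eq_measure)
          show "hat (- D m) k (\<phi> x) \<le> indicat_real (- K m) x" for x
            using \<phi>D[of x m] by (cases "x \<in> K m") (auto simp: hat_eq_0 hat_le_1)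
        qed (auto simp: hat_nonneg)
        also have "\<dots> = measure (s (r n)) (- K m)"
          using Kb[of m] s[of "r n"] by (simp add: borel_probs_sets)
        finally show "integral\<^sup>L (M (r n)) (hat (- D m) k) \<le> 1 / Suc m" using K(2) order_trans by blast
      qed
    qed (auto simp: hat_continuous hat_nonneg hat_le_1)
    ultimately show ?thesis
      by (intro LIMSEQ_le_const2) auto
  qed
  \<comment> \<open>The default value sits on a null set of \<open>N\<close>, by \<open>ND\<close>.
    Being continuous on countably many closed pieces and constant on the remainder,
    \<open>g'\<close> is Borel on the whole line.\<close>
  define g' where "g' t = (if t \<in> (\<Union>m. D m) then g t else undefined)" for t
  have mg: "g' \<in> borel_measurable borel"
  proof -
    have Db: "D m \<in> sets borel" for m using D by (simp add: borel_closed compact_imp_closed)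
    show ?thesis
    proof (rule measurable_piecewise_restrict[where C="insert (- (\<Union>m. D m)) (range D)"])
      fix \<Omega> assume \<Omega>: "\<Omega> \<in> insert (- (\<Union>m. D m)) (range D)"
      then consider "\<Omega> = - (\<Union>m. D m)" | m where "\<Omega> = D m" by blast
      then show "g' \<in> restrict_space borel \<Omega> \<rightarrow>\<^sub>M borel"
      proof cases
        case 1
        then have "g' \<in> restrict_space borel \<Omega> \<rightarrow>\<^sub>M borel \<longleftrightarrow> (\<lambda>_. undefined :: 'a) \<in> restrict_space borel \<Omega> \<rightarrow>\<^sub>M borel"
          by (intro measurable_cong) (auto simp: g'_def space_restrict_space)
        then show ?thesis by simp
      next
        case 2
        then have "continuous_on \<Omega> g'"
          using cg[of m] by (auto simp: g'_def elim!: continuous_on_eq)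
        then show ?thesis by (rule borel_measurable_continuous_on_restrict)
      qed
      show "\<Omega> \<inter> space borel \<in> sets borel" using \<Omega> Db by auto
    qed auto
  qed
  define l where "l = distr N borel g'"
  have l: "l \<in> borel_probs" unfolding l_def using N_pr mg by (rule distr_borel_probs)
  have "weakly_conv (s \<circ> r) l"
    unfolding weakly_conv_def
  proof safe
    fix f :: "'a \<Rightarrow> real" assume f: "continuous_on UNIV f" "bounded (range f)"
    obtain b where b: "\<And>x. \<bar>f x\<bar> \<le> b" using f(2) by (auto simp: bounded_iff)
    have b0: "b \<ge> 0" using b[of undefined] by simp
    have mf[measurable]: "f \<in> borel_measurable borel" using f(1) by (rule borel_measurable_continuous_onI)
    have tail: "\<bar>integral\<^sup>L \<kappa> p - integral\<^sup>L \<kappa> q\<bar> \<le> 2 * b * measure \<kappa> (- Z)"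
      if "\<kappa> \<in> borel_probs" "p \<in> borel_measurable borel" "q \<in> borel_measurable borel"
        "Z \<in> sets borel" "\<And>x. x \<in> Z \<Longrightarrow> p x = q x" "\<And>x. \<bar>p x\<bar> \<le> b" "\<And>x. \<bar>q x\<bar> \<le> b"
      for \<kappa> and p q :: "'z::topological_space \<Rightarrow> real" and Z
    proof -
      interpret prob_space \<kappa> using that borel_probs_prob by blast
      have i: "integrable \<kappa> p" "integrable \<kappa> q"
        using that by (auto intro!: integrable_const_bound[where B=b] simp: borel_probs_measurable)
      have "\<bar>integral\<^sup>L \<kappa> p - integral\<^sup>L \<kappa> q\<bar> = \<bar>integral\<^sup>L \<kappa> (\<lambda>x. p x - q x)\<bar>" using i by simp
      also have "\<dots> \<le> integral\<^sup>L \<kappa> (\<lambda>x. \<bar>p x - q x\<bar>)" by (rule integral_abs_bound)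
      also have "\<dots> \<le> integral\<^sup>L \<kappa> (\<lambda>x. 2 * b * indicator (- Z) x)"
      proof (rule integral_mono)
        show "integrable \<kappa> (\<lambda>x. 2 * b * indicat_real (- Z) x)"
          using that
          by (intro integrable_mult_right integrable_real_indicator) (auto simp: borel_probs_sets emeasure_eq_measure)
        show "\<bar>p x - q x\<bar> \<le> 2 * b * indicat_real (- Z) x" for x
          using that(5)[of x] that(6)[of x] that(7)[of x] by (cases "x \<in> Z") auto
      qed (use i in auto)
      also have "\<dots> = 2 * b * measure \<kappa> (- Z)" using that by (simp add: borel_probs_sets)
      finally show ?thesis .
    qed
    show "(\<lambda>n. integral\<^sup>L ((s \<circ> r) n) f) \<longlonglongrightarrow> integral\<^sup>L l f"
    proof (rule LIMSEQ_I)
      fix e :: real assume e: "0 < e"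
      \<comment> \<open>One third of \<open>e\<close> goes to decoding under \<open>N\<close>, one
        to coding under the measures \<open>s n\<close>, and one to weak convergence on the
        line.\<close>
      obtain m :: nat where m: "2 * b / Suc m < e / 3"
      proof -
        obtain m :: nat where "6 * b / e < real m" using reals_Archimedean2 by blast
        then have "6 * b < e * Suc m" using e by (simp add: field_simps)
        then show ?thesis using that[of m] e by (simp add: field_simps)
      qed
      have "continuous_on (D m) (\<lambda>t. f (g t))"
        using continuous_on_compose[OF cg continuous_on_subset[OF f(1)]] by (simp add: o_def)
      \<comment> \<open>Convergence on the line is tested by functions continuous everywhere, so the
        decoded function is extended from the closed set \<open>D m\<close> with the same
        bound.\<close>
      then obtain F where F: "continuous_on UNIV F" "\<And>t. t \<in> D m \<Longrightarrow> F t = f (g t)" "\<And>t. \<bar>F t\<bar> \<le> b"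
        using Tietze[of "D m" "\<lambda>t. f (g t)" UNIV b] D b b0
        by (auto simp: compact_imp_closed)
      have mF[measurable]: "F \<in> borel_measurable borel" using F(1) by (rule borel_measurable_continuous_onI)
      have "integral\<^sup>L l f = integral\<^sup>L N (\<lambda>t. f (g' t))"
        unfolding l_def using mg by (intro integral_distr) auto
      moreover have "\<bar>integral\<^sup>L N (\<lambda>t. f (g' t)) - integral\<^sup>L N F\<bar> \<le> 2 * b * measure N (- D m)"
      proof (intro tail[OF N_pr])
        show "(\<lambda>t. f (g' t)) \<in> borel_measurable borel" using mg mf by measurable
        show "D m \<in> sets borel" using D by (simp add: compact_imp_closed borel_closed)
      qed (use F b mF in \<open>auto simp: g'_def\<close>)
      moreover have "2 * b * measure N (- D m) \<le> 2 * b * (1 / Suc m)"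
        using ND b0 by (intro mult_left_mono) auto
      ultimately have l1: "\<bar>integral\<^sup>L l f - integral\<^sup>L N F\<bar> < e / 3" using m by simp
      have s1: "\<bar>integral\<^sup>L (s n) f - integral\<^sup>L (M n) F\<bar> < e / 3" for n
      proof -
        have "integral\<^sup>L (M n) F = integral\<^sup>L (s n) (\<lambda>x. F (\<phi> x))"
          unfolding M_def using s by (intro integral_distr) (auto simp: borel_probs_measurable)
        moreover have "\<bar>integral\<^sup>L (s n) f - integral\<^sup>L (s n) (\<lambda>x. F (\<phi> x))\<bar> \<le> 2 * b * measure (s n) (- K m)"
          using F b Kb \<phi>D g[OF memR0] by (intro tail[OF s]) auto
        moreover have "2 * b * measure (s n) (- K m) \<le> 2 * b * (1 / Suc m)"
          using K(2) b0 by (intro mult_left_mono) auto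
        ultimately show ?thesis using m by simp
      qed
      obtain n0 where n0: "\<And>n. n \<ge> n0 \<Longrightarrow> norm (integral\<^sup>L (M (r n)) F - integral\<^sup>L N F) < e / 3"
        using LIMSEQ_D[OF conv[OF F(1,3)], of "e / 3"] e by auto
      show "\<exists>no. \<forall>n\<ge>no. norm (integral\<^sup>L ((s \<circ> r) n) f - integral\<^sup>L l f) < e"
      proof (intro exI allI impI)
        fix n assume "n \<ge> n0"
        from n0[OF this] l1 s1[of "r n"]
        show "norm (integral\<^sup>L ((s \<circ> r) n) f - integral\<^sup>L l f) < e" by (simp add: abs_if split: if_splits)
      qed
    qed
  qed
  with r l show ?thesis by (rule that)
qed

section \<open>Subsequences and sequential criteria in the weak topology\<close>

lemma strict_mono_subseq_of_frequently:
  fixes Q :: "nat \<Rightarrow> bool"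
  assumes "\<not> eventually (\<lambda>n. \<not> Q n) sequentially"
  obtains r :: "nat \<Rightarrow> nat" where "strict_mono r" "\<And>n. Q (r n)"
proof -
  have "infinite {n. Q n}"
    using assms by (auto simp: eventually_sequentially infinite_nat_iff_unbounded_le)
  then show ?thesis
    using that by (metis (mono_tags, lifting) infinite_enumerate mem_Collect_eq)
qed

lemma subseq_less_of_liminf:
  fixes u :: "nat \<Rightarrow> ennreal"
  assumes "liminf u < a"
  obtains r :: "nat \<Rightarrow> nat" where "strict_mono r" "\<And>n. u (r n) < a"
proof (rule strict_mono_subseq_of_frequently)
  show "\<not> eventually (\<lambda>n. \<not> u n < a) sequentially"
  proof
    assume "eventually (\<lambda>n. \<not> u n < a) sequentially"
    then have "a \<le> liminf u" by (intro Liminf_bounded) (simp add: not_less)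
    with assms show False by simp
  qed
qed (use that in blast)

lemma closedin_weak_topology_sequentially:
  fixes S :: "'a::{metric_space, second_countable_topology} measure set"
  shows "closedin weak_topology S \<longleftrightarrow> S \<subseteq> borel_probs \<and>
    (\<forall>s l. range s \<subseteq> S \<and> l \<in> borel_probs \<and> weakly_conv s l \<longrightarrow> l \<in> S)"
proof -
  obtain M d where M: "Metric_space M d" and W: "(weak_topology :: 'a measure topology) = Metric_space.mtopology M d"
    using metrizable_weak_topology unfolding metrizable_space_def by blast
  interpret Metric_space M d by (rule M)
  have "M = borel_probs" using topspace_weak_topology W by (metis topspace_mtopology)
  moreover have "limitin mtopology s l sequentially \<longleftrightarrow> l \<in> borel_probs \<and> weakly_conv s l"
    if "range s \<subseteq> S" "S \<subseteq> borel_probs" for s l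
    using limitin_weak_topology[of s l] that limitin_topspace[of weak_topology s l sequentially]
    unfolding W[symmetric] topspace_weak_topology by blast
  ultimately show ?thesis
    unfolding W metric_closedin_iff_sequentially_closed by blast
qed

lemma compactin_weak_topology_sequentially:
  fixes S :: "'a::{metric_space, second_countable_topology} measure set"
  shows "compactin weak_topology S \<longleftrightarrow> S \<subseteq> borel_probs \<and>
    (\<forall>s :: nat \<Rightarrow> 'a measure. range s \<subseteq> S \<longrightarrow> (\<exists>l r. l \<in> S \<and> strict_mono r \<and> weakly_conv (s \<circ> r) l))"
proof -
  obtain M d where M: "Metric_space M d" and W: "(weak_topology :: 'a measure topology) = Metric_space.mtopology M d"
    using metrizable_weak_topology unfolding metrizable_space_def by blast
  interpret Metric_space M d by (rule M)
  have M: "M = borel_probs" using topspace_weak_topology W by (metis topspace_mtopology)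
  show ?thesis
  proof (cases "S \<subseteq> borel_probs")
    case True
    have "limitin mtopology (s \<circ> r) l sequentially \<longleftrightarrow> weakly_conv (s \<circ> r) l"
      if "range s \<subseteq> S" "l \<in> S" for s l and r :: "nat \<Rightarrow> nat"
      unfolding W[symmetric] using that True by (intro limitin_weak_topology) auto
    then have "(\<exists>l r. l \<in> S \<and> strict_mono r \<and> limitin mtopology (s \<circ> r) l sequentially) \<longleftrightarrow>
        (\<exists>l r. l \<in> S \<and> strict_mono r \<and> weakly_conv (s \<circ> r) l)"
      if "range s \<subseteq> S" for s :: "nat \<Rightarrow> 'a measure"
      using that by (intro ex_cong1 conj_cong refl) auto
    with M show ?thesis
      unfolding W compactin_sequentially by simp
  qed (use compactin_subset_topspace[of weak_topology S] in auto)
qed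

lemma weakly_conv_unique:
  fixes l l' :: "'a::metric_space measure"
  assumes "weakly_conv s l" "weakly_conv s l'" "l \<in> borel_probs" "l' \<in> borel_probs"
  shows "l = l'"
  using assms by (intro borel_probs_eqI) (auto simp: weakly_conv_def intro: LIMSEQ_unique)

text \<open>Truncations of \<open>h\<close> are bounded and continuous, so their integrals converge;
  they increase to \<open>h\<close>, and the bound survives the supremum over the truncation
  level.\<close>

lemma nn_integral_le_liminf_weakly_conv:
  fixes h :: "'a::topological_space \<Rightarrow> real"
  assumes w: "weakly_conv s l" and s: "\<And>n. s n \<in> borel_probs" and l: "l \<in> borel_probs"
    and h: "continuous_on UNIV h" "\<And>x. h x \<ge> 0"
  shows "(\<integral>\<^sup>+x. ennreal (h x) \<partial>l) \<le> liminf (\<lambda>n. \<integral>\<^sup>+x. ennreal (h x) \<partial>s n)"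
proof -
  have [measurable]: "h \<in> borel_measurable borel" using h(1) by (rule borel_measurable_continuous_onI)
  have hl: "h \<in> borel_measurable l" using l by (simp add: borel_probs_measurable)
  define k where "k N x = min (h x) (real N)" for N x
  have k: "continuous_on UNIV (k N)" "bounded (range (k N))" "\<And>x. k N x \<ge> 0" for N
    using h by (auto simp: k_def bounded_iff intro!: continuous_intros exI[of _ "real N"])
  have nn: "(\<integral>\<^sup>+x. ennreal (k N x) \<partial>\<mu>) = ennreal (integral\<^sup>L \<mu> (k N))" if "\<mu> \<in> borel_probs" for \<mu> N
    using k that by (intro nn_integral_eq_integral integrable_bdd_continuous) auto
  have le: "(\<integral>\<^sup>+x. ennreal (k N x) \<partial>l) \<le> liminf (\<lambda>n. \<integral>\<^sup>+x. ennreal (h x) \<partial>s n)" for N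
  proof -
    have "(\<lambda>n. ennreal (integral\<^sup>L (s n) (k N))) \<longlonglongrightarrow> ennreal (integral\<^sup>L l (k N))"
      using w k by (intro tendsto_ennrealI) (auto simp: weakly_conv_def)
    then have "(\<integral>\<^sup>+x. ennreal (k N x) \<partial>l) = liminf (\<lambda>n. \<integral>\<^sup>+x. ennreal (k N x) \<partial>s n)"
      using nn s l lim_imp_Liminf[OF sequentially_bot] by (metis (no_types, lifting) ext)
    also have "\<dots> \<le> liminf (\<lambda>n. \<integral>\<^sup>+x. ennreal (h x) \<partial>s n)"
      by (intro Liminf_mono always_eventually allI nn_integral_mono) (auto simp: k_def ennreal_leI)
    finally show ?thesis .
  qed
  have sup: "ennreal (h x) = (SUP N. ennreal (k N x))" for x
  proof (rule antisym)
    obtain N where "h x \<le> real N" using real_arch_simple by blast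
    then have "ennreal (h x) = ennreal (k N x)" by (simp add: k_def)
    then show "ennreal (h x) \<le> (SUP N. ennreal (k N x))" by (auto intro: SUP_upper2)
  qed (auto intro!: SUP_least ennreal_leI simp: k_def)
  have "(\<integral>\<^sup>+x. ennreal (h x) \<partial>l) = (SUP N. \<integral>\<^sup>+x. ennreal (k N x) \<partial>l)"
    unfolding sup using hl
    by (intro nn_integral_monotone_convergence_SUP) (auto simp: incseq_def le_fun_def k_def intro!: ennreal_leI)
  then show ?thesis using le by (simp add: SUP_least)
qed

section \<open>Couplings and lower semicontinuity of the transport cost\<close>

abbreviation plan_cost :: "('a \<Rightarrow> 'a \<Rightarrow> real) \<Rightarrow> ('a \<times> 'a) measure \<Rightarrow> ennreal" where
  "plan_cost c \<gamma> \<equiv> \<integral>\<^sup>+z. ennreal (c (fst z) (snd z)) \<partial>\<gamma>"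

lemma transport_cost_eq: "transport_cost c \<mu> \<nu> = (INF \<gamma>\<in>couplings \<mu> \<nu>. plan_cost c \<gamma>)"
  by (simp add: transport_cost_def case_prod_unfold)

lemma transport_cost_le: "\<gamma> \<in> couplings \<mu> \<nu> \<Longrightarrow> transport_cost c \<mu> \<nu> \<le> plan_cost c \<gamma>"
  unfolding transport_cost_eq by (rule INF_lower)

lemma transport_cost_less:
  assumes "transport_cost c \<mu> \<nu> < a" obtains \<gamma> where "\<gamma> \<in> couplings \<mu> \<nu>" "plan_cost c \<gamma> < a"
  using assms unfolding transport_cost_eq INF_less_iff by blast

lemma fst_measurable_borel: "fst \<in> borel_measurable (borel :: ('a::topological_space \<times> 'b::topological_space) measure)"
  and snd_measurable_borel: "snd \<in> borel_measurable (borel :: ('a::topological_space \<times> 'b::topological_space) measure)"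
  by (auto intro!: borel_measurable_continuous_onI continuous_intros)

lemma couplings_borel_probs:
  assumes "\<gamma> \<in> couplings \<mu> \<nu>"
  shows "\<gamma> \<in> borel_probs" "\<mu> \<in> borel_probs" "\<nu> \<in> borel_probs"
  using assms distr_borel_probs[OF _ fst_measurable_borel] distr_borel_probs[OF _ snd_measurable_borel]
  by (auto simp: couplings_def)

lemma nn_integral_coupling:
  assumes "\<gamma> \<in> couplings \<mu> \<nu>" and [measurable]: "f \<in> borel_measurable borel"
  shows "(\<integral>\<^sup>+z. f (fst z) \<partial>\<gamma>) = integral\<^sup>N \<mu> f" "(\<integral>\<^sup>+z. f (snd z) \<partial>\<gamma>) = integral\<^sup>N \<nu> f"
proof -
  have \<gamma>: "\<gamma> \<in> borel_probs" "\<mu> = distr \<gamma> borel fst" "\<nu> = distr \<gamma> borel snd"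
    using assms by (auto simp: couplings_def)
  show "(\<integral>\<^sup>+z. f (fst z) \<partial>\<gamma>) = integral\<^sup>N \<mu> f" "(\<integral>\<^sup>+z. f (snd z) \<partial>\<gamma>) = integral\<^sup>N \<nu> f"
    unfolding \<gamma>(2,3) using \<gamma>(1)
    by (auto intro!: nn_integral_distr[symmetric] simp: borel_probs_measurable fst_measurable_borel snd_measurable_borel)
qed

lemma measure_coupling_compl_Times:
  assumes \<gamma>: "\<gamma> \<in> couplings \<mu> \<nu>" and K: "K \<in> sets borel" "L \<in> sets borel"
  shows "measure \<gamma> (- (K \<times> L)) \<le> measure \<mu> (- K) + measure \<nu> (- L)"
proof -
  interpret prob_space \<gamma> using \<gamma> couplings_borel_probs borel_probs_prob by blast
  have \<gamma>': "\<gamma> \<in> borel_probs" "\<mu> = distr \<gamma> borel fst" "\<nu> = distr \<gamma> borel snd"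
    using assms by (auto simp: couplings_def)
  have sp: "space \<gamma> = UNIV" using \<gamma>' borel_probs_space by blast
  have f: "fst \<in> \<gamma> \<rightarrow>\<^sub>M borel" "snd \<in> \<gamma> \<rightarrow>\<^sub>M borel"
    using \<gamma>'(1) by (simp_all add: borel_probs_measurable fst_measurable_borel snd_measurable_borel)
  have s: "fst -` (- K) \<in> sets \<gamma>" "snd -` (- L) \<in> sets \<gamma>"
    using measurable_sets[OF f(1), of "- K"] measurable_sets[OF f(2), of "- L"] K sp by auto
  have "measure \<gamma> (- (K \<times> L)) \<le> measure \<gamma> (fst -` (- K) \<union> snd -` (- L))"
    using s by (intro finite_measure_mono) auto
  also have "\<dots> \<le> measure \<gamma> (fst -` (- K)) + measure \<gamma> (snd -` (- L))"
    using s by (intro measure_Un_le) auto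
  also have "measure \<gamma> (fst -` (- K)) = measure \<mu> (- K)"
    unfolding \<gamma>' using f K sp by (subst measure_distr) auto
  also have "measure \<gamma> (snd -` (- L)) = measure \<nu> (- L)"
    unfolding \<gamma>' using f K sp by (subst measure_distr) auto
  finally show ?thesis .
qed

section \<open>Costs under the growth and compactness conditions\<close>

locale growth_cost =
  fixes c :: "'a::{metric_space, second_countable_topology} \<Rightarrow> 'a \<Rightarrow> real" and A B :: real
  assumes cost_nonneg: "\<And>x y. c x y \<ge> 0"
    and cost_continuous: "continuous_on UNIV (\<lambda>(x, y). c x y)"
    and cost_consistent: "consistent_cost c"
    and AB_nonneg: "A \<ge> 0" "B \<ge> 0"
    and growth: "\<And>x y z. c x y \<le> A + B * (c x z + c y z)"
        "\<And>x y z. c x y \<le> A + B * (c x z + c z y)"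
        "\<And>x y z. c x y \<le> A + B * (c z x + c y z)"
        "\<And>x y z. c x y \<le> A + B * (c z x + c z y)"
    and compact_balls: "\<exists>x0. \<forall>r\<ge>0. compact {y. c x0 y \<le> r}"
begin

lemma cost_continuous': "continuous_on S (\<lambda>z. c (fst z) (snd z))"
  using cost_continuous by (auto simp: case_prod_unfold intro: continuous_on_subset)

lemma cost_tendsto:
  assumes "(f \<longlongrightarrow> x) F" "(g \<longlongrightarrow> y) F" shows "((\<lambda>t. c (f t) (g t)) \<longlongrightarrow> c x y) F"
  using continuous_on_tendsto_compose[OF cost_continuous'[of UNIV] tendsto_Pair[OF assms]] by simp

lemma cost_continuous_on: "continuous_on S f \<Longrightarrow> continuous_on S g \<Longrightarrow> continuous_on S (\<lambda>t. c (f t) (g t))"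
  using continuous_on_compose2[OF cost_continuous'[of UNIV] continuous_on_Pair[of S f g]] by simp

lemma cost_measurable[measurable]: "(\<lambda>z. c (fst z) (snd z)) \<in> borel_measurable borel"
  by (rule borel_measurable_continuous_onI[OF cost_continuous'])

lemma cost_tendsto_0_iff: "(\<lambda>n. c x (u n)) \<longlonglongrightarrow> 0 \<longleftrightarrow> u \<longlonglongrightarrow> x"
  using cost_consistent unfolding consistent_cost_def by blast

lemma cost_self [simp]: "c x x = 0"
  using cost_tendsto_0_iff[of x "\<lambda>_. x"] by (simp add: LIMSEQ_const_iff)

lemma cost_eq_0: "c x y = 0 \<Longrightarrow> x = y"
  using cost_tendsto_0_iff[of x "\<lambda>_. y"] by (simp add: LIMSEQ_const_iff)

text \<open>By the growth condition a ball around \<open>x\<close> is a closed subset of a larger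
  ball around the given centre \<open>x0\<close>.\<close>

lemma compact_ball: "compact {y. c x y \<le> r}"
proof -
  obtain x0 where x0: "\<And>r. r \<ge> 0 \<Longrightarrow> compact {y. c x0 y \<le> r}" using compact_balls by blast
  define R where "R = A + B * (c x0 x + \<bar>r\<bar>)"
  have "R \<ge> 0" using AB_nonneg cost_nonneg by (simp add: R_def)
  have "{y. c x y \<le> r} \<subseteq> {y. c x0 y \<le> R}"
  proof safe
    fix y assume "c x y \<le> r"
    then have "B * (c x0 x + c x y) \<le> B * (c x0 x + \<bar>r\<bar>)" using AB_nonneg by (intro mult_left_mono) auto
    then show "c x0 y \<le> R" using growth(2)[of x0 y x] by (simp add: R_def)
  qed
  moreover have "closed {y. c x y \<le> r}"
    by (intro closed_Collect_le cost_continuous_on continuous_intros)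
  ultimately show ?thesis using x0[OF \<open>R \<ge> 0\<close>] by (metis compact_Int_closed inf.absorb2)
qed

text \<open>This replaces the triangle inequality near zero. The growth condition only keeps the
  costs \<open>c y (z n)\<close> bounded, but then the points stay in a compact ball, and by
  continuity every limit point \<open>v\<close> satisfies \<open>c y v = 0\<close>, hence equals
  \<open>y\<close>.\<close>

lemma cost_tendsto_trans:
  assumes y: "(\<lambda>n. c y (y' n)) \<longlonglongrightarrow> 0" and z: "(\<lambda>n. c (y' n) (z n)) \<longlonglongrightarrow> 0"
  shows "z \<longlonglongrightarrow> y"
proof (rule ccontr)
  assume "\<not> z \<longlonglongrightarrow> y"
  then obtain e where e: "e > 0" "\<not> eventually (\<lambda>n. dist (z n) y < e) sequentially"
    by (auto simp: tendsto_iff)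
  have y': "y' \<longlonglongrightarrow> y" using y cost_tendsto_0_iff by simp
  have ev: "eventually (\<lambda>n. c y (y' n) < 1 \<and> c (y' n) (z n) < 1) sequentially"
    using order_tendstoD(2)[OF y, of 1] order_tendstoD(2)[OF z, of 1] by (auto intro: eventually_conj)
  have "\<not> eventually (\<lambda>n. \<not> (e \<le> dist (z n) y \<and> c y (y' n) < 1 \<and> c (y' n) (z n) < 1)) sequentially"
  proof
    assume "eventually (\<lambda>n. \<not> (e \<le> dist (z n) y \<and> c y (y' n) < 1 \<and> c (y' n) (z n) < 1)) sequentially"
    with ev have "eventually (\<lambda>n. dist (z n) y < e) sequentially" by eventually_elim auto
    with e(2) show False ..
  qed
  then obtain r :: "nat \<Rightarrow> nat" where r: "strict_mono r"
    "\<And>n. e \<le> dist (z (r n)) y \<and> c y (y' (r n)) < 1 \<and> c (y' (r n)) (z (r n)) < 1"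
    by (rule strict_mono_subseq_of_frequently) blast
  have zr: "z (r n) \<in> {v. c y v \<le> A + B * (1 + 1)}" for n
  proof -
    have "B * (c y (y' (r n)) + c (y' (r n)) (z (r n))) \<le> B * (1 + 1)"
      using r(2)[of n] AB_nonneg by (intro mult_left_mono) auto
    then show ?thesis using growth(2)[of y "z (r n)" "y' (r n)"] by simp
  qed
  then obtain v q where q: "strict_mono (q :: nat \<Rightarrow> nat)" "(\<lambda>n. z (r (q n))) \<longlonglongrightarrow> v"
  proof -
    have "seq_compact {v. c y v \<le> A + B * (1 + 1)}"
      using compact_ball compact_eq_seq_compact_metric by blast
    then obtain v q where "strict_mono (q :: nat \<Rightarrow> nat)" "((\<lambda>n. z (r n)) \<circ> q) \<longlonglongrightarrow> v"
      by (rule seq_compactE) (use zr in auto)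
    then show ?thesis by (intro that) (auto simp: o_def)
  qed
  have rq: "strict_mono (r \<circ> q)" using r(1) q(1) by (rule strict_mono_o)
  have "(\<lambda>n. c (y' (r (q n))) (z (r (q n)))) \<longlonglongrightarrow> c y v"
    using LIMSEQ_subseq_LIMSEQ[OF y' rq] q(2) by (intro cost_tendsto) (auto simp: o_def)
  moreover have "(\<lambda>n. c (y' (r (q n))) (z (r (q n)))) \<longlonglongrightarrow> 0"
    using LIMSEQ_subseq_LIMSEQ[OF z rq] by (simp add: o_def)
  ultimately have "v = y" using LIMSEQ_unique cost_eq_0 by metis
  have "(\<lambda>n. dist (z (r (q n))) y) \<longlonglongrightarrow> dist v y"
    using q(2) by (intro tendsto_intros)
  then have "e \<le> dist v y" using r(2) by (intro LIMSEQ_le_const) auto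
  with \<open>v = y\<close> e show False by simp
qed

lemma measure_ball_compl_tendsto:
  assumes \<mu>: "\<mu> \<in> borel_probs"
  shows "(\<lambda>n::nat. measure \<mu> (- {y. c x y \<le> real n})) \<longlonglongrightarrow> 0"
proof -
  interpret prob_space \<mu> using \<mu> borel_probs_prob by blast
  have "(\<lambda>n::nat. measure \<mu> (- {y. c x y \<le> real n})) \<longlonglongrightarrow> measure \<mu> (\<Inter>n::nat. - {y. c x y \<le> real n})"
  proof (rule finite_Lim_measure_decseq)
    show "range (\<lambda>n::nat. - {y. c x y \<le> real n}) \<subseteq> sets \<mu>"
      using \<mu> compact_ball by (auto simp: borel_probs_sets compact_imp_closed borel_closed)
  qed (auto simp: decseq_def)
  moreover have "(\<Inter>n::nat. - {y. c x y \<le> real n}) = {}"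
    using real_arch_simple by auto
  ultimately show ?thesis by simp
qed

text \<open>A continuous \<open>h\<close> between the indicators of the complements of the balls of
  radius \<open>R0 + 1\<close> and \<open>R0\<close> carries the bound from the limit to all but
  finitely many members of the sequence; for those a larger radius is taken.\<close>

lemma weakly_conv_tight:
  assumes w: "weakly_conv s l" and s: "\<And>n. s n \<in> borel_probs" and l: "l \<in> borel_probs" and e: "e > (0::real)"
  obtains R :: nat where "\<And>n. measure (s n) (- {y. c x y \<le> real R}) \<le> e"
proof -
  have mb: "- {y. c x y \<le> r} \<in> sets borel" for r
    using compact_ball by (simp add: compact_imp_closed borel_closed)
  obtain R0 :: nat where R0: "measure l (- {y. c x y \<le> real R0}) < e"
    using order_tendstoD(2)[OF measure_ball_compl_tendsto[OF l] e, of x] by (auto simp: eventually_sequentially)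
  define h where "h y = min 1 (max 0 (c x y - real R0))" for y
  have h: "continuous_on UNIV h" "bounded (range h)"
    unfolding h_def by (auto intro!: continuous_intros cost_continuous_on simp: bounded_iff exI[of _ 1])
  have "integral\<^sup>L l h \<le> integral\<^sup>L l (indicator (- {y. c x y \<le> real R0}))"
    using l mb
    by (intro integral_mono') (auto simp: h_def borel_probs_sets intro!: integrable_real_indicator
        finite_measure.emeasure_finite[THEN top.not_eq_extremum[THEN iffD1]] prob_space.finite_measure borel_probs_prob split: split_indicator)
  also have "\<dots> = measure l (- {y. c x y \<le> real R0})" using l mb by (simp add: borel_probs_sets)
  finally have "integral\<^sup>L l h < e" using R0 by simp
  moreover have "(\<lambda>n. integral\<^sup>L (s n) h) \<longlonglongrightarrow> integral\<^sup>L l h" using w h by (simp add: weakly_conv_def)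
  ultimately obtain n0 where n0: "\<And>n. n \<ge> n0 \<Longrightarrow> integral\<^sup>L (s n) h < e"
    using order_tendstoD(2)[of "\<lambda>n. integral\<^sup>L (s n) h"] by (force simp: eventually_sequentially)
  have big: "measure (s n) (- {y. c x y \<le> real (R0 + 1)}) \<le> e" if "n \<ge> n0" for n
  proof -
    have "measure (s n) (- {y. c x y \<le> real (R0 + 1)}) = integral\<^sup>L (s n) (indicator (- {y. c x y \<le> real (R0 + 1)}))"
      using s mb by (simp add: borel_probs_sets)
    also have "\<dots> \<le> integral\<^sup>L (s n) h"
      using s h by (intro integral_mono' integrable_bdd_continuous) (auto simp: h_def split: split_indicator)
    finally show ?thesis using n0[OF that] by simp
  qed
  have "\<exists>R::nat. measure (s n) (- {y. c x y \<le> real R}) < e" for n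
    using order_tendstoD(2)[OF measure_ball_compl_tendsto[OF s[of n], of x] e] by (auto simp: eventually_sequentially)
  then obtain R :: "nat \<Rightarrow> nat" where R: "\<And>n. measure (s n) (- {y. c x y \<le> real (R n)}) < e" by metis
  \<comment> \<open>The sum is only a convenient common upper bound for the finitely many
    exceptional radii.\<close>
  define R1 where "R1 = R0 + 1 + (\<Sum>n<n0. R n)"
  have mono: "measure (s n) (- {y. c x y \<le> real R1}) \<le> measure (s n) (- {y. c x y \<le> real q})" if "q \<le> R1" for n q
  proof -
    interpret prob_space "s n" using s borel_probs_prob by blast
    have "real q \<le> real R1" using that by simp
    then show ?thesis
      using s[of n] mb by (intro finite_measure_mono) (auto simp: borel_probs_sets simp del: of_nat_le_iff)
  qed
  have "measure (s n) (- {y. c x y \<le> real R1}) \<le> e" for n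
  proof (cases "n \<ge> n0")
    case True
    then show ?thesis using mono[of "R0 + 1" n] big[of n] by (simp add: R1_def)
  next
    case False
    then have "R n \<le> (\<Sum>n<n0. R n)" by (intro member_le_sum) auto
    then show ?thesis using mono[of "R n" n] R[of n] by (simp add: R1_def)
  qed
  then show ?thesis by (rule that)
qed

text \<open>Tight marginals make the plans tight, since the mass outside a product of compact sets
  is bounded by the masses of the marginals outside its factors. The marginals of a limit plan are
  identified by uniqueness of weak limits.\<close>

lemma couplings_limit:
  fixes \<mu>s \<nu>s :: "nat \<Rightarrow> 'a measure"
  assumes \<mu>: "weakly_conv \<mu>s \<mu>" "\<mu> \<in> borel_probs" and \<nu>: "weakly_conv \<nu>s \<nu>" "\<nu> \<in> borel_probs"
    and \<gamma>: "\<And>n. \<gamma>s n \<in> couplings (\<mu>s n) (\<nu>s n)"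
  obtains r \<gamma> where "strict_mono r" "\<gamma> \<in> couplings \<mu> \<nu>" "weakly_conv (\<gamma>s \<circ> r) \<gamma>"
proof -
  have b: "\<gamma>s n \<in> borel_probs" "\<mu>s n \<in> borel_probs" "\<nu>s n \<in> borel_probs" for n
    using couplings_borel_probs[OF \<gamma>] by auto
  have "\<exists>K. compact K \<and> (\<forall>n. measure (\<gamma>s n) (- K) \<le> e)" if e: "e > 0" for e :: real
  proof -
    obtain R :: nat where R: "\<And>n. measure (\<mu>s n) (- {y. c undefined y \<le> real R}) \<le> e / 2"
      using weakly_conv_tight[OF \<mu>(1) b(2) \<mu>(2), of "e / 2" undefined] e by auto
    obtain L :: nat where L: "\<And>n. measure (\<nu>s n) (- {y. c undefined y \<le> real L}) \<le> e / 2"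
      using weakly_conv_tight[OF \<nu>(1) b(3) \<nu>(2), of "e / 2" undefined] e by auto
    define K where "K = {y. c undefined y \<le> real R} \<times> {y. c undefined y \<le> real L}"
    have "measure (\<gamma>s n) (- K) \<le> e" for n
    proof -
      have "measure (\<gamma>s n) (- K) \<le> measure (\<mu>s n) (- {y. c undefined y \<le> real R}) + measure (\<nu>s n) (- {y. c undefined y \<le> real L})"
        unfolding K_def using compact_ball
        by (intro measure_coupling_compl_Times \<gamma>) (simp_all add: compact_imp_closed borel_closed)
      then show ?thesis using R[of n] L[of n] by simp
    qed
    moreover have "compact K" unfolding K_def by (intro compact_Times compact_ball)
    ultimately show ?thesis by blast
  qed
  then obtain r \<gamma> where r: "strict_mono r" "\<gamma> \<in> borel_probs" "weakly_conv (\<gamma>s \<circ> r) \<gamma>"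
    using prokhorov[of \<gamma>s] b(1) by metis
  have "weakly_conv (\<lambda>n. distr ((\<gamma>s \<circ> r) n) borel fst) (distr \<gamma> borel fst)"
    by (rule weakly_conv_distr[OF r(3) _ _ r(2)]) (auto simp: b intro!: continuous_intros)
  moreover have "(\<lambda>n. distr ((\<gamma>s \<circ> r) n) borel fst) = \<mu>s \<circ> r" using \<gamma> by (auto simp: couplings_def)
  ultimately have "distr \<gamma> borel fst = \<mu>"
    using weakly_conv_unique weakly_conv_subseq[OF \<mu>(1) r(1)] \<mu>(2) distr_borel_probs[OF r(2) fst_measurable_borel]
    by metis
  moreover have "weakly_conv (\<lambda>n. distr ((\<gamma>s \<circ> r) n) borel snd) (distr \<gamma> borel snd)"
    by (rule weakly_conv_distr[OF r(3) _ _ r(2)]) (auto simp: b intro!: continuous_intros)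
  moreover have "(\<lambda>n. distr ((\<gamma>s \<circ> r) n) borel snd) = \<nu>s \<circ> r" using \<gamma> by (auto simp: couplings_def)
  ultimately have "\<gamma> \<in> couplings \<mu> \<nu>"
    using weakly_conv_unique weakly_conv_subseq[OF \<nu>(1) r(1)] \<nu>(2) distr_borel_probs[OF r(2) snd_measurable_borel] r(2)
    unfolding couplings_def by (metis (mono_tags, lifting) mem_Collect_eq)
  with r that show ?thesis by blast
qed

lemma plan_cost_le_liminf:
  assumes "weakly_conv \<gamma>s \<gamma>" "\<And>n. \<gamma>s n \<in> borel_probs" "\<gamma> \<in> borel_probs"
  shows "plan_cost c \<gamma> \<le> liminf (\<lambda>n. plan_cost c (\<gamma>s n))"
  using assms by (intro nn_integral_le_liminf_weakly_conv cost_continuous' cost_nonneg)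

text \<open>This is joint lower semicontinuity of the transport cost. Plans that exceed the bound
  \<open>a\<close> by at most \<open>inverse (Suc n)\<close> have a weak limit plan, and plan costs
  are lower semicontinuous.\<close>

lemma transport_cost_sublevel_closed:
  fixes \<mu>s \<nu>s :: "nat \<Rightarrow> 'a measure"
  assumes \<mu>: "weakly_conv \<mu>s \<mu>" "\<mu> \<in> borel_probs" and \<nu>: "weakly_conv \<nu>s \<nu>" "\<nu> \<in> borel_probs"
    and le: "\<And>n. transport_cost c (\<mu>s n) (\<nu>s n) \<le> a"
  shows "transport_cost c \<mu> \<nu> \<le> a"
proof (cases "a = \<top>")
  case False
  have "transport_cost c (\<mu>s n) (\<nu>s n) < a + ennreal (inverse (Suc n))" for n
  proof (rule le_less_trans[OF le])
    obtain q where "q \<ge> 0" "a = ennreal q" using False by (cases a) auto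
    then show "a < a + ennreal (inverse (Suc n))"
      by (simp add: ennreal_plus[symmetric] ennreal_less_iff del: ennreal_plus)
  qed
  then have "\<exists>\<gamma>\<in>couplings (\<mu>s n) (\<nu>s n). plan_cost c \<gamma> < a + ennreal (inverse (Suc n))" for n
    by (rule transport_cost_less) blast
  then obtain \<gamma>s where \<gamma>s: "\<And>n. \<gamma>s n \<in> couplings (\<mu>s n) (\<nu>s n)"
    "\<And>n. plan_cost c (\<gamma>s n) < a + ennreal (inverse (Suc n))" by metis
  obtain r \<gamma> where r: "strict_mono r" "\<gamma> \<in> couplings \<mu> \<nu>" "weakly_conv (\<gamma>s \<circ> r) \<gamma>"
    using couplings_limit[OF \<mu> \<nu> \<gamma>s(1)] .
  have "transport_cost c \<mu> \<nu> \<le> plan_cost c \<gamma>" using r(2) by (rule transport_cost_le)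
  also have "\<dots> \<le> liminf (\<lambda>n. plan_cost c ((\<gamma>s \<circ> r) n))"
    by (rule plan_cost_le_liminf[OF r(3)]) (use r(2) \<gamma>s(1) couplings_borel_probs(1) in auto)
  also have "\<dots> \<le> liminf (\<lambda>n. a + ennreal (inverse (Suc (r n))))"
    using \<gamma>s(2) by (intro Liminf_mono always_eventually) (auto intro: less_imp_le)
  also have "\<dots> = a"
  proof (rule lim_imp_Liminf)
    have "(\<lambda>n. inverse (real (Suc (r n)))) \<longlonglongrightarrow> 0"
      using LIMSEQ_subseq_LIMSEQ[OF LIMSEQ_inverse_real_of_nat r(1)] by (simp add: o_def)
    then have "(\<lambda>n. a + ennreal (inverse (Suc (r n)))) \<longlonglongrightarrow> a + ennreal 0"
      by (intro tendsto_intros tendsto_ennrealI)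
    then show "(\<lambda>n. a + ennreal (inverse (Suc (r n)))) \<longlonglongrightarrow> a" by simp
  qed simp
  finally show ?thesis .
qed simp

lemma transport_cost_le_liminf:
  assumes \<nu>: "weakly_conv \<nu>s \<nu>" "\<nu> \<in> borel_probs" and \<mu>: "\<mu> \<in> borel_probs"
  shows "transport_cost c \<mu> \<nu> \<le> liminf (\<lambda>n. transport_cost c \<mu> (\<nu>s n))"
proof (rule ccontr)
  assume "\<not> ?thesis"
  then obtain a where a: "liminf (\<lambda>n. transport_cost c \<mu> (\<nu>s n)) < a" "a < transport_cost c \<mu> \<nu>"
    using dense by (metis not_le)
  obtain r :: "nat \<Rightarrow> nat" where r: "strict_mono r" "\<And>n. transport_cost c \<mu> (\<nu>s (r n)) < a"
    using subseq_less_of_liminf[OF a(1)] by metis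
  have "weakly_conv (\<lambda>_. \<mu>) \<mu>" by (simp add: weakly_conv_def)
  then have "transport_cost c \<mu> \<nu> \<le> a"
    using transport_cost_sublevel_closed[of "\<lambda>_. \<mu>" \<mu> "\<nu>s \<circ> r" \<nu> a] weakly_conv_subseq[OF \<nu>(1) r(1)] r \<nu> \<mu> by (simp add: less_imp_le)
  with a show False by simp
qed

lemma transport_cost_measurable:
  assumes P: "sets P = sets (borel_measure_of weak_topology)" and \<nu>: "\<nu> \<in> borel_probs"
  shows "(\<lambda>\<mu>. transport_cost c \<mu> \<nu>) \<in> borel_measurable P"
proof (rule borel_measurableI_greater)
  fix a :: ennreal
  have sp: "space P = borel_probs"
    using sets_eq_imp_space_eq[OF P] by (simp add: borel_measure_of_def space_measure_of_conv)
  have "closedin weak_topology {\<mu> \<in> borel_probs. transport_cost c \<mu> \<nu> \<le> a}"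
    unfolding closedin_weak_topology_sequentially
  proof (intro conjI allI impI CollectI)
    fix s and l :: "'a measure"
    assume *: "range s \<subseteq> {\<mu> \<in> borel_probs. transport_cost c \<mu> \<nu> \<le> a} \<and> l \<in> borel_probs \<and> weakly_conv s l"
    have "weakly_conv (\<lambda>_. \<nu>) \<nu>" by (simp add: weakly_conv_def)
    then show "transport_cost c l \<nu> \<le> a"
      using * \<nu> by (intro transport_cost_sublevel_closed[of s l "\<lambda>_. \<nu>" \<nu>]) auto
  qed auto
  then have "openin weak_topology {x \<in> borel_probs. a < transport_cost c x \<nu>}"
    by (simp add: closedin_def set_diff_eq not_le conj_commute cong: conj_cong) 
  then have "{x \<in> borel_probs. a < transport_cost c x \<nu>} \<in> sets P"
    unfolding P borel_measure_of_def using openin_subset[of weak_topology]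
    by (subst sets_measure_of) (auto simp: topspace_weak_topology[symmetric] simp del: topspace_weak_topology)
  then show "{x \<in> space P. a < transport_cost c x \<nu>} \<in> sets P" by (simp add: sp)
qed

end

section \<open>Couplings given by a density\<close>

lemma emeasure_distr_nn_integral:
  "h \<in> M \<rightarrow>\<^sub>M N \<Longrightarrow> X \<in> sets N \<Longrightarrow> emeasure (distr M N h) X = (\<integral>\<^sup>+z. indicator X (h z) \<partial>M)"
  using nn_integral_distr[of h M N "indicator X"] by simp

text \<open>The plan is the image under \<open>f\<close> and \<open>g\<close> of the measure with
  density \<open>w\<close> on the product; \<open>w1\<close> and \<open>w2\<close> say that this
  measure has marginals \<open>\<gamma>\<close> and \<open>\<kappa>\<close>. The maps allow a
  density built from whole plans to couple only their second marginals.\<close>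

lemma block_coupling:
  fixes f :: "'b::second_countable_topology \<Rightarrow> 'a::second_countable_topology"
    and g :: "'c::second_countable_topology \<Rightarrow> 'a"
    and w :: "'b \<times> 'c \<Rightarrow> ennreal"
  assumes \<gamma>: "\<gamma> \<in> borel_probs" and \<kappa>: "\<kappa> \<in> borel_probs"
    and w[measurable]: "w \<in> borel_measurable borel"
    and f[measurable]: "f \<in> borel_measurable borel" and g[measurable]: "g \<in> borel_measurable borel"
    and w1: "AE z in \<gamma>. (\<integral>\<^sup>+z'. w (z, z') \<partial>\<kappa>) = 1"
    and w2: "AE z' in \<kappa>. (\<integral>\<^sup>+z. w (z, z') \<partial>\<gamma>) = 1"
  obtains \<pi> where "\<pi> \<in> couplings (distr \<gamma> borel f) (distr \<kappa> borel g)"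
    "\<And>h. h \<in> borel_measurable borel \<Longrightarrow>
       (\<integral>\<^sup>+p. h p \<partial>\<pi>) = (\<integral>\<^sup>+z. \<integral>\<^sup>+z'. w (z, z') * h (f z, g z') \<partial>\<kappa> \<partial>\<gamma>)"
proof -
  interpret G: prob_space \<gamma> using \<gamma> borel_probs_prob by blast
  interpret K: prob_space \<kappa> using \<kappa> borel_probs_prob by blast
  interpret GK: pair_sigma_finite \<gamma> \<kappa> ..
  have s\<gamma>[measurable_cong]: "sets \<gamma> = sets borel" using \<gamma> by (rule borel_probs_sets)
  have s\<kappa>[measurable_cong]: "sets \<kappa> = sets borel" using \<kappa> by (rule borel_probs_sets)
  have s2: "sets (\<gamma> \<Otimes>\<^sub>M \<kappa>) = sets borel"
    using sets_pair_measure_cong[OF s\<gamma> s\<kappa>] by (metis borel_prod)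
  have w'[measurable]: "w \<in> borel_measurable (\<gamma> \<Otimes>\<^sub>M \<kappa>)"
    using w measurable_cong_sets[OF s2 refl] by blast
  define \<theta> where "\<theta> = density (\<gamma> \<Otimes>\<^sub>M \<kappa>) w"
  have s\<theta>[measurable_cong]: "sets \<theta> = sets (\<gamma> \<Otimes>\<^sub>M \<kappa>)" by (simp add: \<theta>_def)
  define F where "F = (\<lambda>p. (f (fst p), g (snd p)))"
  have Fp: "F \<in> borel_measurable (\<gamma> \<Otimes>\<^sub>M \<kappa>)"
    unfolding F_def by (subst borel_prod[symmetric]) measurable
  define \<pi> where "\<pi> = distr \<theta> borel F"
  have I: "(\<integral>\<^sup>+p. h p \<partial>\<pi>) = (\<integral>\<^sup>+z. \<integral>\<^sup>+z'. w (z, z') * h (f z, g z') \<partial>\<kappa> \<partial>\<gamma>)"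
    if h[measurable]: "h \<in> borel_measurable borel" for h
  proof -
    have hF: "(\<lambda>p. h (F p)) \<in> borel_measurable (\<gamma> \<Otimes>\<^sub>M \<kappa>)"
      using measurable_compose[OF Fp h] .
    have "(\<integral>\<^sup>+p. h p \<partial>\<pi>) = (\<integral>\<^sup>+p. h (F p) \<partial>\<theta>)"
      unfolding \<pi>_def using Fp s\<theta> h by (intro nn_integral_distr) (auto cong: measurable_cong_sets)
    also have "\<dots> = (\<integral>\<^sup>+p. w p * h (F p) \<partial>(\<gamma> \<Otimes>\<^sub>M \<kappa>))"
      unfolding \<theta>_def using hF w' by (intro nn_integral_density) auto
    also have "\<dots> = (\<integral>\<^sup>+z. \<integral>\<^sup>+z'. w (z, z') * h (F (z, z')) \<partial>\<kappa> \<partial>\<gamma>)"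
      using hF w' by (intro K.nn_integral_fst[symmetric]) auto
    finally show ?thesis by (simp add: F_def)
  qed
  have I': "(\<integral>\<^sup>+p. h p \<partial>\<pi>) = (\<integral>\<^sup>+z'. \<integral>\<^sup>+z. w (z, z') * h (f z, g z') \<partial>\<gamma> \<partial>\<kappa>)"
    if h[measurable]: "h \<in> borel_measurable borel" for h
  proof -
    have "(\<lambda>p. h (F p)) \<in> borel_measurable (\<gamma> \<Otimes>\<^sub>M \<kappa>)"
      using measurable_compose[OF Fp h] .
    then have "(\<lambda>(z, z'). w (z, z') * h (f z, g z')) \<in> borel_measurable (\<gamma> \<Otimes>\<^sub>M \<kappa>)"
      using w' by (simp add: F_def case_prod_unfold)
    from GK.Fubini'[OF this] I[OF h] show ?thesis by simp
  qed
  have m1: "distr \<pi> borel fst = distr \<gamma> borel f"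
  proof (rule measure_eqI)
    fix X :: "'a set" assume "X \<in> sets (distr \<pi> borel fst)"
    then have X[measurable]: "X \<in> sets borel" by simp
    have ind: "(\<lambda>p. indicator X (fst p) :: ennreal) \<in> borel_measurable borel"
      by (intro measurable_compose[OF fst_measurable_borel]) simp
    have "emeasure (distr \<pi> borel fst) X = (\<integral>\<^sup>+p. indicator X (fst p) \<partial>\<pi>)"
      using fst_measurable_borel by (intro emeasure_distr_nn_integral) (auto simp: \<pi>_def)
    also have "\<dots> = (\<integral>\<^sup>+z. \<integral>\<^sup>+z'. w (z, z') * indicator X (f z) \<partial>\<kappa> \<partial>\<gamma>)"
      using I[OF ind] by simp
    also have "\<dots> = (\<integral>\<^sup>+z. (\<integral>\<^sup>+z'. w (z, z') \<partial>\<kappa>) * indicator X (f z) \<partial>\<gamma>)"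
      by (intro nn_integral_cong nn_integral_multc) measurable
    also have "\<dots> = (\<integral>\<^sup>+z. indicator X (f z) \<partial>\<gamma>)"
      using w1 by (intro nn_integral_cong_AE) auto
    also have "\<dots> = emeasure (distr \<gamma> borel f) X"
      by (intro emeasure_distr_nn_integral[symmetric]) measurable
    finally show "emeasure (distr \<pi> borel fst) X = emeasure (distr \<gamma> borel f) X" .
  qed simp
  have m2: "distr \<pi> borel snd = distr \<kappa> borel g"
  proof (rule measure_eqI)
    fix X :: "'a set" assume "X \<in> sets (distr \<pi> borel snd)"
    then have X[measurable]: "X \<in> sets borel" by simp
    have ind: "(\<lambda>p. indicator X (snd p) :: ennreal) \<in> borel_measurable borel"
      by (intro measurable_compose[OF snd_measurable_borel]) simp
    have "emeasure (distr \<pi> borel snd) X = (\<integral>\<^sup>+p. indicator X (snd p) \<partial>\<pi>)"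
      using snd_measurable_borel by (intro emeasure_distr_nn_integral) (auto simp: \<pi>_def)
    also have "\<dots> = (\<integral>\<^sup>+z'. \<integral>\<^sup>+z. w (z, z') * indicator X (g z') \<partial>\<gamma> \<partial>\<kappa>)"
      using I'[OF ind] by simp
    also have "\<dots> = (\<integral>\<^sup>+z'. (\<integral>\<^sup>+z. w (z, z') \<partial>\<gamma>) * indicator X (g z') \<partial>\<kappa>)"
      by (intro nn_integral_cong nn_integral_multc) measurable
    also have "\<dots> = (\<integral>\<^sup>+z'. indicator X (g z') \<partial>\<kappa>)"
      using w2 by (intro nn_integral_cong_AE) auto
    also have "\<dots> = emeasure (distr \<kappa> borel g) X"
      by (intro emeasure_distr_nn_integral[symmetric]) measurable
    finally show "emeasure (distr \<pi> borel snd) X = emeasure (distr \<kappa> borel g) X" .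
  qed simp
  have "\<pi> \<in> borel_probs"
  proof -
    have "emeasure \<pi> (space \<pi>) = emeasure (distr \<pi> borel fst) UNIV"
      using fst_measurable_borel by (subst emeasure_distr) (auto simp: \<pi>_def)
    also have "\<dots> = 1"
      using distr_borel_probs[OF \<gamma> f] borel_probs_prob[THEN prob_space.emeasure_space_1, of "distr \<gamma> borel f"]
      by (simp add: m1)
    finally show ?thesis by (auto simp: borel_probs_iff \<pi>_def intro: prob_spaceI)
  qed
  then have "\<pi> \<in> couplings (distr \<gamma> borel f) (distr \<kappa> borel g)"
    using m1 m2 by (simp add: couplings_def)
  then show ?thesis using I by (rule that)
qed

text \<open>Hats of all slopes over a countable subcover are enumerated as one sequence, and
  \<open>f i\<close> is the increment of its partial sums capped at 1. At each point some hat equals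
  1, so the capped sum reaches 1 after finitely many terms.\<close>

lemma partition_of_unity:
  fixes \<U> :: "'a::{metric_space, second_countable_topology} set set"
  assumes op: "\<And>U. U \<in> \<U> \<Longrightarrow> open U" and cov: "\<Union>\<U> = UNIV"
  obtains f :: "nat \<Rightarrow> 'a \<Rightarrow> real" and U where
    "\<And>i. U i \<in> \<U>" "\<And>i. continuous_on UNIV (f i)" "\<And>i x. 0 \<le> f i x"
    "\<And>i x. x \<notin> U i \<Longrightarrow> f i x = 0" "\<And>x. (\<lambda>i. f i x) sums 1"
proof -
  obtain \<V> where \<V>: "\<V> \<subseteq> \<U>" "countable \<V>" "\<Union>\<V> = \<Union>\<U>"
    by (rule Lindelof[of \<U>]) (use op in auto)
  have ne: "\<V> \<noteq> {}" using \<V>(3) cov by auto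
  define V where "V = from_nat_into \<V>"
  have rV: "range V = \<V>" unfolding V_def using \<V>(2) ne by (intro range_from_nat_into)
  define U where "U i = V (fst (prod_decode i))" for i
  define u where "u i = hat (U i) (snd (prod_decode i))" for i
  define S where "S n x = min 1 (\<Sum>i<n. u i x)" for n x
  define f where "f i x = S (Suc i) x - S i x" for i x
  have u0: "0 \<le> u i x" for i x by (simp add: u_def hat_nonneg)
  have "(\<lambda>i. f i x) sums 1" for x
  proof -
    have "x \<in> \<Union>(range V)" using rV \<V>(3) cov by simp
    then obtain k where "x \<in> V k" by auto
    moreover have "open (V k)" using rV \<V>(1) op[of "V k"] by auto
    ultimately obtain N where N: "hat (V k) N x = 1" using hat_eq_1 by metis
    define m where "m = prod_encode (k, N)"
    have um: "u m x = 1" using N by (simp add: u_def U_def m_def)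
    have "S n x = 1" if "n > m" for n
    proof -
      have "u m x \<le> (\<Sum>i<n. u i x)" using that u0 by (intro member_le_sum) auto
      then show ?thesis using um by (simp add: S_def)
    qed
    then have "(\<lambda>n. S n x) \<longlonglongrightarrow> 1"
      by (intro tendsto_eventually) (auto simp: eventually_sequentially intro!: exI[of _ "Suc m"])
    moreover have "(\<Sum>i<n. f i x) = S n x" for n
      using sum_lessThan_telescope[of "\<lambda>i. S i x" n] by (simp add: f_def S_def)
    ultimately show ?thesis by (simp add: sums_def)
  qed
  moreover have "0 \<le> f i x" for i x using u0[of i x] by (auto simp: f_def S_def min_def)
  moreover have "f i x = 0" if "x \<notin> U i" for i x
    using hat_eq_0[OF that] by (simp add: f_def S_def u_def)
  moreover have "continuous_on UNIV (f i)" for i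
    unfolding f_def S_def u_def by (intro continuous_intros hat_continuous)
  moreover have "U i \<in> \<U>" for i using rV \<V>(1) by (auto simp: U_def)
  ultimately show ?thesis using that[of U f] by blast
qed

section \<open>Coupling two plans cell by cell\<close>

text \<open>Let \<open>P i j\<close> be a partition of unity, with masses \<open>m i j\<close> and \<open>m' i j\<close> under two measures whose rows
  \<open>\<Sum>j. m i j\<close> and \<open>\<Sum>j. m' i j\<close> agree.  The density below couples the common mass of each cell within that
  cell, and the remaining mass of each row within that row.  If \<open>m i j = 0\<close>, the quotient
  \<open>excess m m' i j / m i j\<close> is \<open>0 / 0 = 0\<close>.\<close>

definition excess :: "(nat \<Rightarrow> nat \<Rightarrow> ennreal) \<Rightarrow> (nat \<Rightarrow> nat \<Rightarrow> ennreal) \<Rightarrow> nat \<Rightarrow> nat \<Rightarrow> ennreal" where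
  "excess m m' i j = m i j - min (m i j) (m' i j)"

definition residual :: "(nat \<Rightarrow> nat \<Rightarrow> 'z \<Rightarrow> ennreal) \<Rightarrow> (nat \<Rightarrow> nat \<Rightarrow> ennreal) \<Rightarrow> (nat \<Rightarrow> nat \<Rightarrow> ennreal) \<Rightarrow> nat \<Rightarrow> 'z \<Rightarrow> ennreal" where
  "residual P m m' i z = (\<Sum>j. P i j z * (excess m m' i j / m i j))"

text \<open>Dividing by the maximum gives a cell with masses \<open>m\<close> and \<open>m'\<close>
  the coupled mass \<open>m * m' / max m m' = min m m'\<close>. The residuals of a row are coupled
  independently, normalised by the total excess of the row; if that total is 0, the infinite factor
  \<open>inverse 0\<close> meets vanishing residuals.\<close>

definition cell_density :: "(nat \<Rightarrow> nat \<Rightarrow> 'z \<Rightarrow> ennreal) \<Rightarrow> (nat \<Rightarrow> nat \<Rightarrow> ennreal) \<Rightarrow> (nat \<Rightarrow> nat \<Rightarrow> ennreal) \<Rightarrow> 'z \<Rightarrow> 'z \<Rightarrow> ennreal" where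
  "cell_density P m m' z z' =
     (\<Sum>i. \<Sum>j. P i j z * P i j z' * inverse (max (m i j) (m' i j))) +
     (\<Sum>i. residual P m m' i z * residual P m' m i z' * inverse (\<Sum>j. excess m m' i j))"

text \<open>The common mass of a row is the same seen from either side, so it cancels from equal
  finite row sums.\<close>

lemma excess_sums:
  assumes "(\<Sum>j. m i j) = (\<Sum>j. m' i j)" "(\<Sum>j. m i j) \<noteq> \<top>"
  shows "(\<Sum>j. excess m m' i j) = (\<Sum>j. excess m' m i j)"
proof -
  have *: "(\<Sum>j. m i j) = (\<Sum>j. min (m i j) (m' i j)) + (\<Sum>j. excess m m' i j)" for m m'
  proof -
    have "(\<Sum>j. min (m i j) (m' i j)) + (\<Sum>j. excess m m' i j) = (\<Sum>j. min (m i j) (m' i j) + excess m m' i j)"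
      by (rule suminf_add) auto
    also have "\<dots> = (\<Sum>j. m i j)" by (intro suminf_cong) (simp add: excess_def)
    finally show ?thesis by simp
  qed
  have "(\<Sum>j. min (m i j) (m' i j)) \<le> (\<Sum>j. m i j)" by (intro suminf_le) auto
  then have "(\<Sum>j. min (m i j) (m' i j)) \<noteq> \<top>" using assms(2) by (auto simp: top_unique)
  moreover have "(\<Sum>j. min (m i j) (m' i j)) + (\<Sum>j. excess m m' i j) = (\<Sum>j. min (m i j) (m' i j)) + (\<Sum>j. excess m' m i j)"
    using assms(1) *[of m m'] *[of m' m] by (simp add: min.commute)
  ultimately show ?thesis by (simp add: ennreal_add_left_cancel)
qed

lemma residual_measurable [measurable]:
  "(\<And>i j. P i j \<in> borel_measurable M) \<Longrightarrow> residual P m m' i \<in> borel_measurable M"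
  unfolding residual_def[abs_def] by (intro borel_measurable_suminf_order borel_measurable_times_ennreal borel_measurable_const)

lemma mult_excess_div: "m i j \<noteq> \<top> \<Longrightarrow> m i j * (excess m m' i j / m i j) = excess m m' i j"
  using mult_divide_eq_ennreal[of "m i j" "excess m m' i j"]
  by (cases "m i j = 0") (auto simp: excess_def ennreal_times_divide mult.commute)

lemma nn_integral_residual:
  assumes [measurable]: "\<And>i j. P i j \<in> borel_measurable M" "g \<in> borel_measurable M"
  shows "(\<integral>\<^sup>+z. residual P m m' i z * g z \<partial>M) =
    (\<Sum>j. (\<integral>\<^sup>+z. P i j z * g z \<partial>M) * (excess m m' i j / m i j))"
proof -
  have "(\<integral>\<^sup>+z. residual P m m' i z * g z \<partial>M) = (\<integral>\<^sup>+z. (\<Sum>j. P i j z * g z * (excess m m' i j / m i j)) \<partial>M)"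
    by (simp add: residual_def ennreal_suminf_multc[symmetric] mult_ac)
  also have "\<dots> = (\<Sum>j. \<integral>\<^sup>+z. P i j z * g z * (excess m m' i j / m i j) \<partial>M)"
    by (intro nn_integral_suminf) measurable
  also have "\<dots> = (\<Sum>j. (\<integral>\<^sup>+z. P i j z * g z \<partial>M) * (excess m m' i j / m i j))"
    by (intro suminf_cong nn_integral_multc) measurable
  finally show ?thesis .
qed

lemma nn_integral_residual_eq:
  assumes "\<And>i j. P i j \<in> borel_measurable M" "\<And>i j. m i j = (\<integral>\<^sup>+z. P i j z \<partial>M)" "\<And>j. m i j \<noteq> \<top>"
  shows "(\<integral>\<^sup>+z. residual P m m' i z \<partial>M) = (\<Sum>j. excess m m' i j)"
proof -
  have "(\<integral>\<^sup>+z. residual P m m' i z \<partial>M) = (\<Sum>j. m i j * (excess m m' i j / m i j))"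
    using nn_integral_residual[of P M "\<lambda>_. 1" m m' i] assms(1) by (simp add: assms(2)[of i])
  also have "\<dots> = (\<Sum>j. excess m m' i j)"
    by (intro suminf_cong mult_excess_div assms(3))
  finally show ?thesis .
qed

text \<open>Integrating out \<open>z'\<close> leaves \<open>P i j z\<close> times
  \<open>m' / max m m' + (m - min m m') / m\<close> in each cell. This factor is
  \<open>1 + 0\<close> if \<open>m \<le> m'\<close> and \<open>m' / m + (m - m') / m\<close>
  otherwise, so it is always 1, and what remains sums to 1 by hypothesis.\<close>

lemma nn_integral_cell_density:
  assumes [measurable]: "\<And>i j. P i j \<in> borel_measurable M"
    and m': "\<And>i j. m' i j = (\<integral>\<^sup>+z. P i j z \<partial>M)"
    and eq: "\<And>i. (\<Sum>j. m i j) = (\<Sum>j. m' i j)" and fin: "\<And>i. (\<Sum>j. m i j) \<noteq> \<top>"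
    and z: "(\<Sum>i. \<Sum>j. P i j z) = 1" "\<And>i j. m i j = 0 \<Longrightarrow> P i j z = 0"
  shows "(\<integral>\<^sup>+z'. cell_density P m m' z z' \<partial>M) = 1"
proof -
  have finm: "m i j \<noteq> \<top>" "m' i j \<noteq> \<top>" for i j
  proof -
    have "m i j \<le> (\<Sum>j. m i j)" "m' i j \<le> (\<Sum>j. m' i j)"
      using sum_le_suminf[of "\<lambda>j. m i j" "{j}"] sum_le_suminf[of "\<lambda>j. m' i j" "{j}"] by auto
    then show "m i j \<noteq> \<top>" "m' i j \<noteq> \<top>" using fin[of i] eq[of i] by (auto simp: top_unique)
  qed
  define r where "r i = (\<Sum>j. excess m m' i j)" for i
  have r: "r i = (\<Sum>j. excess m' m i j)" for i
    unfolding r_def using eq fin by (rule excess_sums)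
  have rfin: "r i \<noteq> \<top>" for i
  proof -
    have "r i \<le> (\<Sum>j. m i j)" unfolding r_def excess_def by (intro suminf_le) (auto intro: diff_le_self_ennreal)
    then show ?thesis using fin[of i] by (auto simp: top_unique)
  qed
  have res: "(\<integral>\<^sup>+z'. residual P m' m i z' \<partial>M) = r i" for i
    unfolding r by (intro nn_integral_residual_eq m' finm) measurable
  have "(\<integral>\<^sup>+z'. cell_density P m m' z z' \<partial>M) =
     (\<integral>\<^sup>+z'. (\<Sum>i. \<Sum>j. P i j z * P i j z' * inverse (max (m i j) (m' i j))) \<partial>M) +
     (\<integral>\<^sup>+z'. (\<Sum>i. residual P m m' i z * residual P m' m i z' * inverse (r i)) \<partial>M)"
    unfolding cell_density_def r_def by (intro nn_integral_add) measurable
  also have "(\<integral>\<^sup>+z'. (\<Sum>i. \<Sum>j. P i j z * P i j z' * inverse (max (m i j) (m' i j))) \<partial>M) =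
      (\<Sum>i. \<Sum>j. P i j z * m' i j * inverse (max (m i j) (m' i j)))"
    by (simp add: nn_integral_suminf nn_integral_multc nn_integral_cmult m')
  also have "(\<integral>\<^sup>+z'. (\<Sum>i. residual P m m' i z * residual P m' m i z' * inverse (r i)) \<partial>M) =
      (\<Sum>i. residual P m m' i z * r i * inverse (r i))"
    by (simp add: nn_integral_suminf nn_integral_multc nn_integral_cmult res)
  also have "(\<Sum>i. residual P m m' i z * r i * inverse (r i)) = (\<Sum>i. \<Sum>j. P i j z * (excess m m' i j / m i j))"
  proof (intro suminf_cong)
    fix i
    show "residual P m m' i z * r i * inverse (r i) = (\<Sum>j. P i j z * (excess m m' i j / m i j))"
    proof (cases "r i = 0")
      case True
      then have "excess m m' i j = 0" for j
        using sum_le_suminf[of "\<lambda>j. excess m m' i j" "{j}"] by (simp add: r_def)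
      then show ?thesis using True by (simp add: residual_def)
    next
      case False
      then have "r i * inverse (r i) = 1" using rfin[of i] by (metis divide_ennreal_def ennreal_divide_self top.not_eq_extremum zero_less_iff_neq_zero)
      then show ?thesis by (simp add: residual_def mult.assoc)
    qed
  qed
  also have "(\<Sum>i. \<Sum>j. P i j z * m' i j * inverse (max (m i j) (m' i j))) + (\<Sum>i. \<Sum>j. P i j z * (excess m m' i j / m i j)) =
      (\<Sum>i. \<Sum>j. P i j z * m' i j * inverse (max (m i j) (m' i j)) + P i j z * (excess m m' i j / m i j))"
    by (simp add: suminf_add)
  also have "\<dots> = (\<Sum>i. \<Sum>j. P i j z)"
  proof (intro suminf_cong)
    fix i j
    show "P i j z * m' i j * inverse (max (m i j) (m' i j)) + P i j z * (excess m m' i j / m i j) = P i j z"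
    proof (cases "m i j = 0")
      case False
      have "m' i j * inverse (max (m i j) (m' i j)) + excess m m' i j / m i j = 1"
      proof (cases "m i j \<le> m' i j")
        case True
        then have "m' i j \<noteq> 0" using False by auto
        then show ?thesis using True finm[of i j]
          by (simp add: excess_def max_def min_def divide_ennreal_def[symmetric] ennreal_divide_self top.not_eq_extremum)
      next
        case F: False
        then have "m' i j * inverse (max (m i j) (m' i j)) + excess m m' i j / m i j = m' i j / m i j + (m i j - m' i j) / m i j"
          by (simp add: excess_def max_def min_def divide_ennreal_def)
        also have "\<dots> = (m' i j + (m i j - m' i j)) / m i j" by (simp add: add_divide_distrib_ennreal)
        also have "\<dots> = 1" using F False finm[of i j]
          by (simp add: add.commute[of "m' i j"] diff_add_cancel_ennreal ennreal_divide_self top.not_eq_extremum)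
        finally show ?thesis .
      qed
      then have "P i j z * (m' i j * inverse (max (m i j) (m' i j)) + excess m m' i j / m i j) = P i j z" by simp
      then show ?thesis by (simp add: distrib_left mult.assoc)
    qed (simp add: z)
  qed
  finally show ?thesis using z by simp
qed

lemma ennreal_mult_inverse_le_1: "x * inverse x \<le> (1::ennreal)"
proof (cases "x = 0 \<or> x = \<top>")
  case False
  then have "x / x = 1" by (intro ennreal_divide_self) (auto simp: top.not_eq_extremum)
  then show ?thesis by (simp add: divide_ennreal_def)
qed auto

lemma suminf_ennreal_eq_1: "(\<And>i. 0 \<le> f i) \<Longrightarrow> f sums 1 \<Longrightarrow> (\<Sum>i. ennreal (f i)) = 1"
  by (subst suminf_ennreal2) (auto simp: sums_iff)

lemma suminf2_eq_nn_integral: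
  fixes h :: "nat \<Rightarrow> nat \<Rightarrow> ennreal"
  shows "(\<Sum>i. \<Sum>j. h i j) = (\<integral>\<^sup>+k. h (fst k) (snd k) \<partial>count_space UNIV)"
  using nn_integral_fst_count_space[of "\<lambda>k. h (fst k) (snd k)"] by (simp add: nn_integral_count_space_nat)

text \<open>Strict inequalities make room for the factor: if \<open>y < b < C\<close>, then
  \<open>u n\<close> eventually exceeds \<open>b\<close> and \<open>s n\<close> eventually exceeds
  \<open>y / b\<close>.\<close>

lemma liminf_mult_tendsto_1:
  fixes C :: ennreal
  assumes s: "s \<longlonglongrightarrow> (1::ennreal)" and C: "C \<le> liminf u"
  shows "C \<le> liminf (\<lambda>n. u n * s n)"
  unfolding le_Liminf_iff
proof (intro allI impI)
  fix y assume "y < C"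
  then obtain b where b: "y < b" "b < C" using dense by blast
  have b0: "b \<noteq> 0" "b < \<top>" using b by (auto simp: less_top[symmetric] top_unique intro: less_le_trans)
  have "eventually (\<lambda>n. b < u n) sequentially" using C b(2) by (auto simp: le_Liminf_iff)
  moreover have "y / b < 1" using b b0 by (simp add: divide_less_ennreal)
  then have "eventually (\<lambda>n. y / b < s n) sequentially" using s by (rule order_tendstoD(1)[rotated])
  ultimately show "eventually (\<lambda>n. y < u n * s n) sequentially"
  proof eventually_elim
    case (elim n)
    have "y < s n * b" using elim(2) b0 by (simp add: divide_less_ennreal)
    also have "\<dots> \<le> u n * s n" using elim(1) by (subst mult.commute) (intro mult_right_mono, auto)
    finally show ?case .
  qed
qed

text \<open>Fatou's lemma for \<open>Cs n i j * (1 - e n i j)\<close> shows that no mass of the convergent totals is left for the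
  complementary part.\<close>

lemma suminf2_tendsto_0:
  fixes C :: "nat \<Rightarrow> nat \<Rightarrow> ennreal"
  assumes e1: "\<And>n i j. e n i j \<le> 1" and e0: "\<And>i j. C i j \<noteq> 0 \<Longrightarrow> (\<lambda>n. e n i j) \<longlonglongrightarrow> 0"
    and C: "\<And>i j. C i j \<le> liminf (\<lambda>n. Cs n i j)"
    and tot: "(\<lambda>n. \<Sum>i. \<Sum>j. Cs n i j) \<longlonglongrightarrow> (\<Sum>i. \<Sum>j. C i j)" and fin: "(\<Sum>i. \<Sum>j. C i j) \<noteq> \<top>"
  shows "(\<lambda>n. \<Sum>i. \<Sum>j. Cs n i j * e n i j) \<longlonglongrightarrow> 0"
proof -
  define T where "T n = (\<Sum>i. \<Sum>j. Cs n i j * e n i j)" for n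
  define S where "S n = (\<Sum>i. \<Sum>j. Cs n i j * (1 - e n i j))" for n
  define t where "t = (\<Sum>i. \<Sum>j. C i j)"
  have TS: "T n + S n = (\<Sum>i. \<Sum>j. Cs n i j)" for n
  proof -
    have "T n + S n = (\<Sum>i. \<Sum>j. Cs n i j * e n i j + Cs n i j * (1 - e n i j))"
      unfolding T_def S_def by (simp add: suminf_add)
    also have "\<dots> = (\<Sum>i. \<Sum>j. Cs n i j)"
    proof (intro suminf_cong)
      fix i j
      have "e n i j + (1 - e n i j) = 1"
        using e1[of n i j] by (simp add: add.commute diff_add_cancel_ennreal)
      then show "Cs n i j * e n i j + Cs n i j * (1 - e n i j) = Cs n i j"
        by (metis distrib_left mult.right_neutral)
    qed
    finally show ?thesis .
  qed
  \<comment> \<open>Over the counting measure on pairs the double sums are integrals, and Fatou's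
    lemma applies.\<close>
  have "t = (\<integral>\<^sup>+k. C (fst k) (snd k) \<partial>count_space UNIV)" unfolding t_def by (rule suminf2_eq_nn_integral)
  also have "\<dots> \<le> (\<integral>\<^sup>+k. liminf (\<lambda>n. Cs n (fst k) (snd k) * (1 - e n (fst k) (snd k))) \<partial>count_space UNIV)"
  proof (intro nn_integral_mono)
    fix k :: "nat \<times> nat"
    show "C (fst k) (snd k) \<le> liminf (\<lambda>n. Cs n (fst k) (snd k) * (1 - e n (fst k) (snd k)))"
    proof (cases "C (fst k) (snd k) = 0")
      case False
      have "(\<lambda>n. 1 - e n (fst k) (snd k)) \<longlonglongrightarrow> 1 - 0"
        using e0[OF False] by (intro tendsto_diff_ennreal) auto
      then show ?thesis using C by (intro liminf_mult_tendsto_1) simp_all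
    qed simp
  qed
  also have "\<dots> \<le> liminf (\<lambda>n. \<integral>\<^sup>+k. Cs n (fst k) (snd k) * (1 - e n (fst k) (snd k)) \<partial>count_space UNIV)"
    by (intro nn_integral_liminf) simp
  also have "\<dots> = liminf S" unfolding S_def suminf2_eq_nn_integral ..
  finally have tS: "t \<le> liminf S" .
  have tot': "(\<lambda>n. T n + S n) \<longlonglongrightarrow> t" using tot by (simp add: TS t_def)
  have "T \<longlonglongrightarrow> 0"
  proof (rule order_tendstoI)
    fix a :: ennreal assume a: "0 < a"
    obtain b where b: "0 < b" "ennreal b < a"
    proof -
      obtain b' where b': "0 < b'" "b' < a" using dense[OF a] by blast
      then obtain b where "b' = ennreal b" "b \<ge> 0" by (cases b') auto
      with b' that[of b] show ?thesis by auto
    qed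
    \<comment> \<open>One \<open>h\<close> is spent on \<open>T n + S n < t + h\<close>, the other
      on \<open>t \<le> S n + h\<close>.\<close>
    define h where "h = ennreal (b / 2)"
    have h: "h > 0" "h < \<top>" "h + h < a" "h + h = ennreal b"
      using b by (auto simp: h_def ennreal_plus[symmetric] simp del: ennreal_plus)
    have tfin: "t < \<top>" using fin by (simp add: t_def top.not_eq_extremum)
    have ev1: "eventually (\<lambda>n. T n + S n < t + h) sequentially"
    proof (rule order_tendstoD(2)[OF tot'])
      show "t < t + h" using h(1) tfin ennreal_add_left_cancel_less[of t 0 h] by simp
    qed
    have ev2: "eventually (\<lambda>n. t \<le> S n + h) sequentially"
    proof (cases "t = 0")
      case False
      obtain q where q: "t = ennreal q" "q > 0" using False tfin by (cases t) (auto simp: less_le)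
      have "t - h < t" using b(1) q by (simp add: h_def ennreal_minus ennreal_lessI)
      then have "eventually (\<lambda>n. t - h < S n) sequentially" using tS by (auto simp: le_Liminf_iff)
      then show ?thesis
      proof eventually_elim
        case (elim n)
        then show ?case using ennreal_minus_le_iff[of t h "S n"] by (simp add: less_imp_le add.commute)
      qed
    qed simp
    show "eventually (\<lambda>n. T n < a) sequentially"
      using ev1 ev2
    proof eventually_elim
      case (elim n)
      have "T n + S n \<noteq> \<top>" using elim(1) by auto
      then have Sfin: "S n \<noteq> \<top>" by auto
      have "S n + T n \<le> t + h" using elim(1) by (simp add: add.commute less_imp_le)
      also have "\<dots> \<le> (S n + h) + h" using elim(2) by (rule add_right_mono)
      finally have "S n + T n \<le> S n + (h + h)" by (simp add: add.assoc)
      then have "T n \<le> h + h" using Sfin by (simp add: ennreal_add_left_cancel_le)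
      then show ?case using h(3) by simp
    qed
  qed auto
  then show ?thesis unfolding T_def[abs_def] .
qed

context growth_cost
begin

text \<open>Rows are cells of the first coordinate, columns cells of the second.  Mass coupled within a cell
  moves its second coordinate by less than \<open>\<delta>\<close>; for mass coupled only within a row the first coordinates
  are close, so the growth condition bounds the cost by the costs of the two plans.\<close>

lemma transport_cost_overlap:
  fixes \<gamma> \<kappa> :: "('a \<times> 'a) measure" and f :: "nat \<Rightarrow> 'a \<Rightarrow> real" and U :: "nat \<Rightarrow> 'a set"
  assumes \<gamma>: "\<gamma> \<in> borel_probs" and \<kappa>: "\<kappa> \<in> borel_probs"
    and marg: "distr \<gamma> borel fst = distr \<kappa> borel fst"
    and f: "\<And>i. continuous_on UNIV (f i)" "\<And>i x. 0 \<le> f i x" "\<And>i x. x \<notin> U i \<Longrightarrow> f i x = 0"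
      "\<And>x. (\<lambda>i. f i x) sums 1"
    and U: "\<And>i x y. x \<in> U i \<Longrightarrow> y \<in> U i \<Longrightarrow> c x y < \<delta>" and \<delta>: "\<delta> \<le> 1"
    and P: "\<And>i j z. P i j z = ennreal (f i (fst z) * f j (snd z))"
    and m: "\<And>i j. m i j = (\<integral>\<^sup>+z. P i j z \<partial>\<gamma>)" and m': "\<And>i j. m' i j = (\<integral>\<^sup>+z. P i j z \<partial>\<kappa>)"
    and C: "\<And>i j. C i j = (\<integral>\<^sup>+z. P i j z * ennreal (1 + c (fst z) (snd z)) \<partial>\<gamma>)"
    and C': "\<And>i j. C' i j = (\<integral>\<^sup>+z. P i j z * ennreal (1 + c (fst z) (snd z)) \<partial>\<kappa>)"
  shows "transport_cost c (distr \<gamma> borel snd) (distr \<kappa> borel snd) \<le>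
    ennreal \<delta> + ennreal (A + A * B + B + B * B) *
      ((\<Sum>i. \<Sum>j. C i j * (excess m m' i j / m i j)) + (\<Sum>i. \<Sum>j. C' i j * (excess m' m i j / m' i j)))"
proof -
  interpret G: prob_space \<gamma> using \<gamma> borel_probs_prob by blast
  interpret K: prob_space \<kappa> using \<kappa> borel_probs_prob by blast
  have s\<gamma>[measurable_cong]: "sets \<gamma> = sets borel" using \<gamma> by (rule borel_probs_sets)
  have s\<kappa>[measurable_cong]: "sets \<kappa> = sets borel" using \<kappa> by (rule borel_probs_sets)
  define p where "p i x = ennreal (f i x)" for i x
  have psum: "(\<Sum>i. p i x) = 1" for x
    unfolding p_def using f(2,4) by (rule suminf_ennreal_eq_1)
  have Pp: "P i j z = p i (fst z) * p j (snd z)" for i j z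
    using f(2) by (simp add: P p_def ennreal_mult)
  have pm[measurable]: "p i \<in> borel_measurable borel" for i
    unfolding p_def[abs_def] using f(1) by (intro measurable_compose[OF _ measurable_ennreal] borel_measurable_continuous_onI)
  have Pm[measurable]: "P i j \<in> borel_measurable borel" for i j
    unfolding Pp[abs_def]
    by (intro borel_measurable_times_ennreal measurable_compose[OF fst_measurable_borel pm] measurable_compose[OF snd_measurable_borel pm])
  have Pm': "P i j \<in> borel_measurable \<gamma>" "P i j \<in> borel_measurable \<kappa>" for i j by measurable
  have cm: "(\<lambda>z. ennreal (1 + c (fst z) (snd z))) \<in> borel_measurable borel" by measurable
  have Psum: "(\<Sum>i. \<Sum>j. P i j z) = 1" for z by (simp add: Pp psum)
  have rowsum: "(\<Sum>j. \<integral>\<^sup>+z. P i j z \<partial>\<mu>) = integral\<^sup>N (distr \<mu> borel fst) (p i)" if "\<mu> \<in> borel_probs" for \<mu> i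
  proof -
    have *: "P i j \<in> borel_measurable \<mu>" for i j using that by (simp add: borel_probs_measurable)
    have "(\<Sum>j. \<integral>\<^sup>+z. P i j z \<partial>\<mu>) = (\<integral>\<^sup>+z. (\<Sum>j. P i j z) \<partial>\<mu>)"
      using * by (intro nn_integral_suminf[symmetric])
    also have "\<dots> = (\<integral>\<^sup>+z. p i (fst z) \<partial>\<mu>)" by (simp add: Pp psum)
    also have "\<dots> = integral\<^sup>N (distr \<mu> borel fst) (p i)"
      using that by (intro nn_integral_distr[symmetric]) (auto simp: borel_probs_measurable fst_measurable_borel)
    finally show ?thesis .
  qed
  have eq: "(\<Sum>j. m i j) = (\<Sum>j. m' i j)" for i
    using rowsum[OF \<gamma>] rowsum[OF \<kappa>] by (simp add: m m' marg)
  have fin: "(\<Sum>j. m i j) \<noteq> \<top>" for i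
  proof -
    have "(\<Sum>j. m i j) = (\<integral>\<^sup>+z. (\<Sum>j. P i j z) \<partial>\<gamma>)"
      unfolding m by (intro nn_integral_suminf[symmetric]) measurable
    also have "\<dots> \<le> (\<integral>\<^sup>+z. 1 \<partial>\<gamma>)"
    proof (intro nn_integral_mono)
      fix z show "(\<Sum>j. P i j z) \<le> 1"
        using sum_le_suminf[of "\<lambda>i. \<Sum>j. P i j z" "{i}"] Psum[of z] by simp
    qed
    also have "\<dots> = 1" by (simp add: G.emeasure_space_1)
    finally show ?thesis by (auto simp: top_unique)
  qed
  have fin': "(\<Sum>j. m' i j) \<noteq> \<top>" for i using fin[of i] eq[of i] by simp
  have finm: "m i j \<noteq> \<top>" "m' i j \<noteq> \<top>" for i j
    using sum_le_suminf[of "\<lambda>j. m i j" "{j}"] sum_le_suminf[of "\<lambda>j. m' i j" "{j}"] fin[of i] fin'[of i]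
    by (auto simp: top_unique)
  have exc: "(\<Sum>j. excess m m' i j) = (\<Sum>j. excess m' m i j)" for i
    using eq fin by (rule excess_sums)
  define w where "w = (\<lambda>(z, z'). cell_density P m m' z z')"
  \<comment> \<open>The symmetry rests on the equality of the two row excesses, and reduces the
    second marginal condition to the first with the roles exchanged.\<close>
  have wsym: "cell_density P m m' z z' = cell_density P m' m z' z" for z z'
    unfolding cell_density_def exc by (simp add: max.commute mult.commute)
  have null: "AE z in \<mu>. \<forall>i j. (\<integral>\<^sup>+z. P i j z \<partial>\<mu>) = 0 \<longrightarrow> P i j z = 0" if "\<mu> \<in> borel_probs" for \<mu>
    unfolding AE_all_countable
  proof (intro allI)
    fix i j
    have "P i j \<in> borel_measurable \<mu>" using that by (simp add: borel_probs_measurable)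
    then show "AE z in \<mu>. (\<integral>\<^sup>+z. P i j z \<partial>\<mu>) = 0 \<longrightarrow> P i j z = 0"
      by (cases "(\<integral>\<^sup>+z. P i j z \<partial>\<mu>) = 0") (auto simp: nn_integral_0_iff_AE)
  qed
  have w1: "AE z in \<gamma>. (\<integral>\<^sup>+z'. w (z, z') \<partial>\<kappa>) = 1"
    using null[OF \<gamma>]
  proof eventually_elim
    case (elim z)
    then show ?case
      unfolding w_def prod.case by (intro nn_integral_cell_density Pm' eq fin Psum m') (simp add: m)
  qed
  have w2: "AE z' in \<kappa>. (\<integral>\<^sup>+z. w (z, z') \<partial>\<gamma>) = 1"
    using null[OF \<kappa>]
  proof eventually_elim
    case (elim z)
    then show ?case
      unfolding w_def prod.case wsym by (intro nn_integral_cell_density Pm' eq[symmetric] fin' Psum m) (simp add: m')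
  qed
  have Rm: "residual P m m' i \<in> borel_measurable borel" "residual P m' m i \<in> borel_measurable borel" for i
    by (intro residual_measurable Pm)+
  have Rm'[measurable]: "residual P m m' i \<in> borel_measurable \<gamma>" "residual P m' m i \<in> borel_measurable \<kappa>" for i
    by (intro residual_measurable Pm')+
  have wm: "w \<in> borel_measurable borel"
    unfolding w_def case_prod_unfold cell_density_def
    by (intro borel_measurable_add borel_measurable_suminf_order borel_measurable_times_ennreal
        borel_measurable_const measurable_compose[OF fst_measurable_borel] measurable_compose[OF snd_measurable_borel] Pm Rm)
  obtain \<pi> where \<pi>: "\<pi> \<in> couplings (distr \<gamma> borel snd) (distr \<kappa> borel snd)"
    and I: "\<And>h. h \<in> borel_measurable borel \<Longrightarrow>
       (\<integral>\<^sup>+p. h p \<partial>\<pi>) = (\<integral>\<^sup>+z. \<integral>\<^sup>+z'. w (z, z') * h (snd z, snd z') \<partial>\<kappa> \<partial>\<gamma>)"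
    using block_coupling[OF \<gamma> \<kappa> wm snd_measurable_borel snd_measurable_borel w1 w2] by blast
  \<comment> \<open>For two points \<open>(x, y)\<close> and \<open>(x', y')\<close> of one row with
    \<open>c x x' \<le> 1\<close>, two uses of the growth condition bound \<open>c y y'\<close> by
    \<open>(A + A * B + B * B) + B * c x y + B * B * c x' y'\<close>; \<open>E\<close> dominates the
    constant term and both factors.\<close>
  define E where "E = A + A * B + B + B * B"
  have E0: "E \<ge> 0" using AB_nonneg by (simp add: E_def)
  define g where "g z = ennreal E * ennreal (1 + c (fst z) (snd z))" for z
  have gm: "g \<in> borel_measurable borel" unfolding g_def[abs_def] using cm by measurable
  have gm'[measurable]: "g \<in> borel_measurable \<gamma>" "g \<in> borel_measurable \<kappa>" using gm by measurable
  define r where "r i = (\<Sum>j. excess m m' i j)" for i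
  define R where "R = residual P m m'"
  define R' where "R' = residual P m' m"
  have Rmm[measurable]: "R i \<in> borel_measurable \<gamma>" "R' i \<in> borel_measurable \<kappa>" for i
    unfolding R_def R'_def by measurable
  have Rpos: "f i (fst z) \<noteq> 0" if "residual P n n' i z \<noteq> 0" for n n' i z
  proof
    assume "f i (fst z) = 0"
    then have "residual P n n' i z = 0" by (simp add: residual_def P)
    with that show False by simp
  qed
  \<comment> \<open>The two sums separate the variables: each carries the cost weight
    \<open>g\<close> of one plan only, so that the factor of the other plan integrates to the row
    excess.\<close>
  have pt: "w (z, z') * ennreal (c (snd z) (snd z')) \<le> ennreal \<delta> * w (z, z') +
      ((\<Sum>i. R i z * g z * (R' i z' * inverse (r i))) + (\<Sum>i. R i z * (R' i z' * g z' * inverse (r i))))" for z z'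
  proof -
    define D where "D = (\<Sum>i. \<Sum>j. P i j z * P i j z' * inverse (max (m i j) (m' i j)))"
    define Q where "Q = (\<Sum>i. R i z * R' i z' * inverse (r i))"
    have w: "w (z, z') = D + Q" by (simp add: w_def cell_density_def D_def Q_def R_def R'_def r_def)
    have 1: "D * ennreal (c (snd z) (snd z')) \<le> ennreal \<delta> * D"
      unfolding D_def ennreal_suminf_multc[symmetric] ennreal_suminf_cmult[symmetric]
    proof (intro suminf_le allI summableI)
      fix i j
      show "P i j z * P i j z' * inverse (max (m i j) (m' i j)) * ennreal (c (snd z) (snd z')) \<le>
          ennreal \<delta> * (P i j z * P i j z' * inverse (max (m i j) (m' i j)))"
      proof (cases "P i j z = 0 \<or> P i j z' = 0")
        case False
        then have "f j (snd z) \<noteq> 0" "f j (snd z') \<noteq> 0" by (auto simp: P)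
        then have "snd z \<in> U j" "snd z' \<in> U j" using f(3) by blast+
        then have "ennreal (c (snd z) (snd z')) \<le> ennreal \<delta>" using U by (intro ennreal_leI less_imp_le) auto
        then show ?thesis by (subst mult.commute) (intro mult_right_mono, auto)
      qed auto
    qed
    have 2: "Q * ennreal (c (snd z) (snd z')) \<le>
       (\<Sum>i. R i z * g z * (R' i z' * inverse (r i))) + (\<Sum>i. R i z * (R' i z' * g z' * inverse (r i)))"
      unfolding Q_def ennreal_suminf_multc[symmetric]
    proof (subst suminf_add, simp, simp, intro suminf_le allI summableI)
      fix i
      have "R i z * R' i z' * inverse (r i) * ennreal (c (snd z) (snd z')) \<le> R i z * R' i z' * inverse (r i) * (g z + g z')"
      proof (cases "R i z = 0 \<or> R' i z' = 0")
        case False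
        then have "fst z \<in> U i" "fst z' \<in> U i" using Rpos f(3) unfolding R_def R'_def by metis+
        then have x: "c (fst z) (fst z') \<le> 1" using U \<delta> by (meson less_imp_le less_le_trans)
        let ?a = "c (fst z) (snd z)" and ?b = "c (fst z') (snd z')"
        have a: "c (fst z) (snd z') \<le> A + B * (1 + ?b)"
          using growth(2)[of "fst z" "snd z'" "fst z'"] x AB_nonneg
          by (smt (verit) mult_left_mono)
        have "c (snd z) (snd z') \<le> A + B * (?a + c (fst z) (snd z'))" by (rule growth(4))
        also have "\<dots> \<le> A + B * (?a + (A + B * (1 + ?b)))"
          using a AB_nonneg by (intro add_left_mono mult_left_mono) auto
        also have "\<dots> = (A + A * B + B * B) + B * ?a + B * B * ?b" by (simp add: algebra_simps)
        also have "\<dots> \<le> E + E * ?a + E * ?b"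
          using AB_nonneg cost_nonneg by (intro add_mono mult_right_mono) (auto simp: E_def)
        also have "\<dots> \<le> E * (1 + ?a) + E * (1 + ?b)" using E0 by (simp add: algebra_simps)
        finally have "ennreal (c (snd z) (snd z')) \<le> ennreal (E * (1 + ?a) + E * (1 + ?b))" by (rule ennreal_leI)
        also have "\<dots> = g z + g z'"
        proof -
          have "0 \<le> 1 + ?a" "0 \<le> 1 + ?b" using cost_nonneg by (auto intro: add_nonneg_nonneg)
          then show ?thesis using E0 by (simp add: g_def ennreal_mult ennreal_plus mult_nonneg_nonneg)
        qed
        finally show ?thesis by (intro mult_left_mono) auto
      qed auto
      then show "R i z * R' i z' * inverse (r i) * ennreal (c (snd z) (snd z')) \<le>
          R i z * g z * (R' i z' * inverse (r i)) + R i z * (R' i z' * g z' * inverse (r i))"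
        by (simp add: distrib_left mult_ac)
    qed
    have "ennreal \<delta> * D \<le> ennreal \<delta> * (D + Q)" by (intro mult_left_mono) auto
    with 1 have 3: "D * ennreal (c (snd z) (snd z')) \<le> ennreal \<delta> * (D + Q)" by (rule order_trans)
    show ?thesis unfolding w distrib_right by (rule add_mono[OF 3 2])
  qed
  have rR: "(\<integral>\<^sup>+z. R i z \<partial>\<gamma>) = r i" for i
    unfolding R_def r_def using finm by (intro nn_integral_residual_eq Pm' m) auto
  have rR': "(\<integral>\<^sup>+z. R' i z \<partial>\<kappa>) = r i" for i
    unfolding R'_def r_def exc using finm by (intro nn_integral_residual_eq Pm' m') auto
  have prod: "(\<integral>\<^sup>+z. \<integral>\<^sup>+z'. (\<Sum>i. u i z * (v i z' * inverse (r i))) \<partial>\<kappa> \<partial>\<gamma>) =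
      (\<Sum>i. (\<integral>\<^sup>+z. u i z \<partial>\<gamma>) * ((\<integral>\<^sup>+z'. v i z' \<partial>\<kappa>) * inverse (r i)))"
    if [measurable]: "\<And>i. u i \<in> borel_measurable \<gamma>" "\<And>i. v i \<in> borel_measurable \<kappa>" for u v
    by (simp add: nn_integral_suminf nn_integral_cmult nn_integral_multc)
  \<comment> \<open>The factor \<open>r i\<close> comes from the residual of the other plan; against
    the normalisation it gives at most 1, also when \<open>r i = 0\<close>.\<close>
  have part: "(\<Sum>i. (\<integral>\<^sup>+z. residual P n n' i z * g z \<partial>\<mu>) * (r i * inverse (r i))) \<le>
      ennreal E * (\<Sum>i. \<Sum>j. (\<integral>\<^sup>+z. P i j z * ennreal (1 + c (fst z) (snd z)) \<partial>\<mu>) * (excess n n' i j / n i j))"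
    if \<mu>: "\<mu> \<in> borel_probs" for \<mu> n n'
  proof -
    have [measurable]: "P i j \<in> borel_measurable \<mu>" "g \<in> borel_measurable \<mu>"
      "(\<lambda>z. ennreal (1 + c (fst z) (snd z))) \<in> borel_measurable \<mu>" for i j
      using Pm gm cm by (simp_all add: borel_probs_measurable[OF \<mu>])
    have "(\<Sum>i. (\<integral>\<^sup>+z. residual P n n' i z * g z \<partial>\<mu>) * (r i * inverse (r i))) \<le>
        (\<Sum>i. (\<integral>\<^sup>+z. residual P n n' i z * g z \<partial>\<mu>) * 1)"
      by (intro suminf_le summableI allI mult_left_mono ennreal_mult_inverse_le_1) auto
    also have "\<dots> = (\<Sum>i. \<Sum>j. (\<integral>\<^sup>+z. P i j z * g z \<partial>\<mu>) * (excess n n' i j / n i j))"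
      by (simp add: nn_integral_residual)
    also have "\<dots> = (\<Sum>i. \<Sum>j. ennreal E * ((\<integral>\<^sup>+z. P i j z * ennreal (1 + c (fst z) (snd z)) \<partial>\<mu>) * (excess n n' i j / n i j)))"
    proof (intro suminf_cong)
      fix i j
      have "(\<integral>\<^sup>+z. P i j z * g z \<partial>\<mu>) = (\<integral>\<^sup>+z. ennreal E * (P i j z * ennreal (1 + c (fst z) (snd z))) \<partial>\<mu>)"
        by (simp add: g_def mult_ac)
      also have "\<dots> = ennreal E * (\<integral>\<^sup>+z. P i j z * ennreal (1 + c (fst z) (snd z)) \<partial>\<mu>)"
        by (intro nn_integral_cmult) measurable
      finally show "(\<integral>\<^sup>+z. P i j z * g z \<partial>\<mu>) * (excess n n' i j / n i j) =
          ennreal E * ((\<integral>\<^sup>+z. P i j z * ennreal (1 + c (fst z) (snd z)) \<partial>\<mu>) * (excess n n' i j / n i j))"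
        by (simp add: mult.assoc)
    qed
    finally show ?thesis by (simp only: ennreal_suminf_cmult)
  qed
  have S1: "(\<integral>\<^sup>+z. \<integral>\<^sup>+z'. (\<Sum>i. R i z * g z * (R' i z' * inverse (r i))) \<partial>\<kappa> \<partial>\<gamma>) \<le>
      ennreal E * (\<Sum>i. \<Sum>j. C i j * (excess m m' i j / m i j))"
    using part[OF \<gamma>, of m m'] by (simp add: prod rR' C R_def)
  have S2: "(\<integral>\<^sup>+z. \<integral>\<^sup>+z'. (\<Sum>i. R i z * (R' i z' * g z' * inverse (r i))) \<partial>\<kappa> \<partial>\<gamma>) \<le>
      ennreal E * (\<Sum>i. \<Sum>j. C' i j * (excess m' m i j / m' i j))"
    using part[OF \<kappa>, of m' m] by (simp add: prod rR C' R'_def mult.left_commute[of "r _"])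
  have wm2[measurable]: "w \<in> borel_measurable (\<gamma> \<Otimes>\<^sub>M \<kappa>)"
  proof -
    have "sets (\<gamma> \<Otimes>\<^sub>M \<kappa>) = sets borel"
      using sets_pair_measure_cong[OF s\<gamma> s\<kappa>] by (metis borel_prod)
    then show ?thesis using wm measurable_cong_sets by blast
  qed
  have "transport_cost c (distr \<gamma> borel snd) (distr \<kappa> borel snd) \<le> plan_cost c \<pi>"
    using \<pi> by (rule transport_cost_le)
  also have "\<dots> = (\<integral>\<^sup>+z. \<integral>\<^sup>+z'. w (z, z') * ennreal (c (snd z) (snd z')) \<partial>\<kappa> \<partial>\<gamma>)"
    using I[of "\<lambda>z. ennreal (c (fst z) (snd z))"] by simp
  also have "\<dots> \<le> (\<integral>\<^sup>+z. \<integral>\<^sup>+z'. ennreal \<delta> * w (z, z') +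
      ((\<Sum>i. R i z * g z * (R' i z' * inverse (r i))) + (\<Sum>i. R i z * (R' i z' * g z' * inverse (r i)))) \<partial>\<kappa> \<partial>\<gamma>)"
    by (intro nn_integral_mono pt)
  also have "\<dots> = (\<integral>\<^sup>+z. (\<integral>\<^sup>+z'. ennreal \<delta> * w (z, z') \<partial>\<kappa>) \<partial>\<gamma>) +
      ((\<integral>\<^sup>+z. \<integral>\<^sup>+z'. (\<Sum>i. R i z * g z * (R' i z' * inverse (r i))) \<partial>\<kappa> \<partial>\<gamma>) +
       (\<integral>\<^sup>+z. \<integral>\<^sup>+z'. (\<Sum>i. R i z * (R' i z' * g z' * inverse (r i))) \<partial>\<kappa> \<partial>\<gamma>))"
  proof -
    have [measurable]: "(\<lambda>z'. w (z, z')) \<in> borel_measurable \<kappa>" for z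
      using measurable_compose_Pair1[OF _ wm2, of z] borel_probs_space[OF \<gamma>] by simp
    show ?thesis
      by (subst nn_integral_add[symmetric], measurable, subst nn_integral_add[symmetric], measurable)
        (intro nn_integral_cong, simp add: nn_integral_add)
  qed
  also have "(\<integral>\<^sup>+z. (\<integral>\<^sup>+z'. ennreal \<delta> * w (z, z') \<partial>\<kappa>) \<partial>\<gamma>) = (\<integral>\<^sup>+z. ennreal \<delta> \<partial>\<gamma>)"
    using w1 by (intro nn_integral_cong_AE) (auto simp: nn_integral_cmult)
  also have "\<dots> = ennreal \<delta>" by (simp add: G.emeasure_space_1)
  finally show ?thesis
    using add_mono[OF S1 S2] unfolding E_def by (simp add: distrib_left add_left_mono order_trans)
qed

end

section \<open>Stability of the transport cost\<close>

lemma excess_div_le_1: "excess m m' i j / m i j \<le> 1"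
proof -
  have "excess m m' i j / m i j \<le> m i j / m i j"
    unfolding excess_def by (intro divide_right_mono_ennreal diff_le_self_ennreal)
  also have "\<dots> \<le> 1" unfolding divide_ennreal_def by (rule ennreal_mult_inverse_le_1)
  finally show ?thesis .
qed

text \<open>The fraction of the mass of a cell that is not common mass vanishes as the masses
  converge to a positive limit. The second quotient agrees with its real counterpart only
  eventually, once the masses \<open>ms n i j\<close> are positive.\<close>

lemma excess_div_tendsto_0:
  assumes lim: "(\<lambda>n. ms n i j) \<longlonglongrightarrow> m i j" and m: "m i j \<noteq> 0" "m i j \<noteq> \<top>" and ms: "\<And>n. ms n i j \<noteq> \<top>"
  shows "(\<lambda>n. excess m (ms n) i j / m i j) \<longlonglongrightarrow> 0" "(\<lambda>n. excess (ms n) m i j / ms n i j) \<longlonglongrightarrow> 0"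
proof -
  obtain M where M: "m i j = ennreal M" "M > 0" using m by (cases "m i j") (auto simp: less_le)
  have "\<exists>q. ms n i j = ennreal q \<and> 0 \<le> q" for n using ms[of n] by (cases "ms n i j") auto
  then obtain Ms where Ms: "\<And>n. ms n i j = ennreal (Ms n)" "\<And>n. 0 \<le> Ms n" by metis
  have l: "Ms \<longlonglongrightarrow> M" using lim Ms M by simp
  have ev: "eventually (\<lambda>n. 0 < Ms n) sequentially" using order_tendstoD(1)[OF l M(2)] .
  have "(\<lambda>n. ennreal ((M - min M (Ms n)) / M)) \<longlonglongrightarrow> ennreal ((M - min M M) / M)"
    using M(2) by (intro tendsto_ennrealI tendsto_intros l) auto
  moreover have "excess m (ms n) i j / m i j = ennreal ((M - min M (Ms n)) / M)" for n
    using M Ms(2)[of n] by (simp add: excess_def Ms(1) min_ennreal ennreal_minus divide_ennreal)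
  ultimately show "(\<lambda>n. excess m (ms n) i j / m i j) \<longlonglongrightarrow> 0" by simp
  have "(\<lambda>n. ennreal ((Ms n - min (Ms n) M) / Ms n)) \<longlonglongrightarrow> ennreal ((M - min M M) / M)"
    using M(2) by (intro tendsto_ennrealI tendsto_intros l) auto
  moreover have "eventually (\<lambda>n. ennreal ((Ms n - min (Ms n) M) / Ms n) = excess (ms n) m i j / ms n i j) sequentially"
    using ev
  proof eventually_elim
    case (elim n)
    then show ?case using M by (simp add: excess_def Ms(1) min_ennreal ennreal_minus divide_ennreal)
  qed
  ultimately show "(\<lambda>n. excess (ms n) m i j / ms n i j) \<longlonglongrightarrow> 0"
    using tendsto_cong by fastforce
qed

context growth_cost
begin

text \<open>The cost vanishes on the diagonal and is continuous, so every point has a neighbourhood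
  on which all mutual costs are below \<open>\<delta>\<close>.\<close>

lemma small_cells:
  assumes \<delta>: "\<delta> > 0"
  obtains f :: "nat \<Rightarrow> 'a \<Rightarrow> real" and U where
    "\<And>i. continuous_on UNIV (f i)" "\<And>i x. 0 \<le> f i x" "\<And>i x. x \<notin> U i \<Longrightarrow> f i x = 0"
    "\<And>x. (\<lambda>i. f i x) sums 1" "\<And>i x y. x \<in> U i \<Longrightarrow> y \<in> U i \<Longrightarrow> c x y < \<delta>"
proof -
  define \<U> where "\<U> = {U. open U \<and> (\<forall>x\<in>U. \<forall>y\<in>U. c x y < \<delta>)}"
  have "\<exists>V\<in>\<U>. x \<in> V" for x
  proof -
    have "open {z. c (fst z) (snd z) < \<delta>}"
      by (intro open_Collect_less cost_continuous' continuous_on_const)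
    moreover have "(x, x) \<in> {z. c (fst z) (snd z) < \<delta>}" using \<delta> by simp
    ultimately obtain V W where VW: "open V" "open W" "x \<in> V" "x \<in> W" "V \<times> W \<subseteq> {z. c (fst z) (snd z) < \<delta>}"
      by (auto elim!: open_prod_elim)
    have "V \<inter> W \<in> \<U>" using VW by (fastforce simp: \<U>_def)
    then show ?thesis using VW by blast
  qed
  then have cov: "\<Union>\<U> = UNIV" by blast
  have op: "\<And>U. U \<in> \<U> \<Longrightarrow> open U" by (simp add: \<U>_def)
  show ?thesis
  proof (rule partition_of_unity[OF op cov])
    fix f :: "nat \<Rightarrow> 'a \<Rightarrow> real" and U
    assume f: "\<And>i. U i \<in> \<U>" "\<And>i. continuous_on UNIV (f i)" "\<And>i x. 0 \<le> f i x"
      "\<And>i x. x \<notin> U i \<Longrightarrow> f i x = 0" "\<And>x. (\<lambda>i. f i x) sums 1"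
    have "c x y < \<delta>" if "x \<in> U i" "y \<in> U i" for i x y
      using that f(1)[of i] by (auto simp: \<U>_def)
    then show ?thesis by (intro that[OF f(2-5)]) auto
  qed
qed

text \<open>For fixed cells the masses of the plans converge cell by cell, so the uncommon fraction
  vanishes in every cell that carries cost. Convergence of the total costs prevents cost from
  escaping to infinitely many cells, so the row terms of \<open>transport_cost_overlap\<close>
  vanish in the limit and only \<open>\<delta>\<close> remains.\<close>

lemma transport_cost_tendsto_0_of_plans:
  assumes \<gamma>s: "\<And>n. \<gamma>s n \<in> couplings \<mu> (\<nu>s n)" and \<gamma>: "\<gamma> \<in> couplings \<mu> \<nu>"
    and w: "weakly_conv \<gamma>s \<gamma>" and cost: "(\<lambda>n. plan_cost c (\<gamma>s n)) \<longlonglongrightarrow> plan_cost c \<gamma>"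
    and fin: "plan_cost c \<gamma> \<noteq> \<top>"
  shows "(\<lambda>n. transport_cost c \<nu> (\<nu>s n)) \<longlonglongrightarrow> 0"
proof (rule tendsto_zero_ennreal)
  fix b :: real assume b: "0 < b"
  define \<delta> where "\<delta> = min 1 (b / 2)"
  have \<delta>: "\<delta> > 0" "\<delta> \<le> 1" "\<delta> < b" using b by (auto simp: \<delta>_def)
  obtain f :: "nat \<Rightarrow> 'a \<Rightarrow> real" and U where f:
    "\<And>i. continuous_on UNIV (f i)" "\<And>i x. 0 \<le> f i x" "\<And>i x. x \<notin> U i \<Longrightarrow> f i x = 0"
    "\<And>x. (\<lambda>i. f i x) sums 1" and U: "\<And>i x y. x \<in> U i \<Longrightarrow> y \<in> U i \<Longrightarrow> c x y < \<delta>"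
    using small_cells[OF \<delta>(1)] by metis
  have f1: "f i x \<le> 1" for i x
  proof -
    have "f i x = (\<Sum>k\<in>{i}. f k x)" by simp
    also have "\<dots> \<le> (\<Sum>k. f k x)" using f(2) f(4)[of x] by (intro sum_le_suminf) (auto simp: sums_iff)
    finally show ?thesis using f(4)[of x] by (simp add: sums_iff)
  qed
  define P where "P i j z = ennreal (f i (fst z) * f j (snd z))" for i j and z :: "'a \<times> 'a"
  define h where "h i j z = f i (fst z) * f j (snd z)" for i j and z :: "'a \<times> 'a"
  have f2: "continuous_on UNIV (\<lambda>z::'a \<times> 'a. f i (fst z))" "continuous_on UNIV (\<lambda>z::'a \<times> 'a. f i (snd z))" for i
    using continuous_on_compose2[OF f(1)[of i] continuous_on_fst[OF continuous_on_id]]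
      continuous_on_compose2[OF f(1)[of i] continuous_on_snd[OF continuous_on_id]] by auto
  have h: "continuous_on UNIV (h i j)" "\<And>z. 0 \<le> h i j z" "\<And>z. h i j z \<le> 1" for i j
    using f(2) f1 f2 by (auto simp: h_def intro!: continuous_on_mult mult_nonneg_nonneg mult_le_one)
  have hb: "bounded (range (h i j))" for i j
    using h[of i j] by (auto simp: bounded_iff intro!: exI[of _ 1])
  have b\<gamma>: "\<gamma> \<in> borel_probs" "\<gamma>s n \<in> borel_probs" for n
    using \<gamma> \<gamma>s couplings_borel_probs by blast+
  define m where "m i j = (\<integral>\<^sup>+z. P i j z \<partial>\<gamma>)" for i j
  define ms where "ms n i j = (\<integral>\<^sup>+z. P i j z \<partial>\<gamma>s n)" for n i j
  \<comment> \<open>The added 1 absorbs the constant of the growth condition; summed over all cells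
    the weights give 1 plus the plan cost.\<close>
  define C where "C i j = (\<integral>\<^sup>+z. P i j z * ennreal (1 + c (fst z) (snd z)) \<partial>\<gamma>)" for i j
  define Cs where "Cs n i j = (\<integral>\<^sup>+z. P i j z * ennreal (1 + c (fst z) (snd z)) \<partial>\<gamma>s n)" for n i j
  have Pm: "P i j \<in> borel_measurable borel" for i j
    using borel_measurable_continuous_onI[OF h(1)[of i j]] by (simp add: P_def[abs_def] h_def[abs_def])
  have cm: "(\<lambda>z. ennreal (1 + c (fst z) (snd z))) \<in> borel_measurable borel" by measurable
  have mi: "(\<integral>\<^sup>+z. P i j z \<partial>\<mu>) = ennreal (integral\<^sup>L \<mu> (h i j))" if "\<mu> \<in> borel_probs" for \<mu> i j
    unfolding P_def h_def[symmetric] using h(2) that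
    by (intro nn_integral_eq_integral integrable_bdd_continuous h hb) auto
  have mlim: "(\<lambda>n. ms n i j) \<longlonglongrightarrow> m i j" for i j
    unfolding m_def ms_def mi[OF b\<gamma>(1)] mi[OF b\<gamma>(2)]
    using w h hb by (intro tendsto_ennrealI) (auto simp: weakly_conv_def)
  have mfin: "m i j \<noteq> \<top>" "ms n i j \<noteq> \<top>" for i j n
    unfolding m_def ms_def mi[OF b\<gamma>(1)] mi[OF b\<gamma>(2)] by auto
  have Clim: "C i j \<le> liminf (\<lambda>n. Cs n i j)" for i j
  proof -
    have eq: "P i j z * ennreal (1 + c (fst z) (snd z)) = ennreal (h i j z * (1 + c (fst z) (snd z)))" for z
      using h(2)[of i j z] cost_nonneg by (simp add: P_def h_def ennreal_mult)
    have "continuous_on UNIV (\<lambda>z. h i j z * (1 + c (fst z) (snd z)))"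
      by (intro continuous_intros h(1) cost_continuous')
    then show ?thesis
      unfolding C_def Cs_def eq using h(2) cost_nonneg
      by (intro nn_integral_le_liminf_weakly_conv[OF w b\<gamma>(2,1)]) auto
  qed
  have Psum: "(\<Sum>i. \<Sum>j. P i j z) = 1" for z
  proof -
    have "(\<Sum>i. ennreal (f i x)) = 1" for x
      using f(2,4) by (rule suminf_ennreal_eq_1)
    then show ?thesis using f(2) by (simp add: P_def ennreal_mult)
  qed
  have total: "(\<Sum>i. \<Sum>j. \<integral>\<^sup>+z. P i j z * ennreal (1 + c (fst z) (snd z)) \<partial>\<mu>) = 1 + plan_cost c \<mu>"
    if \<mu>: "\<mu> \<in> borel_probs" for \<mu>
  proof -
    have [measurable]: "P i j \<in> borel_measurable \<mu>" "(\<lambda>z. ennreal (1 + c (fst z) (snd z))) \<in> borel_measurable \<mu>"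
      "(\<lambda>z. ennreal (c (fst z) (snd z))) \<in> borel_measurable \<mu>" for i j
      using Pm cm \<mu> by (auto simp: borel_probs_measurable)
    have "(\<Sum>i. \<Sum>j. \<integral>\<^sup>+z. P i j z * ennreal (1 + c (fst z) (snd z)) \<partial>\<mu>) =
        (\<integral>\<^sup>+z. (\<Sum>i. \<Sum>j. P i j z * ennreal (1 + c (fst z) (snd z))) \<partial>\<mu>)"
      by (simp add: nn_integral_suminf del: ennreal_suminf_multc)
    also have "\<dots> = (\<integral>\<^sup>+z. 1 + ennreal (c (fst z) (snd z)) \<partial>\<mu>)"
      using cost_nonneg by (simp add: Psum)
    also have "\<dots> = 1 + plan_cost c \<mu>"
      using prob_space.emeasure_space_1[OF borel_probs_prob[OF \<mu>]] by (simp add: nn_integral_add)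
    finally show ?thesis .
  qed
  have tot: "(\<lambda>n. \<Sum>i. \<Sum>j. Cs n i j) \<longlonglongrightarrow> (\<Sum>i. \<Sum>j. C i j)"
    unfolding C_def Cs_def total[OF b\<gamma>(1)] total[OF b\<gamma>(2)] using cost by (intro tendsto_add tendsto_const)
  have Cfin: "(\<Sum>i. \<Sum>j. C i j) \<noteq> \<top>"
    unfolding C_def total[OF b\<gamma>(1)] using fin by simp
  \<comment> \<open>The uncommon fraction is known to vanish only in cells of positive limit mass;
    the other cells carry no limit cost.\<close>
  have Cm: "m i j \<noteq> 0" if "C i j \<noteq> 0" for i j
  proof
    assume "m i j = 0"
    then have "AE z in \<gamma>. P i j z = 0"
      using Pm b\<gamma> by (simp add: m_def nn_integral_0_iff_AE borel_probs_measurable)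
    then have "C i j = (\<integral>\<^sup>+z. 0 \<partial>\<gamma>)" unfolding C_def by (intro nn_integral_cong_AE) auto
    with that show False by simp
  qed
  define X where "X n = (\<Sum>i. \<Sum>j. C i j * (excess m (ms n) i j / m i j))" for n
  define Y where "Y n = (\<Sum>i. \<Sum>j. Cs n i j * (excess (ms n) m i j / ms n i j))" for n
  define E where "E = ennreal (A + A * B + B + B * B)"
  \<comment> \<open>For \<open>X\<close> the cell costs do not depend on \<open>n\<close>, so the
    totals converge trivially; for \<open>Y\<close> their convergence is that of the plan
    costs.\<close>
  have X: "X \<longlonglongrightarrow> 0"
    unfolding X_def[abs_def]
    by (rule suminf2_tendsto_0[where C=C])
      (auto intro!: excess_div_le_1 excess_div_tendsto_0 mlim mfin Cm Cfin simp: Liminf_const)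
  have Y: "Y \<longlonglongrightarrow> 0"
    unfolding Y_def[abs_def]
    by (rule suminf2_tendsto_0[where C=C])
      (auto intro!: excess_div_le_1 excess_div_tendsto_0 mlim mfin Cm Cfin Clim tot)
  have le: "transport_cost c \<nu> (\<nu>s n) \<le> ennreal \<delta> + E * (X n + Y n)" for n
  proof -
    have "distr \<gamma> borel fst = distr (\<gamma>s n) borel fst" "\<nu> = distr \<gamma> borel snd" "\<nu>s n = distr (\<gamma>s n) borel snd"
      using \<gamma> \<gamma>s[of n] by (auto simp: couplings_def)
    then show ?thesis
      unfolding X_def Y_def E_def
      using transport_cost_overlap[OF b\<gamma>(1) b\<gamma>(2)[of n] _ f U \<delta>(2) P_def m_def ms_def C_def Cs_def] by simp
  qed
  have "(\<lambda>n. ennreal \<delta> + E * (X n + Y n)) \<longlonglongrightarrow> ennreal \<delta> + E * (0 + 0)"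
    using X Y by (intro tendsto_add tendsto_const ennreal_tendsto_cmult) (auto simp: E_def)
  moreover have "ennreal \<delta> + E * (0 + 0) < ennreal b" using \<delta> b by (simp add: ennreal_lessI)
  ultimately have "eventually (\<lambda>n. ennreal \<delta> + E * (X n + Y n) < ennreal b) sequentially"
    by (rule order_tendstoD(2))
  then show "eventually (\<lambda>n. transport_cost c \<nu> (\<nu>s n) < ennreal b) sequentially"
    by eventually_elim (rule le_less_trans[OF le])
qed

text \<open>A substitute for the gluing lemma that needs no disintegration: the two copies of the common
  marginal are identified only up to cost \<open>\<delta>\<close>.\<close>

lemma glue_couplings:
  assumes \<kappa>: "\<kappa> \<in> couplings \<mu> \<nu>" and \<pi>: "\<pi> \<in> couplings \<nu> \<rho>" and \<delta>: "\<delta> > 0"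
  obtains \<Theta> where "\<Theta> \<in> couplings \<kappa> \<pi>" "AE p in \<Theta>. c (snd (fst p)) (fst (snd p)) < \<delta>"
proof -
  obtain f :: "nat \<Rightarrow> 'a \<Rightarrow> real" and U where f:
    "\<And>i. continuous_on UNIV (f i)" "\<And>i x. 0 \<le> f i x" "\<And>i x. x \<notin> U i \<Longrightarrow> f i x = 0"
    "\<And>x. (\<lambda>i. f i x) sums 1" and U: "\<And>i x y. x \<in> U i \<Longrightarrow> y \<in> U i \<Longrightarrow> c x y < \<delta>"
    using small_cells[OF \<delta>] by metis
  have b: "\<kappa> \<in> borel_probs" "\<pi> \<in> borel_probs" "\<nu> \<in> borel_probs"
    using couplings_borel_probs[OF \<kappa>] couplings_borel_probs[OF \<pi>] by auto
  define p where "p i x = ennreal (f i x)" for i x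
  have psum: "(\<Sum>i. p i x) = 1" for x
    unfolding p_def using f(2,4) by (rule suminf_ennreal_eq_1)
  have pm[measurable]: "p i \<in> borel_measurable borel" for i
    unfolding p_def[abs_def] using f(1) by (intro measurable_compose[OF _ measurable_ennreal] borel_measurable_continuous_onI)
  define m where "m i = integral\<^sup>N \<nu> (p i)" for i
  have m\<kappa>: "(\<integral>\<^sup>+z. p i (snd z) \<partial>\<kappa>) = m i" and m\<pi>: "(\<integral>\<^sup>+z. p i (fst z) \<partial>\<pi>) = m i" for i
    using nn_integral_coupling[OF \<kappa> pm] nn_integral_coupling[OF \<pi> pm] by (simp_all add: m_def)
  have mfin: "m i \<noteq> \<top>" for i
  proof -
    have "m i \<le> (\<integral>\<^sup>+x. (\<Sum>i. p i x) \<partial>\<nu>)"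
      unfolding m_def using sum_le_suminf[of "\<lambda>i. p i x" "{i}" for x] by (intro nn_integral_mono) simp
    then show ?thesis using prob_space.emeasure_space_1[OF borel_probs_prob[OF b(3)]]
      by (auto simp: psum top_unique)
  qed
  \<comment> \<open>Within each cell of the shared coordinate the two plans are coupled
    independently, normalised by the mass \<open>m i\<close> that \<open>\<nu>\<close> gives to the
    cell.\<close>
  define w where "w = (\<lambda>q :: ('a \<times> 'a) \<times> ('a \<times> 'a). \<Sum>i. p i (snd (fst q)) * p i (fst (snd q)) * inverse (m i))"
  have one: "(\<Sum>i. p i x * (m i * inverse (m i))) = 1" if "\<forall>i. m i = 0 \<longrightarrow> p i x = 0" for x
  proof -
    have "(\<Sum>i. p i x * (m i * inverse (m i))) = (\<Sum>i. p i x)"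
    proof (intro suminf_cong)
      fix i
      show "p i x * (m i * inverse (m i)) = p i x"
        using that mfin[of i] ennreal_divide_self[of "m i"]
        by (cases "m i = 0") (auto simp: divide_ennreal_def top.not_eq_extremum)
    qed
    then show ?thesis by (simp add: psum)
  qed
  have sm[measurable_cong]: "sets \<kappa> = sets borel" "sets \<pi> = sets borel" using b by (auto simp: borel_probs_sets)
  have pm'[measurable]: "(\<lambda>z. p i (snd z)) \<in> borel_measurable \<kappa>" "(\<lambda>z. p i (fst z)) \<in> borel_measurable \<pi>" for i
    using b measurable_compose[OF fst_measurable_borel pm] measurable_compose[OF snd_measurable_borel pm]
    by (auto simp: borel_probs_measurable)
  have n1: "AE z in \<kappa>. \<forall>i. m i = 0 \<longrightarrow> p i (snd z) = 0"
    unfolding AE_all_countable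
  proof
    fix i show "AE z in \<kappa>. m i = 0 \<longrightarrow> p i (snd z) = 0"
      using m\<kappa>[of i] by (cases "m i = 0") (simp_all add: nn_integral_0_iff_AE)
  qed
  have n2: "AE z in \<pi>. \<forall>i. m i = 0 \<longrightarrow> p i (fst z) = 0"
    unfolding AE_all_countable
  proof
    fix i show "AE z in \<pi>. m i = 0 \<longrightarrow> p i (fst z) = 0"
      using m\<pi>[of i] by (cases "m i = 0") (simp_all add: nn_integral_0_iff_AE)
  qed
  have w1: "AE z in \<kappa>. (\<integral>\<^sup>+z'. w (z, z') \<partial>\<pi>) = 1"
    using n1
  proof eventually_elim
    case (elim z)
    have "(\<integral>\<^sup>+z'. w (z, z') \<partial>\<pi>) = (\<Sum>i. p i (snd z) * (m i * inverse (m i)))"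
      unfolding w_def by (simp add: nn_integral_suminf nn_integral_multc nn_integral_cmult m\<pi> mult.assoc)
    with one[OF elim] show ?case by simp
  qed
  have w2: "AE z' in \<pi>. (\<integral>\<^sup>+z. w (z, z') \<partial>\<kappa>) = 1"
    using n2
  proof eventually_elim
    case (elim z')
    have "(\<integral>\<^sup>+z. w (z, z') \<partial>\<kappa>) = (\<integral>\<^sup>+z. (\<Sum>i. p i (fst z') * inverse (m i) * p i (snd z)) \<partial>\<kappa>)"
      unfolding w_def by (simp add: mult_ac)
    also have "\<dots> = (\<Sum>i. p i (fst z') * inverse (m i) * m i)"
      by (simp add: nn_integral_suminf nn_integral_cmult m\<kappa>)
    finally show ?case using one[OF elim] by (simp add: mult_ac)
  qed
  have wm: "w \<in> borel_measurable borel"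
    unfolding w_def
    by (intro borel_measurable_suminf_order borel_measurable_times_ennreal borel_measurable_const
        measurable_compose[OF fst_measurable_borel measurable_compose[OF snd_measurable_borel]]
        measurable_compose[OF snd_measurable_borel measurable_compose[OF fst_measurable_borel]] pm)
  obtain \<Theta> where \<Theta>: "\<Theta> \<in> couplings (distr \<kappa> borel (\<lambda>z. z)) (distr \<pi> borel (\<lambda>z. z))"
    and I: "\<And>h. h \<in> borel_measurable borel \<Longrightarrow>
       (\<integral>\<^sup>+p. h p \<partial>\<Theta>) = (\<integral>\<^sup>+z. \<integral>\<^sup>+z'. w (z, z') * h (z, z') \<partial>\<pi> \<partial>\<kappa>)"
    using block_coupling[OF b(1,2) wm _ _ w1 w2, of "\<lambda>z. z" "\<lambda>z. z"] by auto
  have \<Theta>': "\<Theta> \<in> couplings \<kappa> \<pi>" using \<Theta> sm by (simp add: distr_id2)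
  define N where "N = {p :: ('a \<times> 'a) \<times> ('a \<times> 'a). \<delta> \<le> c (snd (fst p)) (fst (snd p))}"
  have N: "N \<in> sets borel"
    unfolding N_def by (intro borel_closed closed_Collect_le continuous_intros cost_continuous_on)
  \<comment> \<open>Two points of a common cell have cost below \<open>\<delta>\<close>, so on
    \<open>N\<close> every term of the density has a vanishing factor.\<close>
  have w0: "w q * indicator N q = 0" for q
  proof (cases "q \<in> N")
    case True
    then have "\<not> c (snd (fst q)) (fst (snd q)) < \<delta>" by (simp add: N_def)
    then have "f i (snd (fst q)) = 0 \<or> f i (fst (snd q)) = 0" for i using U f(3) by blast
    then have "p i (snd (fst q)) * p i (fst (snd q)) = 0" for i
      unfolding p_def by (metis ennreal_0 mult_zero_left mult_zero_right)
    then have "w q = (\<Sum>i::nat. 0)" unfolding w_def by (intro suminf_cong) (metis mult_zero_left)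
    then have "w q = 0" by simp
    then show ?thesis by simp
  qed simp
  have "emeasure \<Theta> N = (\<integral>\<^sup>+p. indicator N p \<partial>\<Theta>)"
    using N couplings_borel_probs(1)[OF \<Theta>'] by (simp add: borel_probs_sets)
  also have "\<dots> = 0" using N by (subst I) (simp_all add: w0)
  finally have "AE p in \<Theta>. p \<notin> N"
    using N couplings_borel_probs(1)[OF \<Theta>'] by (intro AE_not_in) (auto simp: null_sets_def borel_probs_sets)
  then have "AE p in \<Theta>. c (snd (fst p)) (fst (snd p)) < \<delta>" by (auto simp: N_def not_le)
  with \<Theta>' show ?thesis by (rule that)
qed

section \<open>Upper semicontinuity along sequences of vanishing transport cost\<close>

text \<open>As a supremum over an open condition the envelope is lower semicontinuous, hence measurable.  For
  \<open>\<eta> \<rightarrow> 0\<close> it decreases to \<open>g\<close>.\<close>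

definition envelope :: "('a \<Rightarrow> 'a \<Rightarrow> real) \<Rightarrow> real \<Rightarrow> 'a \<times> 'a \<Rightarrow> ennreal" where
  "envelope g \<eta> p = (SUP z\<in>{z. \<exists>y'. c (snd p) y' < \<eta> \<and> c y' z < \<eta>}. ennreal (g (fst p) z))"

lemma envelope_measurable:
  assumes g: "continuous_on UNIV (\<lambda>z. g (fst z) (snd z))"
  shows "envelope g \<eta> \<in> borel_measurable borel"
proof (rule borel_measurableI_greater)
  fix t :: ennreal
  \<comment> \<open>Here \<open>q\<close> stands for the pair of \<open>y'\<close> and
    \<open>z\<close>. For fixed \<open>q\<close> both conditions are open in \<open>p\<close>, and
    an arbitrary union of open sets is open.\<close>
  have eq: "{p \<in> space borel. t < envelope g \<eta> p} =
      (\<Union>q\<in>{q. c (fst q) (snd q) < \<eta>}. {p. c (snd p) (fst q) < \<eta>} \<inter> {p. t < ennreal (g (fst p) (snd q))})"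
    by (fastforce simp: envelope_def less_SUP_iff)
  have op: "open ({p. c (snd p) y < \<eta>} \<inter> {p. t < ennreal (g (fst p) z)})" for y z
  proof (intro open_Int open_Collect_less continuous_on_const cost_continuous_on continuous_on_snd continuous_on_id continuous_on_ennreal)
    show "continuous_on UNIV (\<lambda>p :: 'a \<times> 'a. g (fst p) z)"
      using continuous_on_compose2[OF g, of UNIV "\<lambda>p. (fst p, z)"] by (simp add: continuous_intros)
  qed
  show "{p \<in> space borel. t < envelope g \<eta> p} \<in> sets borel"
    unfolding eq by (intro borel_open open_UN ballI op)
qed

lemma envelope_upper:
  "c (snd p) y' < \<eta> \<Longrightarrow> c y' z < \<eta> \<Longrightarrow> ennreal (g (fst p) z) \<le> envelope g \<eta> p"
  unfolding envelope_def by (rule SUP_upper) auto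

text \<open>If the envelopes stayed above some \<open>b\<close> exceeding the value of
  \<open>g\<close>, there would be intermediate points \<open>y' n\<close> and end points
  \<open>z n\<close> with both costs tending to 0 and \<open>g\<close> above \<open>b\<close> at
  \<open>z n\<close>. By \<open>cost_tendsto_trans\<close> the points \<open>z n\<close> converge to
  \<open>snd p\<close>, against the continuity of \<open>g\<close>.\<close>

lemma envelope_tendsto:
  assumes g: "continuous_on UNIV (\<lambda>z. g (fst z) (snd z))" "\<And>x z. 0 \<le> g x z"
  shows "(\<lambda>n. envelope g (inverse (real (Suc n))) p) \<longlonglongrightarrow> ennreal (g (fst p) (snd p))"
proof (rule order_tendstoI)
  fix a assume a: "a < ennreal (g (fst p) (snd p))"
  have "ennreal (g (fst p) (snd p)) \<le> envelope g (inverse (real (Suc n))) p" for n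
    by (rule envelope_upper[of _ "snd p"]) auto
  then show "eventually (\<lambda>n. a < envelope g (inverse (real (Suc n))) p) sequentially"
    using a by (intro always_eventually allI) (rule less_le_trans)
next
  fix a assume a: "ennreal (g (fst p) (snd p)) < a"
  show "eventually (\<lambda>n. envelope g (inverse (real (Suc n))) p < a) sequentially"
  proof (rule ccontr)
    assume neg: "\<not> ?thesis"
    obtain b where b: "ennreal (g (fst p) (snd p)) < b" "b < a" using dense[OF a] by blast
    have mono: "envelope g (inverse (real (Suc m))) p \<le> envelope g (inverse (real (Suc n))) p" if "n \<le> m" for m n
    proof -
      have "inverse (real (Suc m)) \<le> inverse (real (Suc n))" using that by simp
      then show ?thesis unfolding envelope_def by (intro SUP_subset_mono Collect_mono) (meson less_le_trans, simp)
    qed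
    have "\<exists>z y'. c (snd p) y' < inverse (real (Suc n)) \<and> c y' z < inverse (real (Suc n)) \<and> b < ennreal (g (fst p) z)" for n
    proof -
      obtain m where "m \<ge> n" "\<not> envelope g (inverse (real (Suc m))) p < a"
        using neg by (auto simp: eventually_sequentially)
      then have "b < envelope g (inverse (real (Suc n))) p" using mono[of n m] b(2) by (meson less_le_trans not_less)
      then show ?thesis unfolding envelope_def less_SUP_iff by blast
    qed
    then obtain z y' where zy: "\<And>n. c (snd p) (y' n) < inverse (real (Suc n))"
      "\<And>n. c (y' n) (z n) < inverse (real (Suc n))" "\<And>n. b < ennreal (g (fst p) (z n))" by metis
    have "(\<lambda>n. c (snd p) (y' n)) \<longlonglongrightarrow> 0"
      by (rule tendsto_sandwich[OF _ _ tendsto_const LIMSEQ_inverse_real_of_nat])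
        (auto simp: cost_nonneg intro!: always_eventually less_imp_le zy simp del: of_nat_Suc)
    moreover have "(\<lambda>n. c (y' n) (z n)) \<longlonglongrightarrow> 0"
      by (rule tendsto_sandwich[OF _ _ tendsto_const LIMSEQ_inverse_real_of_nat])
        (auto simp: cost_nonneg intro!: always_eventually less_imp_le zy simp del: of_nat_Suc)
    ultimately have "z \<longlonglongrightarrow> snd p" by (rule cost_tendsto_trans)
    then have "(\<lambda>n. g (fst p) (z n)) \<longlonglongrightarrow> g (fst p) (snd p)"
      using continuous_on_tendsto_compose[OF g(1) tendsto_Pair[OF tendsto_const], of z "snd p" sequentially "fst p"] by simp
    then have "(\<lambda>n. ennreal (g (fst p) (z n))) \<longlonglongrightarrow> ennreal (g (fst p) (snd p))" by (rule tendsto_ennrealI)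
    then have "b \<le> ennreal (g (fst p) (snd p))"
      by (rule LIMSEQ_le_const) (use zy(3) in \<open>auto intro: less_imp_le\<close>)
    with b(1) show False by simp
  qed
qed

text \<open>Gluing \<open>\<kappa>\<close> to a cheap plan from \<open>\<nu>\<close> to
  \<open>\<nu>s n\<close> moves the second coordinate from \<open>y\<close> through
  \<open>y'\<close> to \<open>z\<close>. Where \<open>c y' z < \<eta>\<close>, the envelope bounds
  \<open>g\<close>; elsewhere \<open>bound\<close> gives a cost tail of \<open>\<kappa>\<close> plus
  a multiple of \<open>c y' z\<close>, and both have small integrals. A general \<open>g\<close> is
  allowed so that the cost itself and bounded test functions are both covered.\<close>

lemma coupling_integral_usc:
  assumes \<kappa>: "\<kappa> \<in> couplings \<mu> \<nu>" and fin: "plan_cost c \<kappa> \<noteq> \<top>"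
    and J0: "(\<lambda>n. transport_cost c \<nu> (\<nu>s n)) \<longlonglongrightarrow> 0"
    and g: "continuous_on UNIV (\<lambda>z. g (fst z) (snd z))" "\<And>x z. 0 \<le> g x z"
    and bound: "\<And>x y y' z. c y y' < 1 \<Longrightarrow> g x z \<le> D + E * (c x y + c y' z)" and DE: "D \<ge> 0" "E \<ge> 0"
    and a: "(\<integral>\<^sup>+p. ennreal (g (fst p) (snd p)) \<partial>\<kappa>) < a"
  shows "eventually (\<lambda>n. \<exists>\<theta>\<in>couplings \<mu> (\<nu>s n). (\<integral>\<^sup>+p. ennreal (g (fst p) (snd p)) \<partial>\<theta>) < a) sequentially"
proof -
  have b\<kappa>: "\<kappa> \<in> borel_probs" using couplings_borel_probs[OF \<kappa>] by simp
  interpret K: prob_space \<kappa> using b\<kappa> borel_probs_prob by blast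
  have gm: "(\<lambda>p. ennreal (g (fst p) (snd p))) \<in> borel_measurable borel"
    using borel_measurable_continuous_onI[OF g(1)] by measurable
  have cm\<kappa>: "(\<lambda>p. c (fst p) (snd p)) \<in> borel_measurable \<kappa>" using cost_measurable b\<kappa> by (simp add: borel_probs_measurable)
  have bfin: "(\<integral>\<^sup>+p. ennreal (d + e * c (fst p) (snd p)) \<partial>\<kappa>) < \<infinity>" if "d \<ge> 0" "e \<ge> 0" for d e
  proof -
    have "(\<integral>\<^sup>+p. ennreal (d + e * c (fst p) (snd p)) \<partial>\<kappa>) = (\<integral>\<^sup>+p. ennreal d + ennreal e * ennreal (c (fst p) (snd p)) \<partial>\<kappa>)"
      using that cost_nonneg by (simp add: ennreal_mult)
    also have "\<dots> = ennreal d + ennreal e * plan_cost c \<kappa>"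
      using cm\<kappa> by (simp add: nn_integral_add nn_integral_cmult K.emeasure_space_1)
    also have "\<dots> < \<infinity>" using fin by (simp add: ennreal_mult_less_top top.not_eq_extremum)
    finally show ?thesis .
  qed
  \<comment> \<open>With all radii at most 1, \<open>bound\<close> yields an integrable majorant.
    The limit is needed only to fix one radius \<open>\<eta>\<close> at which the integral is still
    below \<open>a\<close>.\<close>
  have "(\<lambda>n. \<integral>\<^sup>+p. envelope g (inverse (real (Suc n))) p \<partial>\<kappa>) \<longlonglongrightarrow> (\<integral>\<^sup>+p. ennreal (g (fst p) (snd p)) \<partial>\<kappa>)"
  proof (rule nn_integral_dominated_convergence[where w="\<lambda>p. ennreal (D + E + E * c (fst p) (snd p))"])
    show "envelope g (inverse (real (Suc n))) \<in> borel_measurable \<kappa>" for n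
      using envelope_measurable[OF g(1)] b\<kappa> by (simp add: borel_probs_measurable)
    show "(\<lambda>p. ennreal (g (fst p) (snd p))) \<in> borel_measurable \<kappa>"
      using gm b\<kappa> by (simp add: borel_probs_measurable)
    show "(\<lambda>p. ennreal (D + E + E * c (fst p) (snd p))) \<in> borel_measurable \<kappa>" using cm\<kappa> by measurable
    show "(\<integral>\<^sup>+p. ennreal (D + E + E * c (fst p) (snd p)) \<partial>\<kappa>) < \<infinity>" using bfin DE by simp
    show "AE p in \<kappa>. envelope g (inverse (real (Suc n))) p \<le> ennreal (D + E + E * c (fst p) (snd p))" for n
    proof (intro AE_I2)
      fix p
      have "inverse (real (Suc n)) \<le> 1" by (simp add: inverse_eq_divide)
      then show "envelope g (inverse (real (Suc n))) p \<le> ennreal (D + E + E * c (fst p) (snd p))"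
        unfolding envelope_def
      proof (intro SUP_least ennreal_leI)
        fix z assume "z \<in> {z. \<exists>y'. c (snd p) y' < inverse (real (Suc n)) \<and> c y' z < inverse (real (Suc n))}"
        then obtain y' where y': "c (snd p) y' < 1" "c y' z < 1"
          using \<open>inverse (real (Suc n)) \<le> 1\<close> by (auto intro: less_le_trans)
        have "g (fst p) z \<le> D + E * (c (fst p) (snd p) + c y' z)" using y'(1) by (rule bound)
        also have "\<dots> \<le> D + E * (c (fst p) (snd p) + 1)" using y'(2) DE by (intro add_left_mono mult_left_mono) auto
        finally show "g (fst p) z \<le> D + E + E * c (fst p) (snd p)" by (simp add: algebra_simps)
      qed
    qed
  qed (intro AE_I2 envelope_tendsto g)
  then have "eventually (\<lambda>n. (\<integral>\<^sup>+p. envelope g (inverse (real (Suc n))) p \<partial>\<kappa>) < a) sequentially"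
    using a by (rule order_tendstoD(2))
  then obtain n0 where n0: "(\<integral>\<^sup>+p. envelope g (inverse (real (Suc n0))) p \<partial>\<kappa>) < a"
    by (auto simp: eventually_sequentially)
  define \<eta> where "\<eta> = inverse (real (Suc n0))"
  have \<eta>: "\<eta> > 0" "\<eta> \<le> 1" by (auto simp: \<eta>_def inverse_eq_divide)
  define S where "S = (\<integral>\<^sup>+p. envelope g \<eta> p \<partial>\<kappa>)"
  have S: "S < a" using n0 by (simp add: S_def \<eta>_def)
  obtain \<epsilon> :: real where \<epsilon>: "\<epsilon> > 0" "S + ennreal \<epsilon> + ennreal \<epsilon> < a"
  proof -
    obtain t where t: "S < t" "t < a" using dense[OF S] by blast
    obtain s' where s': "S = ennreal s'" "s' \<ge> 0" using t by (cases S) auto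
    obtain t' where t': "t = ennreal t'" "t' \<ge> 0" using t by (cases t) auto
    have "s' < t'" using t(1) s' t' by (simp add: ennreal_less_iff)
    moreover have "S + ennreal ((t' - s') / 2) + ennreal ((t' - s') / 2) = t"
      using \<open>s' < t'\<close> s' t' by (simp add: ennreal_plus[symmetric] del: ennreal_plus)
    ultimately show ?thesis using that[of "(t' - s') / 2"] t(2) by simp
  qed
  \<comment> \<open>This is the part of the cost of \<open>\<kappa>\<close> beyond level
    \<open>R\<close>; its integral vanishes as \<open>R\<close> grows because the plan cost is
    finite.\<close>
  define T where "T R p = ennreal (E * max 0 (c (fst p) (snd p) - real R))" for R and p :: "'a \<times> 'a"
  have Tm: "T R \<in> borel_measurable borel" for R unfolding T_def[abs_def] by measurable
  have "(\<lambda>R. \<integral>\<^sup>+p. T R p \<partial>\<kappa>) \<longlonglongrightarrow> (\<integral>\<^sup>+p. 0 \<partial>\<kappa>)"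
  proof (rule nn_integral_dominated_convergence[where w="\<lambda>p. ennreal (0 + E * c (fst p) (snd p))"])
    show "T R \<in> borel_measurable \<kappa>" for R using Tm b\<kappa> by (simp add: borel_probs_measurable)
    show "(\<integral>\<^sup>+p. ennreal (0 + E * c (fst p) (snd p)) \<partial>\<kappa>) < \<infinity>" using bfin DE by blast
    show "AE p in \<kappa>. T R p \<le> ennreal (0 + E * c (fst p) (snd p))" for R
      using DE cost_nonneg by (intro AE_I2) (auto simp: T_def intro!: ennreal_leI mult_left_mono)
    show "AE p in \<kappa>. (\<lambda>R. T R p) \<longlonglongrightarrow> 0"
    proof (intro AE_I2)
      fix p
      obtain R0 :: nat where R0: "c (fst p) (snd p) \<le> real R0" using real_arch_simple by blast
      have "T R p = 0" if "R \<ge> R0" for R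
      proof -
        have "real R0 \<le> real R" using that by simp
        then have "max 0 (c (fst p) (snd p) - real R) = 0" using R0 by linarith
        then show ?thesis by (simp add: T_def)
      qed
      then show "(\<lambda>R. T R p) \<longlonglongrightarrow> 0"
        by (intro tendsto_eventually) (auto simp: eventually_sequentially)
    qed
  qed (use cm\<kappa> in measurable)
  then have "eventually (\<lambda>R. (\<integral>\<^sup>+p. T R p \<partial>\<kappa>) < ennreal \<epsilon>) sequentially"
    using \<epsilon>(1) by (intro order_tendstoD(2)) auto
  then obtain R where R: "(\<integral>\<^sup>+p. T R p \<partial>\<kappa>) < ennreal \<epsilon>" by (auto simp: eventually_sequentially)
  \<comment> \<open>Where \<open>c y' z \<ge> \<eta>\<close>, the constant
    \<open>D + E * real R\<close> is at most \<open>(D + E * real R) / \<eta>\<close> times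
    \<open>c y' z\<close>; the last summand accounts for the term \<open>E * c y' z\<close> of
    \<open>bound\<close>.\<close>
  define L where "L = (D + E * real R) / \<eta> + E"
  have L: "L \<ge> 0" using DE \<eta> by (simp add: L_def)
  have pt: "ennreal (g (fst p) z) \<le> envelope g \<eta> p + T R p + ennreal L * ennreal (c y' z)"
    if y': "c (snd p) y' < \<eta>" for p y' z
  proof (cases "c y' z < \<eta>")
    case True
    then show ?thesis using envelope_upper[of p y' \<eta> z g] y' by (metis add.assoc add_increasing2 zero_le)
  next
    case False
    have "D + E * real R = (D + E * real R) / \<eta> * \<eta>" using \<eta> by simp
    also have "\<dots> \<le> (D + E * real R) / \<eta> * c y' z"
      using False DE \<eta> by (intro mult_left_mono) auto
    finally have 1: "D + E * real R \<le> (D + E * real R) / \<eta> * c y' z" .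
    have "g (fst p) z \<le> D + E * (c (fst p) (snd p) + c y' z)" using y' \<eta> by (intro bound) auto
    also have "\<dots> \<le> D + E * (real R + max 0 (c (fst p) (snd p) - real R) + c y' z)"
      using DE by (intro add_left_mono mult_left_mono) auto
    also have "\<dots> \<le> E * max 0 (c (fst p) (snd p) - real R) + L * c y' z"
      using 1 by (simp add: L_def algebra_simps)
    finally have "ennreal (g (fst p) z) \<le> ennreal (E * max 0 (c (fst p) (snd p) - real R) + L * c y' z)" by (rule ennreal_leI)
    also have "\<dots> = T R p + ennreal L * ennreal (c y' z)"
      using L DE cost_nonneg by (simp add: T_def ennreal_mult)
    also have "\<dots> \<le> envelope g \<eta> p + T R p + ennreal L * ennreal (c y' z)" by (simp add: add.assoc)
    finally show ?thesis .
  qed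
  \<comment> \<open>Dividing by \<open>L + 1\<close> rather than \<open>L\<close> covers the case
    \<open>L = 0\<close>.\<close>
  have "eventually (\<lambda>n. transport_cost c \<nu> (\<nu>s n) < ennreal (\<epsilon> / (L + 1))) sequentially"
    using \<epsilon> L by (intro order_tendstoD(2)[OF J0]) auto
  then show ?thesis
  proof eventually_elim
    case (elim n)
    then obtain \<pi> where \<pi>: "\<pi> \<in> couplings \<nu> (\<nu>s n)" "plan_cost c \<pi> < ennreal (\<epsilon> / (L + 1))"
      by (rule transport_cost_less)
    have L\<epsilon>: "ennreal L * plan_cost c \<pi> \<le> ennreal \<epsilon>"
    proof -
      have "ennreal L * plan_cost c \<pi> \<le> ennreal L * ennreal (\<epsilon> / (L + 1))" using \<pi>(2) by (intro mult_left_mono) auto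
      also have "\<dots> = ennreal (L * (\<epsilon> / (L + 1)))" using L \<epsilon> by (intro ennreal_mult[symmetric]) auto
      also have "\<dots> \<le> ennreal \<epsilon>" using L \<epsilon> by (intro ennreal_leI) (simp add: field_simps)
      finally show ?thesis .
    qed
    obtain \<Theta> where \<Theta>: "\<Theta> \<in> couplings \<kappa> \<pi>" "AE q in \<Theta>. c (snd (fst q)) (fst (snd q)) < \<eta>"
      using glue_couplings[OF \<kappa> \<pi>(1) \<eta>(1)] .
    have b\<Theta>: "\<Theta> \<in> borel_probs" and d\<Theta>: "distr \<Theta> borel fst = \<kappa>" "distr \<Theta> borel snd = \<pi>"
      using \<Theta>(1) by (auto simp: couplings_def)
    \<comment> \<open>Dropping the two middle coordinates turns the glued plan into one from
      \<open>\<mu>\<close> to \<open>\<nu>s n\<close>.\<close>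
    define F where "F = (\<lambda>q :: ('a \<times> 'a) \<times> ('a \<times> 'a). (fst (fst q), snd (snd q)))"
    have Fm: "F \<in> borel_measurable borel"
      unfolding F_def by (intro borel_measurable_continuous_onI continuous_intros)
    have Fm\<Theta>: "F \<in> \<Theta> \<rightarrow>\<^sub>M borel" using Fm b\<Theta> by (simp add: borel_probs_measurable)
    define \<theta> where "\<theta> = distr \<Theta> borel F"
    have fsm: "fst \<in> \<Theta> \<rightarrow>\<^sub>M borel" "snd \<in> \<Theta> \<rightarrow>\<^sub>M borel"
      using b\<Theta> by (simp_all add: borel_probs_measurable fst_measurable_borel snd_measurable_borel)
    have "distr \<theta> borel fst = distr (distr \<Theta> borel fst) borel fst"
      unfolding \<theta>_def using Fm\<Theta> fsm by (simp add: distr_distr fst_measurable_borel F_def o_def)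
    then have 1: "distr \<theta> borel fst = \<mu>" using \<kappa> d\<Theta> by (simp add: couplings_def)
    have "distr \<theta> borel snd = distr (distr \<Theta> borel snd) borel snd"
      unfolding \<theta>_def using Fm\<Theta> fsm by (simp add: distr_distr snd_measurable_borel F_def o_def)
    then have 2: "distr \<theta> borel snd = \<nu>s n" using \<pi> d\<Theta> by (simp add: couplings_def)
    have \<theta>: "\<theta> \<in> couplings \<mu> (\<nu>s n)"
      using 1 2 distr_borel_probs[OF b\<Theta> Fm] by (simp add: couplings_def \<theta>_def)
    have mm: "(\<lambda>p. envelope g \<eta> p + T R p) \<in> borel_measurable borel"
      using envelope_measurable[OF g(1)] Tm by measurable
    have mc: "(\<lambda>p. ennreal L * ennreal (c (fst p) (snd p))) \<in> borel_measurable borel" by measurable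
    have "(\<integral>\<^sup>+p. ennreal (g (fst p) (snd p)) \<partial>\<theta>) = (\<integral>\<^sup>+q. ennreal (g (fst (fst q)) (snd (snd q))) \<partial>\<Theta>)"
      unfolding \<theta>_def using nn_integral_distr[OF Fm\<Theta>, of "\<lambda>p. ennreal (g (fst p) (snd p))"] gm by (simp add: F_def)
    also have "\<dots> \<le> (\<integral>\<^sup>+q. (envelope g \<eta> (fst q) + T R (fst q)) + ennreal L * ennreal (c (fst (snd q)) (snd (snd q))) \<partial>\<Theta>)"
      using \<Theta>(2) by (intro nn_integral_mono_AE) (auto elim!: eventually_mono intro: pt)
    also have "\<dots> = (\<integral>\<^sup>+q. envelope g \<eta> (fst q) + T R (fst q) \<partial>\<Theta>) + (\<integral>\<^sup>+q. ennreal L * ennreal (c (fst (snd q)) (snd (snd q))) \<partial>\<Theta>)"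
      using measurable_compose[OF fsm(1) mm] measurable_compose[OF fsm(2) mc] by (intro nn_integral_add) auto
    also have "(\<integral>\<^sup>+q. envelope g \<eta> (fst q) + T R (fst q) \<partial>\<Theta>) = (\<integral>\<^sup>+p. envelope g \<eta> p + T R p \<partial>\<kappa>)"
      using nn_integral_coupling(1)[OF \<Theta>(1) mm] .
    also have "(\<integral>\<^sup>+q. ennreal L * ennreal (c (fst (snd q)) (snd (snd q))) \<partial>\<Theta>) = (\<integral>\<^sup>+p. ennreal L * ennreal (c (fst p) (snd p)) \<partial>\<pi>)"
      using nn_integral_coupling(2)[OF \<Theta>(1) mc] .
    also have "\<dots> = ennreal L * plan_cost c \<pi>"
      using couplings_borel_probs(1)[OF \<pi>(1)] by (intro nn_integral_cmult) (simp add: borel_probs_measurable)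
    also have "(\<integral>\<^sup>+p. envelope g \<eta> p + T R p \<partial>\<kappa>) = S + (\<integral>\<^sup>+p. T R p \<partial>\<kappa>)"
      unfolding S_def using envelope_measurable[OF g(1)] Tm b\<kappa> by (intro nn_integral_add) (simp_all add: borel_probs_measurable)
    also have "S + (\<integral>\<^sup>+p. T R p \<partial>\<kappa>) + ennreal L * plan_cost c \<pi> \<le> S + ennreal \<epsilon> + ennreal \<epsilon>"
      using R L\<epsilon> by (intro add_mono) auto
    also have "\<dots> < a" by (rule \<epsilon>(2))
    finally show ?case using \<theta> by blast
  qed
qed

lemma transport_cost_usc:
  assumes J0: "(\<lambda>n. transport_cost c \<nu> (\<nu>s n)) \<longlonglongrightarrow> 0" and r: "transport_cost c \<mu> \<nu> < r"
  shows "eventually (\<lambda>n. transport_cost c \<mu> (\<nu>s n) < r) sequentially"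
proof -
  obtain \<kappa> where \<kappa>: "\<kappa> \<in> couplings \<mu> \<nu>" "plan_cost c \<kappa> < r" using r by (rule transport_cost_less)
  \<comment> \<open>Both constants result from two uses of the growth condition, from
    \<open>x\<close> to \<open>z\<close> through \<open>y\<close> and from \<open>y\<close> to
    \<open>z\<close> through \<open>y'\<close>, with \<open>c y y' < 1\<close>.\<close>
  define D where "D = A + B * (A + B)"
  define E where "E = B + B * B"
  have "c x z \<le> D + E * (c x y + c y' z)" if "c y y' < 1" for x y y' z
  proof -
    have 1: "c y z \<le> A + B * (1 + c y' z)"
      using growth(2)[of y z y'] that AB_nonneg by (smt (verit) mult_left_mono)
    have "c x z \<le> A + B * (c x y + c y z)" by (rule growth(2))
    also have "\<dots> \<le> A + B * (c x y + (A + B * (1 + c y' z)))"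
      using 1 AB_nonneg by (intro add_left_mono mult_left_mono) auto
    also have "\<dots> = D + B * c x y + B * B * c y' z" by (simp add: D_def algebra_simps)
    also have "\<dots> \<le> D + E * c x y + E * c y' z"
      using AB_nonneg cost_nonneg by (intro add_mono mult_right_mono) (auto simp: E_def)
    finally show ?thesis by (simp add: algebra_simps)
  qed
  moreover have "D \<ge> 0" "E \<ge> 0" using AB_nonneg by (auto simp: D_def E_def)
  ultimately have "eventually (\<lambda>n. \<exists>\<theta>\<in>couplings \<mu> (\<nu>s n). plan_cost c \<theta> < r) sequentially"
    using \<kappa> by (intro coupling_integral_usc[OF \<kappa>(1) _ J0, where D=D and E=E] cost_continuous' cost_nonneg) auto
  then show ?thesis
    by eventually_elim (auto intro: le_less_trans[OF transport_cost_le])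
qed

section \<open>Vanishing transport cost implies weak convergence\<close>

lemma diagonal_coupling:
  fixes \<nu> :: "'a measure"
  assumes "\<nu> \<in> borel_probs"
  shows "distr \<nu> borel (\<lambda>x. (x, x)) \<in> couplings \<nu> \<nu>"
    and "h \<in> borel_measurable borel \<Longrightarrow> (\<integral>\<^sup>+p. h p \<partial>distr \<nu> borel (\<lambda>x. (x, x))) = (\<integral>\<^sup>+x. h (x, x) \<partial>\<nu>)"
proof -
  have d: "(\<lambda>x::'a. (x, x)) \<in> borel_measurable borel"
    by (intro borel_measurable_continuous_onI continuous_intros)
  have d': "(\<lambda>x::'a. (x, x)) \<in> \<nu> \<rightarrow>\<^sub>M borel" using d assms by (simp add: borel_probs_measurable)
  have s: "sets \<nu> = sets borel" using assms by (rule borel_probs_sets)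
  show "distr \<nu> borel (\<lambda>x. (x, x)) \<in> couplings \<nu> \<nu>"
    using distr_borel_probs[OF assms d] d' s
    by (simp add: couplings_def distr_distr fst_measurable_borel snd_measurable_borel o_def distr_id2)
  show "h \<in> borel_measurable borel \<Longrightarrow> (\<integral>\<^sup>+p. h p \<partial>distr \<nu> borel (\<lambda>x. (x, x))) = (\<integral>\<^sup>+x. h (x, x) \<partial>\<nu>)"
    using d' by (intro nn_integral_distr) simp_all
qed

lemma transport_cost_self: "\<nu> \<in> borel_probs \<Longrightarrow> transport_cost c \<nu> \<nu> = 0"
  using transport_cost_le[OF diagonal_coupling(1), of \<nu> c] diagonal_coupling(2)[of \<nu> "\<lambda>p. ennreal (c (fst p) (snd p))"]
  by simp

text \<open>For the diagonal plan of \<open>\<nu>\<close>, which costs nothing, and a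
  \<open>g\<close> depending on the second coordinate only, \<open>coupling_integral_usc\<close> is
  upper semicontinuity of the integral of a bounded test function. Negating the function gives the
  lower bound.\<close>

lemma weakly_conv_of_transport_cost:
  assumes J0: "(\<lambda>n. transport_cost c \<nu> (\<nu>s n)) \<longlonglongrightarrow> 0" and \<nu>: "\<nu> \<in> borel_probs" and \<nu>s: "\<And>n. \<nu>s n \<in> borel_probs"
  shows "weakly_conv \<nu>s \<nu>"
proof -
  have upper: "eventually (\<lambda>n. integral\<^sup>L (\<nu>s n) f < a) sequentially"
    if f: "continuous_on UNIV f" "bounded (range f)" and a: "integral\<^sup>L \<nu> f < a" for f :: "'a \<Rightarrow> real" and a
  proof -
    obtain b where b: "\<And>x. \<bar>f x\<bar> \<le> b" using f(2) by (auto simp: bounded_iff)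
    have b0: "b \<ge> 0" using b[of undefined] by simp
    \<comment> \<open>The shift by \<open>b\<close> makes \<open>g\<close> nonnegative with values
      at most \<open>2 * b\<close>, so the growth bound holds with \<open>D = 2 * b\<close> and
      \<open>E = 0\<close>.\<close>
    define g where "g x z = f z + b" for x z :: 'a
    have g0: "g x z \<ge> 0" and gb: "g x z \<le> 2 * b" for x z using b[of z] by (auto simp: g_def)
    have cf: "continuous_on UNIV (\<lambda>z. f z + b)" "bounded (range (\<lambda>z. f z + b))"
      using f by (auto intro!: continuous_intros bounded_plus_comp)
    have gc: "continuous_on UNIV (\<lambda>z. g (fst z) (snd z))"
      unfolding g_def using continuous_on_compose2[OF cf(1) continuous_on_snd[OF continuous_on_id], of UNIV] by simp
    have fm: "(\<lambda>z. ennreal (f z + b)) \<in> borel_measurable borel"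
      using borel_measurable_continuous_onI[OF cf(1)] by measurable
    have gm: "(\<lambda>p. ennreal (g (fst p) (snd p))) \<in> borel_measurable borel"
      using borel_measurable_continuous_onI[OF gc] by measurable
    have int: "(\<integral>\<^sup>+z. ennreal (f z + b) \<partial>\<mu>) = ennreal (integral\<^sup>L \<mu> f + b)" "integral\<^sup>L \<mu> f + b \<ge> 0" if \<mu>: "\<mu> \<in> borel_probs" for \<mu>
    proof -
      interpret prob_space \<mu> using \<mu> borel_probs_prob by blast
      have "integral\<^sup>L \<mu> (\<lambda>z. f z + b) = integral\<^sup>L \<mu> f + b"
        using integrable_bdd_continuous[OF \<mu> f] by (simp add: prob_space)
      moreover have "integral\<^sup>L \<mu> (\<lambda>z. f z + b) \<ge> 0" using g0 by (intro integral_nonneg_AE) (auto simp: g_def)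
      moreover have "(\<integral>\<^sup>+z. ennreal (f z + b) \<partial>\<mu>) = ennreal (integral\<^sup>L \<mu> (\<lambda>z. f z + b))"
        using g0 by (intro nn_integral_eq_integral integrable_bdd_continuous[OF \<mu> cf]) (auto simp: g_def)
      ultimately show "(\<integral>\<^sup>+z. ennreal (f z + b) \<partial>\<mu>) = ennreal (integral\<^sup>L \<mu> f + b)" "integral\<^sup>L \<mu> f + b \<ge> 0" by auto
    qed
    define \<kappa> where "\<kappa> = distr \<nu> borel (\<lambda>x. (x, x))"
    have \<kappa>: "\<kappa> \<in> couplings \<nu> \<nu>" unfolding \<kappa>_def using \<nu> by (rule diagonal_coupling)
    have "plan_cost c \<kappa> = 0"
      unfolding \<kappa>_def using diagonal_coupling(2)[OF \<nu>, of "\<lambda>p. ennreal (c (fst p) (snd p))"] by simp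
    moreover have "(\<integral>\<^sup>+p. ennreal (g (fst p) (snd p)) \<partial>\<kappa>) < ennreal (a + b)"
      unfolding \<kappa>_def using diagonal_coupling(2)[OF \<nu> gm] int[OF \<nu>] a by (simp add: g_def ennreal_less_iff)
    ultimately have "eventually (\<lambda>n. \<exists>\<theta>\<in>couplings \<nu> (\<nu>s n). (\<integral>\<^sup>+p. ennreal (g (fst p) (snd p)) \<partial>\<theta>) < ennreal (a + b)) sequentially"
      using gb b0 by (intro coupling_integral_usc[OF \<kappa> _ J0 gc g0, where D="2 * b" and E=0]) auto
    then show ?thesis
    proof eventually_elim
      case (elim n)
      then obtain \<theta> where \<theta>: "\<theta> \<in> couplings \<nu> (\<nu>s n)" "(\<integral>\<^sup>+p. ennreal (g (fst p) (snd p)) \<partial>\<theta>) < ennreal (a + b)" by blast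
      have "(\<integral>\<^sup>+p. ennreal (g (fst p) (snd p)) \<partial>\<theta>) = ennreal (integral\<^sup>L (\<nu>s n) f + b)"
        unfolding g_def using nn_integral_coupling(2)[OF \<theta>(1) fm] int[OF \<nu>s] by simp
      then show ?case using \<theta>(2) int(2)[OF \<nu>s] by (simp add: ennreal_less_iff)
    qed
  qed
  show ?thesis unfolding weakly_conv_def
  proof (safe, rule order_tendstoI)
    fix f :: "'a \<Rightarrow> real" and a assume f: "continuous_on UNIV f" "bounded (range f)"
    { assume "integral\<^sup>L \<nu> f < a"
      then show "eventually (\<lambda>n. integral\<^sup>L (\<nu>s n) f < a) sequentially" using f by (intro upper) }
    { assume "a < integral\<^sup>L \<nu> f"
      then show "eventually (\<lambda>n. a < integral\<^sup>L (\<nu>s n) f) sequentially"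
        using upper[of "\<lambda>x. - f x" "- a"] f by (auto intro!: continuous_intros simp: bounded_iff) }
  qed
qed

end

section \<open>The transport topology\<close>

lemma topspace_transport_topology_subset: "topspace (transport_topology c) \<subseteq> borel_probs"
  unfolding transport_topology_def topology_generated_by_topspace by blast

context growth_cost
begin

text \<open>An argument in the style of Markov's inequality: a plan moving mass from the ball
  \<open>Q\<close> to the outside of the larger ball \<open>K\<close> pays at least \<open>L\<close>
  per unit, so \<open>L\<close> times the mass outside \<open>K\<close> is at most \<open>M\<close>
  plus \<open>L\<close> times the mass of \<open>\<mu>\<close> outside \<open>Q\<close>.\<close>

lemma tight_of_bounded_cost:
  fixes \<sigma> :: "nat \<Rightarrow> 'a measure"
  assumes \<mu>: "\<mu> \<in> borel_probs" and s: "\<And>n. \<sigma> n \<in> borel_probs"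
    and le: "\<And>n. transport_cost c \<mu> (\<sigma> n) < ennreal M" and e: "e > (0::real)"
  shows "\<exists>K. compact K \<and> (\<forall>n. measure (\<sigma> n) (- K) \<le> e)"
proof -
  define x :: 'a where "x = undefined"
  have M0: "M > 0" using le[of 0] by (metis ennreal_eq_0_iff not_less zero_le le_less_trans)
  obtain R :: nat where R: "measure \<mu> (- {y. c x y \<le> real R}) < e / 2"
    using order_tendstoD(2)[OF measure_ball_compl_tendsto[OF \<mu>, of x], of "e / 2"] e
    by (auto simp: eventually_sequentially)
  \<comment> \<open>Then \<open>M / L = e / 2\<close>; the other half of \<open>e\<close> is the
    mass of \<open>\<mu>\<close> outside \<open>Q\<close>.\<close>
  define L where "L = 2 * M / e"
  have L0: "L > 0" using M0 e by (simp add: L_def)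
  define K where "K = {y. c x y \<le> A + B * (real R + L)}"
  define Q where "Q = {y. c x y \<le> real R}"
  have KQ[measurable]: "K \<in> sets borel" "Q \<in> sets borel"
    unfolding K_def Q_def using compact_ball by (simp_all add: borel_closed compact_imp_closed)
  have "measure (\<sigma> n) (- K) \<le> e" for n
  proof -
    obtain \<gamma> where \<gamma>: "\<gamma> \<in> couplings \<mu> (\<sigma> n)" "plan_cost c \<gamma> < ennreal M"
      using le by (rule transport_cost_less)
    have b\<gamma>: "\<gamma> \<in> borel_probs" using couplings_borel_probs(1)[OF \<gamma>(1)] .
    interpret G: prob_space \<gamma> using b\<gamma> borel_probs_prob by blast
    interpret S: prob_space "\<sigma> n" using s borel_probs_prob by blast
    interpret M: prob_space \<mu> using \<mu> borel_probs_prob by blast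
    have cm: "(\<lambda>z. ennreal (c (fst z) (snd z))) \<in> borel_measurable \<gamma>"
      using b\<gamma> by (simp add: borel_probs_measurable)
    have ind1: "(\<lambda>z. indicator (- Q) (fst z) :: ennreal) \<in> borel_measurable \<gamma>"
      unfolding borel_probs_measurable[OF b\<gamma>] using KQ
      by (intro measurable_compose[OF fst_measurable_borel] borel_measurable_indicator) simp
    have "ennreal L * emeasure (\<sigma> n) (- K) = (\<integral>\<^sup>+y. ennreal L * indicator (- K) y \<partial>\<sigma> n)"
      using KQ s[of n] by (subst nn_integral_cmult_indicator) (auto simp: borel_probs_sets)
    also have "\<dots> = (\<integral>\<^sup>+z. ennreal L * indicator (- K) (snd z) \<partial>\<gamma>)"
      using KQ by (intro nn_integral_coupling(2)[OF \<gamma>(1), symmetric]) measurable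
    also have "\<dots> \<le> (\<integral>\<^sup>+z. ennreal (c (fst z) (snd z)) + ennreal L * indicator (- Q) (fst z) \<partial>\<gamma>)"
    proof (intro nn_integral_mono)
      fix z :: "'a \<times> 'a"
      show "ennreal L * indicator (- K) (snd z) \<le> ennreal (c (fst z) (snd z)) + ennreal L * indicator (- Q) (fst z)"
      proof (cases "snd z \<in> K \<or> fst z \<notin> Q")
        case False
        have "L \<le> c (fst z) (snd z)"
        proof (rule ccontr)
          assume "\<not> L \<le> c (fst z) (snd z)"
          then have "B * (c x (fst z) + c (fst z) (snd z)) \<le> B * (real R + L)"
            using False AB_nonneg by (intro mult_left_mono add_mono) (auto simp: Q_def)
          then have "c x (snd z) \<le> A + B * (real R + L)" using growth(2)[of x "snd z" "fst z"] by simp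
          with False show False by (simp add: K_def)
        qed
        then have "ennreal L \<le> ennreal (c (fst z) (snd z))" by (rule ennreal_leI)
        then show ?thesis using False by simp
      qed (auto split: split_indicator)
    qed
    also have "\<dots> = plan_cost c \<gamma> + (\<integral>\<^sup>+z. ennreal L * indicator (- Q) (fst z) \<partial>\<gamma>)"
      using cm ind1 by (intro nn_integral_add) auto
    also have "(\<integral>\<^sup>+z. ennreal L * indicator (- Q) (fst z) \<partial>\<gamma>) = (\<integral>\<^sup>+x. ennreal L * indicator (- Q) x \<partial>\<mu>)"
      using KQ by (intro nn_integral_coupling(1)[OF \<gamma>(1)]) measurable
    also have "\<dots> = ennreal L * emeasure \<mu> (- Q)"
      using KQ \<mu> by (subst nn_integral_cmult_indicator) (auto simp: borel_probs_sets)
    also have "plan_cost c \<gamma> + ennreal L * emeasure \<mu> (- Q) \<le> ennreal M + ennreal L * ennreal (e / 2)"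
      using \<gamma>(2) R by (intro add_mono mult_left_mono) (auto simp: M.emeasure_eq_measure Q_def intro!: ennreal_leI)
    also have "\<dots> = ennreal (L * e)"
      using M0 L0 e by (simp add: ennreal_mult[symmetric] ennreal_plus[symmetric] L_def del: ennreal_plus)
    finally have "ennreal (L * measure (\<sigma> n) (- K)) \<le> ennreal (L * e)"
      using L0 by (simp add: S.emeasure_eq_measure ennreal_mult)
    then have "L * measure (\<sigma> n) (- K) \<le> L * e" using L0 e by (subst (asm) ennreal_le_iff) auto
    then show ?thesis using L0 by simp
  qed
  moreover have "compact K" unfolding K_def by (rule compact_ball)
  ultimately show ?thesis by blast
qed

text \<open>Almost optimal plans from \<open>\<mu>\<close> along suitable indices have a weak limit
  plan. Lower semicontinuity makes that plan optimal and forces the plan costs to converge, so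
  \<open>transport_cost_tendsto_0_of_plans\<close> and \<open>transport_cost_usc\<close> apply. One
  index is enough, because the lemma will be applied to subsequences chosen to violate the
  conclusion.\<close>

lemma frequently_transport_cost_less:
  assumes w: "weakly_conv \<sigma> \<nu>" and \<nu>: "\<nu> \<in> borel_probs" and s: "\<And>n. \<sigma> n \<in> borel_probs" and \<mu>: "\<mu> \<in> borel_probs"
    and lim: "liminf (\<lambda>n. transport_cost c \<mu> (\<sigma> n)) \<le> transport_cost c \<mu> \<nu>" and fin: "transport_cost c \<mu> \<nu> \<noteq> \<top>"
    and r: "transport_cost c \<mu>' \<nu> < r"
  shows "\<exists>n. transport_cost c \<mu>' (\<sigma> n) < r"
proof -
  define J where "J = transport_cost c \<mu> \<nu>"
  have "\<exists>n\<ge>N. transport_cost c \<mu> (\<sigma> n) < J + ennreal (inverse (Suc N))" for N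
  proof (rule ccontr)
    assume "\<not> ?thesis"
    then have "eventually (\<lambda>n. J + ennreal (inverse (Suc N)) \<le> transport_cost c \<mu> (\<sigma> n)) sequentially"
      by (auto simp: eventually_sequentially not_less)
    then have "J + ennreal (inverse (Suc N)) \<le> liminf (\<lambda>n. transport_cost c \<mu> (\<sigma> n))" by (rule Liminf_bounded)
    also have "\<dots> \<le> J + 0" using lim by (simp add: J_def)
    finally show False using fin unfolding ennreal_add_left_cancel_le by (simp add: J_def)
  qed
  then obtain k where k: "\<And>N. k N \<ge> N" "\<And>N. transport_cost c \<mu> (\<sigma> (k N)) < J + ennreal (inverse (Suc N))" by metis
  \<comment> \<open>The indices \<open>k N\<close> need not increase; that they tend to infinity
    suffices for weak convergence.\<close>
  have "filterlim k at_top sequentially"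
    using k(1) by (auto simp: filterlim_at_top eventually_sequentially intro: order_trans)
  then have wk: "weakly_conv (\<sigma> \<circ> k) \<nu>"
    using w unfolding weakly_conv_def by (auto simp: o_def intro: filterlim_compose)
  have "\<exists>\<gamma>\<in>couplings \<mu> (\<sigma> (k N)). plan_cost c \<gamma> < J + ennreal (inverse (Suc N))" for N
    using k(2)[of N] by (rule transport_cost_less) blast
  then obtain \<gamma>s where \<gamma>s: "\<And>N. \<gamma>s N \<in> couplings \<mu> (\<sigma> (k N))" "\<And>N. plan_cost c (\<gamma>s N) < J + ennreal (inverse (Suc N))" by metis
  have w\<mu>: "weakly_conv (\<lambda>_. \<mu>) \<mu>" by (simp add: weakly_conv_def)
  obtain q \<gamma> where q: "strict_mono q" "\<gamma> \<in> couplings \<mu> \<nu>" "weakly_conv (\<gamma>s \<circ> q) \<gamma>"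
    using couplings_limit[OF w\<mu> \<mu> wk \<nu>, of \<gamma>s] \<gamma>s(1) by auto
  have b: "\<gamma> \<in> borel_probs" "(\<gamma>s \<circ> q) N \<in> borel_probs" for N
    using couplings_borel_probs(1) q(2) \<gamma>s(1) by auto
  have Jle: "J \<le> plan_cost c \<gamma>" unfolding J_def using q(2) by (rule transport_cost_le)
  have up: "(\<lambda>N. J + ennreal (inverse (Suc (q N)))) \<longlonglongrightarrow> J"
  proof -
    have "(\<lambda>n. inverse (real (Suc (q n)))) \<longlonglongrightarrow> 0"
      using LIMSEQ_subseq_LIMSEQ[OF LIMSEQ_inverse_real_of_nat q(1)] by (simp add: o_def)
    then have "(\<lambda>n. J + ennreal (inverse (Suc (q n)))) \<longlonglongrightarrow> J + ennreal 0"
      by (intro tendsto_intros tendsto_ennrealI)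
    then show ?thesis by simp
  qed
  have "plan_cost c \<gamma> \<le> liminf (\<lambda>N. plan_cost c ((\<gamma>s \<circ> q) N))"
    using plan_cost_le_liminf[OF q(3) b(2,1)] .
  also have "\<dots> \<le> liminf (\<lambda>N. J + ennreal (inverse (Suc (q N))))"
    using \<gamma>s(2) by (intro Liminf_mono always_eventually) (auto intro: less_imp_le)
  also have "\<dots> = J" using up by (intro lim_imp_Liminf) auto
  finally have J: "plan_cost c \<gamma> = J" using Jle by simp
  have "limsup (\<lambda>N. plan_cost c ((\<gamma>s \<circ> q) N)) \<le> limsup (\<lambda>N. J + ennreal (inverse (Suc (q N))))"
    using \<gamma>s(2) by (intro Limsup_mono always_eventually) (auto intro: less_imp_le)
  also have "\<dots> = J" using up by (intro lim_imp_Limsup) auto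
  finally have ls: "limsup (\<lambda>N. plan_cost c ((\<gamma>s \<circ> q) N)) \<le> plan_cost c \<gamma>" using J by simp
  have cost: "(\<lambda>N. plan_cost c ((\<gamma>s \<circ> q) N)) \<longlonglongrightarrow> plan_cost c \<gamma>"
    using plan_cost_le_liminf[OF q(3) b(2,1)] ls Liminf_le_Limsup[of sequentially "\<lambda>N. plan_cost c ((\<gamma>s \<circ> q) N)"]
    by (subst tendsto_iff_Liminf_eq_Limsup) auto
  have "(\<lambda>N. transport_cost c \<nu> (\<sigma> (k (q N)))) \<longlonglongrightarrow> 0"
    by (rule transport_cost_tendsto_0_of_plans[OF _ q(2,3) cost])
      (use \<gamma>s(1) fin in \<open>auto simp: J J_def\<close>)
  then have "eventually (\<lambda>N. transport_cost c \<mu>' (\<sigma> (k (q N))) < r) sequentially"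
    using r by (rule transport_cost_usc)
  then show ?thesis by (auto simp: eventually_sequentially)
qed

lemma topspace_transport_topology: "topspace (transport_topology c) = borel_probs"
proof (intro equalityI topspace_transport_topology_subset subsetI)
  fix \<nu> :: "'a measure" assume \<nu>: "\<nu> \<in> borel_probs"
  then have "\<nu> \<in> {\<kappa> \<in> borel_probs. transport_cost c \<nu> \<kappa> < ennreal 1}"
    by (simp add: transport_cost_self)
  then show "\<nu> \<in> topspace (transport_topology c)"
    unfolding transport_topology_def topology_generated_by_topspace using \<nu> zero_less_one[where 'a=real] by blast
qed

lemma openin_transport_ball:
  "\<mu> \<in> borel_probs \<Longrightarrow> r > 0 \<Longrightarrow> openin (transport_topology c) {\<nu> \<in> borel_probs. transport_cost c \<mu> \<nu> < ennreal r}"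
  unfolding transport_topology_def by (rule topology_generated_by_Basis) blast

lemma limitin_transport_topologyI:
  assumes "\<And>n. \<sigma> n \<in> borel_probs" "\<nu> \<in> borel_probs"
    and "\<And>\<mu> r. \<mu> \<in> borel_probs \<Longrightarrow> transport_cost c \<mu> \<nu> < ennreal r \<Longrightarrow>
      eventually (\<lambda>n. transport_cost c \<mu> (\<sigma> n) < ennreal r) sequentially"
  shows "limitin (transport_topology c) \<sigma> \<nu> sequentially"
proof -
  have "\<nu> \<in> topspace (transport_topology c)" using assms(2) by (simp add: topspace_transport_topology)
  then show ?thesis
    unfolding transport_topology_def limitin_topology_generated_by topology_generated_by_topspace
    using assms by auto
qed

text \<open>Since \<open>\<nu>\<close> has cost 0 to itself, the balls centred at
  \<open>\<nu>\<close> are among its neighbourhoods.\<close>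

lemma weakly_conv_of_limitin_transport_topology:
  assumes lim: "limitin (transport_topology c) \<sigma> \<nu> sequentially" and s: "\<And>n. \<sigma> n \<in> borel_probs"
  shows "weakly_conv \<sigma> \<nu>" "\<nu> \<in> borel_probs"
proof -
  show \<nu>: "\<nu> \<in> borel_probs"
    using limitin_topspace[OF lim] by (simp add: topspace_transport_topology)
  have "(\<lambda>n. transport_cost c \<nu> (\<sigma> n)) \<longlonglongrightarrow> 0"
  proof (rule tendsto_zero_ennreal)
    fix r :: real assume r: "0 < r"
    have "\<nu> \<in> {\<kappa> \<in> borel_probs. transport_cost c \<nu> \<kappa> < ennreal r}"
      using r \<nu> by (simp add: transport_cost_self)
    then have "eventually (\<lambda>n. \<sigma> n \<in> {\<kappa> \<in> borel_probs. transport_cost c \<nu> \<kappa> < ennreal r}) sequentially"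
      using lim openin_transport_ball[OF \<nu> r] unfolding limitin_def by blast
    then show "eventually (\<lambda>n. transport_cost c \<nu> (\<sigma> n) < ennreal r) sequentially" by eventually_elim simp
  qed
  then show "weakly_conv \<sigma> \<nu>" using \<nu> s by (rule weakly_conv_of_transport_cost)
qed

text \<open>A weakly open set contains a cost ball around each of its points; otherwise points of
  shrinking balls outside the set would converge weakly to the centre.\<close>

lemma openin_transport_topology_of_weak:
  fixes U :: "'a measure set"
  assumes U: "openin weak_topology U"
  shows "openin (transport_topology c) U"
proof (subst openin_subopen, safe)
  fix \<nu> assume \<nu>U: "\<nu> \<in> U"
  then have \<nu>: "\<nu> \<in> borel_probs" using openin_subset[OF U] by auto
  have "\<exists>n. {\<kappa> \<in> borel_probs. transport_cost c \<nu> \<kappa> < ennreal (inverse (real (Suc n)))} \<subseteq> U"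
  proof (rule ccontr)
    assume "\<not> ?thesis"
    then have "\<forall>n. \<exists>\<kappa>. \<kappa> \<in> borel_probs \<and> transport_cost c \<nu> \<kappa> < ennreal (inverse (real (Suc n))) \<and> \<kappa> \<notin> U" by blast
    then obtain \<sigma> where \<sigma>: "\<And>n. \<sigma> n \<in> borel_probs" "\<And>n. transport_cost c \<nu> (\<sigma> n) < ennreal (inverse (real (Suc n)))" "\<And>n. \<sigma> n \<notin> U"
      by metis
    have lim: "(\<lambda>n. ennreal (inverse (real (Suc n)))) \<longlonglongrightarrow> ennreal 0"
      by (intro tendsto_ennrealI LIMSEQ_inverse_real_of_nat)
    have "(\<lambda>n. transport_cost c \<nu> (\<sigma> n)) \<longlonglongrightarrow> 0"
    proof (rule tendsto_zero_ennreal)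
      fix e :: real assume "0 < e"
      then have "eventually (\<lambda>n. ennreal (inverse (real (Suc n))) < ennreal e) sequentially"
        by (intro order_tendstoD(2)[OF lim]) simp
      then show "eventually (\<lambda>n. transport_cost c \<nu> (\<sigma> n) < ennreal e) sequentially"
        by eventually_elim (rule less_trans[OF \<sigma>(2)])
    qed
    then have "weakly_conv \<sigma> \<nu>" using \<nu> \<sigma>(1) by (rule weakly_conv_of_transport_cost)
    then have "limitin weak_topology \<sigma> \<nu> sequentially" using limitin_weak_topology \<nu> \<sigma>(1) by blast
    then have "eventually (\<lambda>n. \<sigma> n \<in> U) sequentially" using U \<nu>U by (auto simp: limitin_def)
    with \<sigma>(3) show False by simp
  qed
  then obtain n where n: "{\<kappa> \<in> borel_probs. transport_cost c \<nu> \<kappa> < ennreal (inverse (real (Suc n)))} \<subseteq> U" by blast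
  then show "\<exists>T. openin (transport_topology c) T \<and> \<nu> \<in> T \<and> T \<subseteq> U"
    using \<nu> by (intro exI[of _ "{\<kappa> \<in> borel_probs. transport_cost c \<nu> \<kappa> < ennreal (inverse (real (Suc n)))}"] conjI openin_transport_ball)
      (simp_all add: transport_cost_self)
qed

text \<open>A topology finer than a Hausdorff one is Hausdorff. This makes compact sets closed, so
  that closures remain inside them.\<close>

lemma Hausdorff_transport_topology: "Hausdorff_space (transport_topology c)"
proof (rule Hausdorff_space_injective_preimage)
  show "Hausdorff_space (weak_topology :: 'a measure topology)"
    by (intro metrizable_imp_Hausdorff_space metrizable_weak_topology)
  show "continuous_map (transport_topology c) weak_topology (\<lambda>\<nu>. \<nu>)"
    unfolding continuous_map_def
  proof safe
    fix U :: "'a measure set" assume U: "openin weak_topology U"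
    have "{\<nu> \<in> topspace (transport_topology c). \<nu> \<in> U} = U"
      using openin_subset[OF U] by (auto simp: topspace_transport_topology)
    then show "openin (transport_topology c) {\<nu> \<in> topspace (transport_topology c). \<nu> \<in> U}"
      using openin_transport_topology_of_weak[OF U] by simp
  qed (auto simp: topspace_transport_topology)
qed auto

end

section \<open>Minimizing sequences\<close>

locale barycenter_problem = growth_cost c A B
  for c :: "'a::{metric_space, second_countable_topology} \<Rightarrow> 'a \<Rightarrow> real" and A B +
  fixes G :: "'a measure \<Rightarrow> ereal" and P :: "'a measure measure"
  assumes G_bounded_below: "\<exists>m::real. \<forall>\<nu>\<in>borel_probs. ereal m \<le> G \<nu>"
    and G_lsc: "lower_semicontinuous_map weak_topology G"
    and P_prob: "prob_space P"
    and P_borel: "sets P = sets (borel_measure_of weak_topology)"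
    and finite_inf: "(INF \<nu>\<in>borel_probs. barycenter_objective c G P \<nu>) < \<infinity>"
begin

abbreviation objective :: "'a measure \<Rightarrow> ereal" where "objective \<equiv> barycenter_objective c G P"

abbreviation mean_cost :: "'a measure \<Rightarrow> ennreal" where
  "mean_cost \<nu> \<equiv> \<integral>\<^sup>+ \<mu>. transport_cost c \<mu> \<nu> \<partial>P"

definition infimum :: ereal where "infimum = (INF \<nu>\<in>borel_probs. objective \<nu>)"

definition minimizing :: "(nat \<Rightarrow> 'a measure) \<Rightarrow> bool" where
  "minimizing \<sigma> \<longleftrightarrow> (\<forall>n. \<sigma> n \<in> borel_probs) \<and> (\<lambda>n. objective (\<sigma> n)) \<longlonglongrightarrow> infimum"

lemma minimizing_subseq: "minimizing \<sigma> \<Longrightarrow> strict_mono r \<Longrightarrow> minimizing (\<sigma> \<circ> r)"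
  unfolding minimizing_def using LIMSEQ_subseq_LIMSEQ[of "\<lambda>n. objective (\<sigma> n)" infimum r] by (simp add: o_def)

lemma infimum_le: "\<nu> \<in> borel_probs \<Longrightarrow> infimum \<le> objective \<nu>"
  unfolding infimum_def by (rule INF_lower)

lemma barycenters_iff: "\<nu> \<in> barycenters c G P \<longleftrightarrow> \<nu> \<in> borel_probs \<and> objective \<nu> = infimum"
proof -
  have "objective \<nu> \<le> infimum \<longleftrightarrow> (\<forall>\<nu>'\<in>borel_probs. objective \<nu> \<le> objective \<nu>')"
    unfolding infimum_def by (rule le_INF_iff)
  then show ?thesis
    using infimum_le[of \<nu>] by (auto simp: barycenters_def)
qed

lemma infimum_finite: "\<bar>infimum\<bar> \<noteq> \<infinity>"
proof -
  obtain m :: real where m: "\<forall>\<nu>\<in>borel_probs. ereal m \<le> G \<nu>" using G_bounded_below by blast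
  have "ereal m \<le> infimum"
    unfolding infimum_def
  proof (rule INF_greatest)
    fix \<nu> :: "'a measure" assume "\<nu> \<in> borel_probs"
    then have "0 + ereal m \<le> objective \<nu>"
      unfolding barycenter_objective_def using m by (intro add_mono) auto
    then show "ereal m \<le> objective \<nu>" by simp
  qed
  moreover have "infimum < \<infinity>" using finite_inf by (simp add: infimum_def)
  ultimately show ?thesis by auto
qed

lemma space_P: "space P = borel_probs"
  using sets_eq_imp_space_eq[OF P_borel] by (simp add: borel_measure_of_def space_measure_of_conv)

lemma cost_measurable_P: "\<nu> \<in> borel_probs \<Longrightarrow> (\<lambda>\<mu>. transport_cost c \<mu> \<nu>) \<in> borel_measurable P"
  using P_borel by (rule transport_cost_measurable)

lemma mean_cost_fatou:
  assumes "\<And>n. \<sigma> n \<in> borel_probs"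
  shows "(\<integral>\<^sup>+\<mu>. liminf (\<lambda>n. transport_cost c \<mu> (\<sigma> n)) \<partial>P) \<le> liminf (\<lambda>n. mean_cost (\<sigma> n))"
  using assms by (intro nn_integral_liminf cost_measurable_P)

lemma minimizing_imp_weakly_conv_subseq:
  assumes "minimizing \<sigma>"
  obtains r \<nu> where "strict_mono r" "\<nu> \<in> borel_probs" "weakly_conv (\<sigma> \<circ> r) \<nu>"
proof -
  have s: "\<And>n. \<sigma> n \<in> borel_probs" and lim: "(\<lambda>n. objective (\<sigma> n)) \<longlonglongrightarrow> infimum"
    using assms by (auto simp: minimizing_def)
  obtain m :: real where m: "\<forall>\<nu>\<in>borel_probs. ereal m \<le> G \<nu>" using G_bounded_below by blast
  obtain i where i: "infimum = ereal i" using infimum_finite by (cases infimum) auto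
  have "eventually (\<lambda>n. objective (\<sigma> n) < ereal (i + 1)) sequentially"
    using lim by (rule order_tendstoD(2)) (simp add: i)
  \<comment> \<open>The objective is eventually below \<open>i + 1\<close>, and \<open>G\<close>
    contributes at least \<open>m\<close> to it.\<close>
  then have "eventually (\<lambda>n. mean_cost (\<sigma> n) \<le> ennreal (i + 1 - m)) sequentially"
  proof eventually_elim
    case (elim n)
    have "enn2ereal (mean_cost (\<sigma> n)) + ereal m \<le> objective (\<sigma> n)"
      unfolding barycenter_objective_def using m s by (intro add_mono) auto
    then have le: "enn2ereal (mean_cost (\<sigma> n)) + ereal m < ereal (i + 1)" using elim by (rule le_less_trans)
    then show ?case
      by (cases "mean_cost (\<sigma> n)") (auto simp: enn2ereal_ennreal ennreal_leI)
  qed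
  then have "\<exists>N. \<forall>n\<ge>N. mean_cost (\<sigma> n) \<le> ennreal (i + 1 - m)" by (simp add: eventually_sequentially)
  then obtain N where N: "\<And>n. n \<ge> N \<Longrightarrow> mean_cost (\<sigma> n) \<le> ennreal (i + 1 - m)" by blast
  have "liminf (\<lambda>n. mean_cost (\<sigma> n)) \<le> liminf (\<lambda>n::nat. ennreal (i + 1 - m))"
    using N by (intro Liminf_mono) (auto simp: eventually_sequentially)
  also have "\<dots> = ennreal (i + 1 - m)" by (simp add: Liminf_const)
  finally have fin: "(\<integral>\<^sup>+\<mu>. liminf (\<lambda>n. transport_cost c \<mu> (\<sigma> n)) \<partial>P) \<noteq> \<infinity>"
    using mean_cost_fatou[of \<sigma>, OF s] by (auto simp: top_unique)
  interpret P: prob_space P by (rule P_prob)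
  have meas: "(\<lambda>\<mu>. liminf (\<lambda>n. transport_cost c \<mu> (\<sigma> n))) \<in> borel_measurable P"
    using cost_measurable_P[OF s] by measurable
  have "AE \<mu> in P. liminf (\<lambda>n. transport_cost c \<mu> (\<sigma> n)) \<noteq> \<infinity>"
    using nn_integral_PInf_AE[OF meas fin] .
  moreover have "AE \<mu> in P. \<mu> \<in> space P" by (rule AE_space)
  ultimately have ae: "AE \<mu> in P. \<mu> \<in> borel_probs \<and> liminf (\<lambda>n. transport_cost c \<mu> (\<sigma> n)) \<noteq> \<infinity>"
    by eventually_elim (simp add: space_P)
  obtain \<mu> where \<mu>: "\<mu> \<in> borel_probs" "liminf (\<lambda>n. transport_cost c \<mu> (\<sigma> n)) \<noteq> \<infinity>"
  proof -
    have "\<exists>\<mu>. \<mu> \<in> borel_probs \<and> liminf (\<lambda>n. transport_cost c \<mu> (\<sigma> n)) \<noteq> \<infinity>" (is "\<exists>\<mu>. ?Q \<mu>")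
    proof (rule ccontr)
      assume none: "\<not> (\<exists>\<mu>. ?Q \<mu>)"
      from ae have "AE \<mu> in P. False" by (rule eventually_mono) (use none in blast)
      then show False using P.AE_False by simp
    qed
    then show ?thesis using that by blast
  qed
  obtain M where M: "liminf (\<lambda>n. transport_cost c \<mu> (\<sigma> n)) < ennreal M"
  proof -
    obtain q where "liminf (\<lambda>n. transport_cost c \<mu> (\<sigma> n)) = ennreal q" "q \<ge> 0"
      using \<mu>(2) by (cases "liminf (\<lambda>n. transport_cost c \<mu> (\<sigma> n))") auto
    then show ?thesis using that[of "q + 1"] by (simp add: ennreal_less_iff)
  qed
  obtain r :: "nat \<Rightarrow> nat" where r: "strict_mono r" "\<And>n. transport_cost c \<mu> (\<sigma> (r n)) < ennreal M"
    using subseq_less_of_liminf[OF M] by metis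
  obtain q \<nu> where q: "strict_mono q" "\<nu> \<in> borel_probs" "weakly_conv (\<sigma> \<circ> r \<circ> q) \<nu>"
  proof (rule prokhorov)
    show "(\<sigma> \<circ> r) n \<in> borel_probs" for n using s by simp
    show "\<exists>K. compact K \<and> (\<forall>n. measure ((\<sigma> \<circ> r) n) (- K) \<le> e)" if "e > 0" for e
      using tight_of_bounded_cost[OF \<mu>(1), of "\<sigma> \<circ> r" M] s r(2) that by simp
  qed
  show ?thesis
  proof (rule that)
    show "strict_mono (r \<circ> q)" using r(1) q(1) by (rule strict_mono_o)
  qed (use q in \<open>simp_all add: o_assoc\<close>)
qed

text \<open>Lower semicontinuity makes Fatou's inequality an equality along a minimizing sequence, whence the
  second claim: the costs from some \<open>\<mu>\<close> converge along a subsequence.  This is what upgrades weak convergence to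
  convergence in the transport topology.\<close>

lemma minimizing_weak_limit:
  assumes min: "minimizing \<sigma>" and w: "weakly_conv \<sigma> \<nu>" and \<nu>: "\<nu> \<in> borel_probs"
  shows "\<nu> \<in> barycenters c G P"
    and "\<exists>\<mu>\<in>borel_probs. transport_cost c \<mu> \<nu> \<noteq> \<top> \<and>
      liminf (\<lambda>n. transport_cost c \<mu> (\<sigma> n)) \<le> transport_cost c \<mu> \<nu>"
proof -
  interpret P: prob_space P by (rule P_prob)
  have s: "\<And>n. \<sigma> n \<in> borel_probs" and lim: "(\<lambda>n. objective (\<sigma> n)) \<longlonglongrightarrow> infimum"
    using min by (auto simp: minimizing_def)
  obtain m :: real where m: "\<forall>\<nu>\<in>borel_probs. ereal m \<le> G \<nu>" using G_bounded_below by blast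
  obtain i where i: "infimum = ereal i" using infimum_finite by (cases infimum) auto
  have G: "G \<nu> \<le> liminf (\<lambda>n. G (\<sigma> n))"
    unfolding le_Liminf_iff
  proof (intro allI impI)
    fix y assume "y < G \<nu>"
    have "limitin weak_topology \<sigma> \<nu> sequentially" using limitin_weak_topology[of \<sigma>, OF s \<nu>] w by blast
    moreover have "openin weak_topology {x \<in> topspace weak_topology. y < G x}"
      using G_lsc unfolding lower_semicontinuous_map_def by blast
    moreover have "\<nu> \<in> {x \<in> topspace weak_topology. y < G x}" using \<nu> \<open>y < G \<nu>\<close> by simp
    ultimately have "eventually (\<lambda>n. \<sigma> n \<in> {x \<in> topspace weak_topology. y < G x}) sequentially"
      unfolding limitin_def by blast
    then show "eventually (\<lambda>n. y < G (\<sigma> n)) sequentially" by eventually_elim simp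
  qed
  have Jl: "transport_cost c \<mu> \<nu> \<le> liminf (\<lambda>n. transport_cost c \<mu> (\<sigma> n))" if "\<mu> \<in> borel_probs" for \<mu>
    using transport_cost_le_liminf[OF w \<nu> that] .
  have fatou: "mean_cost \<nu> \<le> (\<integral>\<^sup>+\<mu>. liminf (\<lambda>n. transport_cost c \<mu> (\<sigma> n)) \<partial>P)"
    using Jl by (intro nn_integral_mono) (simp add: space_P)
  \<comment> \<open>Used twice: with the mean cost of \<open>\<nu>\<close> it proves minimality, and
    with the lower limit itself it shows that no mean cost is lost in the limit.\<close>
  have add: "enn2ereal b + G \<nu> \<le> infimum" if b: "b \<le> liminf (\<lambda>n. mean_cost (\<sigma> n))" for b
  proof -
    define L where "L = liminf (\<lambda>n. enn2ereal (mean_cost (\<sigma> n)))"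
    have bL: "enn2ereal b \<le> L" unfolding L_def le_Liminf_iff
    proof (intro allI impI)
      fix y assume y: "y < enn2ereal b"
      show "eventually (\<lambda>n. y < enn2ereal (mean_cost (\<sigma> n))) sequentially"
      proof (cases "y < 0")
        case True
        then show ?thesis by (intro always_eventually allI less_le_trans[OF True]) simp
      next
        case False
        then have y': "y = enn2ereal (e2ennreal y)" by (simp add: enn2ereal_e2ennreal)
        then have "e2ennreal y < b" using y by (metis less_ennreal.rep_eq)
        then have "eventually (\<lambda>n. e2ennreal y < mean_cost (\<sigma> n)) sequentially" using b by (auto simp: le_Liminf_iff)
        then show ?thesis by eventually_elim (metis y' less_ennreal.rep_eq)
      qed
    qed
    have "0 \<le> L" unfolding L_def by (intro Liminf_bounded always_eventually) auto
    moreover have "ereal m \<le> liminf (\<lambda>n. G (\<sigma> n))" using m s by (intro Liminf_bounded always_eventually) auto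
    ultimately have "L + liminf (\<lambda>n. G (\<sigma> n)) \<le> liminf (\<lambda>n. enn2ereal (mean_cost (\<sigma> n)) + G (\<sigma> n))"
      unfolding L_def by (intro ereal_liminf_add_mono) auto
    also have "\<dots> = infimum" using lim unfolding barycenter_objective_def by (intro lim_imp_Liminf) auto
    finally show ?thesis using add_mono[OF bL G] by simp
  qed
  have "objective \<nu> \<le> infimum"
    unfolding barycenter_objective_def by (rule add) (rule order_trans[OF fatou mean_cost_fatou[of \<sigma>, OF s]])
  then have objective: "objective \<nu> = infimum" using infimum_le[OF \<nu>] by simp
  then show "\<nu> \<in> barycenters c G P" using \<nu> by (simp add: barycenters_iff)
  have mG: "ereal m \<le> G \<nu>" using m \<nu> by blast
  have "enn2ereal (mean_cost \<nu>) + G \<nu> = ereal i" using objective i by (simp add: barycenter_objective_def)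
  \<comment> \<open>Finiteness of \<open>G \<nu>\<close> allows it to be cancelled below, which
    isolates the mean costs.\<close>
  then obtain g where g: "G \<nu> = ereal g" using mG
    by (cases "G \<nu>"; cases "enn2ereal (mean_cost \<nu>)") auto
  have fin: "mean_cost \<nu> \<noteq> \<top>"
    using \<open>enn2ereal (mean_cost \<nu>) + G \<nu> = ereal i\<close> g by auto
  have "liminf (\<lambda>n. mean_cost (\<sigma> n)) \<le> mean_cost \<nu>"
  proof -
    have "enn2ereal (liminf (\<lambda>n. mean_cost (\<sigma> n))) + ereal g \<le> enn2ereal (mean_cost \<nu>) + ereal g"
      using add[OF order_refl] objective g by (simp add: barycenter_objective_def)
    then have "enn2ereal (liminf (\<lambda>n. mean_cost (\<sigma> n))) \<le> enn2ereal (mean_cost \<nu>)"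
      by (simp add: ereal_add_le_add_iff2)
    then show ?thesis by (simp add: less_eq_ennreal.rep_eq)
  qed
  then have int_le: "(\<integral>\<^sup>+\<mu>. liminf (\<lambda>n. transport_cost c \<mu> (\<sigma> n)) \<partial>P) \<le> mean_cost \<nu>"
    using mean_cost_fatou[of \<sigma>, OF s] by (rule order_trans[rotated])
  show "\<exists>\<mu>\<in>borel_probs. transport_cost c \<mu> \<nu> \<noteq> \<top> \<and>
      liminf (\<lambda>n. transport_cost c \<mu> (\<sigma> n)) \<le> transport_cost c \<mu> \<nu>"
  proof (rule ccontr)
    assume neg: "\<not> ?thesis"
    have meas: "(\<lambda>\<mu>. liminf (\<lambda>n. transport_cost c \<mu> (\<sigma> n))) \<in> borel_measurable P"
      using cost_measurable_P[OF s] by measurable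
    have "AE \<mu> in P. transport_cost c \<mu> \<nu> \<noteq> \<infinity>"
      using nn_integral_PInf_AE[OF cost_measurable_P[OF \<nu>]] fin by simp
    moreover have "AE \<mu> in P. \<mu> \<in> space P" by (rule AE_space)
    ultimately have less: "AE \<mu> in P. transport_cost c \<mu> \<nu> < liminf (\<lambda>n. transport_cost c \<mu> (\<sigma> n))"
      by eventually_elim (use neg in \<open>auto simp: space_P not_le\<close>)
    have "mean_cost \<nu> < (\<integral>\<^sup>+\<mu>. liminf (\<lambda>n. transport_cost c \<mu> (\<sigma> n)) \<partial>P)"
    proof (rule nn_integral_less[OF cost_measurable_P[OF \<nu>] meas])
      show "AE \<mu> in P. transport_cost c \<mu> \<nu> \<le> liminf (\<lambda>n. transport_cost c \<mu> (\<sigma> n))"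
        using less by eventually_elim simp
      show "\<not> (AE \<mu> in P. liminf (\<lambda>n. transport_cost c \<mu> (\<sigma> n)) \<le> transport_cost c \<mu> \<nu>)"
      proof
        assume "AE \<mu> in P. liminf (\<lambda>n. transport_cost c \<mu> (\<sigma> n)) \<le> transport_cost c \<mu> \<nu>"
        with less have "AE \<mu> in P. False" by eventually_elim simp
        then show False using P.AE_False by simp
      qed
    qed (use fin in simp)
    with int_le show False by simp
  qed
qed

text \<open>If the costs from some \<open>\<mu>\<close> were not eventually below \<open>r\<close>,
  a subsequence would keep them at least \<open>r\<close>. It is still minimizing and weakly
  convergent to \<open>\<nu>\<close>, so \<open>frequently_transport_cost_less\<close> yields a
  member below \<open>r\<close>.\<close>

lemma minimizing_transport_limit:
  assumes min: "minimizing \<sigma>" and w: "weakly_conv \<sigma> \<nu>" and \<nu>: "\<nu> \<in> borel_probs"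
  shows "transport_cost c \<mu> \<nu> < r \<Longrightarrow> eventually (\<lambda>n. transport_cost c \<mu> (\<sigma> n) < r) sequentially"
    and "limitin (transport_topology c) \<sigma> \<nu> sequentially"
proof -
  have s: "\<And>n. \<sigma> n \<in> borel_probs" using min by (simp add: minimizing_def)
  show *: "eventually (\<lambda>n. transport_cost c \<mu> (\<sigma> n) < r) sequentially" if less: "transport_cost c \<mu> \<nu> < r" for \<mu> r
  proof (rule ccontr)
    assume "\<not> ?thesis"
    then obtain q :: "nat \<Rightarrow> nat" where q: "strict_mono q" "\<And>n. \<not> transport_cost c \<mu> (\<sigma> (q n)) < r"
      using strict_mono_subseq_of_frequently[of "\<lambda>n. \<not> transport_cost c \<mu> (\<sigma> n) < r"] by auto
    have wq: "weakly_conv (\<sigma> \<circ> q) \<nu>" using w q(1) by (rule weakly_conv_subseq)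
    obtain \<mu>0 where \<mu>0: "\<mu>0 \<in> borel_probs" "transport_cost c \<mu>0 \<nu> \<noteq> \<top>"
      "liminf (\<lambda>n. transport_cost c \<mu>0 ((\<sigma> \<circ> q) n)) \<le> transport_cost c \<mu>0 \<nu>"
      using minimizing_weak_limit(2)[OF minimizing_subseq[OF min q(1)] wq \<nu>] by blast
    obtain n where "transport_cost c \<mu> ((\<sigma> \<circ> q) n) < r"
      using frequently_transport_cost_less[OF wq \<nu> _ \<mu>0(1,3,2) less] s by auto
    with q(2)[of n] show False by simp
  qed
  show "limitin (transport_topology c) \<sigma> \<nu> sequentially"
    using s \<nu> * by (rule limitin_transport_topologyI)
qed

lemma minimizing_barycenters: "(\<And>n. \<sigma> n \<in> barycenters c G P) \<Longrightarrow> minimizing \<sigma>"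
  by (simp add: minimizing_def barycenters_iff)

text \<open>Sequences of barycenters are minimizing, so every statement about minimizing sequences
  applies to them: they have weak limit points among the barycenters, and costs to them from any
  fixed centre are upper semicontinuous.\<close>

lemma compactin_barycenters: "compactin (transport_topology c) (barycenters c G P)"
proof -
  define K where "K = barycenters c G P"
  have Kb: "K \<subseteq> borel_probs" by (auto simp: K_def barycenters_iff)
  have "compactin weak_topology K"
    unfolding compactin_weak_topology_sequentially
  proof (intro conjI Kb allI impI)
    fix s :: "nat \<Rightarrow> 'a measure" assume "range s \<subseteq> K"
    then have min: "minimizing s" unfolding K_def by (intro minimizing_barycenters) auto
    then obtain r \<nu> where r: "strict_mono r" "\<nu> \<in> borel_probs" "weakly_conv (s \<circ> r) \<nu>"
      by (rule minimizing_imp_weakly_conv_subseq)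
    then have "\<nu> \<in> K"
      unfolding K_def by (intro minimizing_weak_limit(1)[OF minimizing_subseq[OF min]])
    then show "\<exists>l r. l \<in> K \<and> strict_mono r \<and> weakly_conv (s \<circ> r) l" using r by blast
  qed
  then have "compactin (subtopology weak_topology K) K" by (simp add: compactin_subtopology)
  moreover have "continuous_map (subtopology weak_topology K) (transport_topology c) (\<lambda>\<nu>. \<nu>)"
    unfolding transport_topology_def continuous_on_generated_topo_iff
  proof safe
    fix \<mu> :: "'a measure" and r :: real assume \<mu>: "\<mu> \<in> borel_probs" and r: "0 < r"
    \<comment> \<open>Continuity is checked on the complement of a ball within \<open>K\<close>,
      where weak closedness can be tested by sequences.\<close>
    define S where "S = {\<nu> \<in> K. \<not> transport_cost c \<mu> \<nu> < ennreal r}"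
    have "closedin weak_topology S"
      unfolding closedin_weak_topology_sequentially
    proof (intro conjI allI impI)
      show "S \<subseteq> borel_probs" using Kb by (auto simp: S_def)
      fix s l assume *: "range s \<subseteq> S \<and> l \<in> borel_probs \<and> weakly_conv s l"
      then have s: "\<And>n. s n \<in> K" "\<And>n. \<not> transport_cost c \<mu> (s n) < ennreal r" by (auto simp: S_def)
      have min: "minimizing s" using s(1) unfolding K_def by (rule minimizing_barycenters)
      have "l \<in> K" unfolding K_def using * by (intro minimizing_weak_limit(1)[OF min]) auto
      moreover have "\<not> transport_cost c \<mu> l < ennreal r"
      proof
        assume "transport_cost c \<mu> l < ennreal r"
        then have "eventually (\<lambda>n. transport_cost c \<mu> (s n) < ennreal r) sequentially"
          using * by (intro minimizing_transport_limit(1)[OF min]) auto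
        with s(2) show False by simp
      qed
      ultimately show "l \<in> S" by (simp add: S_def)
    qed
    then have "openin weak_topology (borel_probs - S)" by (simp add: closedin_def)
    moreover have "(\<lambda>\<nu>. \<nu>) -` {\<nu> \<in> borel_probs. transport_cost c \<mu> \<nu> < ennreal r} \<inter> topspace (subtopology weak_topology K) =
        (borel_probs - S) \<inter> K"
      using Kb by (auto simp: S_def)
    ultimately show "openin (subtopology weak_topology K)
        ((\<lambda>\<nu>. \<nu>) -` {\<nu> \<in> borel_probs. transport_cost c \<mu> \<nu> < ennreal r} \<inter> topspace (subtopology weak_topology K))"
      by (auto simp: openin_subtopology)
  next
    fix \<nu> assume "\<nu> \<in> topspace (subtopology weak_topology K)"
    then have "\<nu> \<in> topspace (transport_topology c)" by (simp add: topspace_transport_topology)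
    then show "\<nu> \<in> \<Union>{{\<nu> \<in> borel_probs. transport_cost c \<mu> \<nu> < ennreal r} | \<mu> r. \<mu> \<in> borel_probs \<and> r > 0}"
      unfolding transport_topology_def topology_generated_by_topspace .
  qed
  ultimately have "compactin (transport_topology c) ((\<lambda>\<nu>. \<nu>) ` K)" by (rule image_compactin)
  then show ?thesis by (simp add: K_def)
qed

text \<open>A subsequence avoiding \<open>U\<close> would have a further subsequence converging in
  the transport topology to a barycenter, whose neighbourhood \<open>U\<close> it must
  enter.\<close>

lemma minimizing_eventually_in:
  assumes min: "minimizing \<sigma>" and U: "openin (transport_topology c) U" "barycenters c G P \<subseteq> U"
  shows "eventually (\<lambda>n. \<sigma> n \<in> U) sequentially"
proof (rule ccontr)
  assume "\<not> ?thesis"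
  then obtain q :: "nat \<Rightarrow> nat" where q: "strict_mono q" "\<And>n. \<sigma> (q n) \<notin> U"
    using strict_mono_subseq_of_frequently[of "\<lambda>n. \<sigma> n \<notin> U"] by auto
  have minq: "minimizing (\<sigma> \<circ> q)" using min q(1) by (rule minimizing_subseq)
  obtain r \<nu> where r: "strict_mono r" "\<nu> \<in> borel_probs" "weakly_conv (\<sigma> \<circ> q \<circ> r) \<nu>"
    using minq by (rule minimizing_imp_weakly_conv_subseq)
  have minr: "minimizing (\<sigma> \<circ> q \<circ> r)" using minq r(1) by (rule minimizing_subseq)
  have "\<nu> \<in> U" using minimizing_weak_limit(1)[OF minr r(3,2)] U(2) by blast
  then have "eventually (\<lambda>n. (\<sigma> \<circ> q \<circ> r) n \<in> U) sequentially"
    using minimizing_transport_limit(2)[OF minr r(3,2)] U(1) unfolding limitin_def by blast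
  then show False using q(2) by simp
qed

text \<open>The barycenters together with the sequence form a compact set: finitely many members of
  a cover contain the barycenters, hence a tail of the sequence, and finitely many more cover the
  rest.\<close>

lemma minimizing_precompact:
  assumes min: "minimizing \<sigma>"
  shows "precompact_in (transport_topology c) (range \<sigma>)"
proof -
  have s: "\<And>n. \<sigma> n \<in> borel_probs" using min by (simp add: minimizing_def)
  define K where "K = barycenters c G P \<union> range \<sigma>"
  have "compactin (transport_topology c) K"
    unfolding compactin_def
  proof (intro conjI allI impI)
    show "K \<subseteq> topspace (transport_topology c)"
      using s by (auto simp: K_def barycenters_iff topspace_transport_topology)
    fix \<U> assume \<U>: "(\<forall>U\<in>\<U>. openin (transport_topology c) U) \<and> K \<subseteq> \<Union>\<U>"
    then have "barycenters c G P \<subseteq> \<Union>\<U>" by (simp add: K_def)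
    then obtain \<F> where \<F>: "finite \<F>" "\<F> \<subseteq> \<U>" "barycenters c G P \<subseteq> \<Union>\<F>"
      using compactin_barycenters \<U> unfolding compactin_def by metis
    have "openin (transport_topology c) (\<Union>\<F>)" using \<F>(2) \<U> by (intro openin_Union) auto
    then have "\<exists>N. \<forall>n\<ge>N. \<sigma> n \<in> \<Union>\<F>"
      using minimizing_eventually_in[OF min] \<F>(3) unfolding eventually_sequentially by blast
    then obtain N where N: "\<And>n. n \<ge> N \<Longrightarrow> \<sigma> n \<in> \<Union>\<F>" by blast
    have "\<exists>V\<in>\<U>. \<sigma> n \<in> V" for n
    proof -
      have "\<sigma> n \<in> K" by (simp add: K_def)
      then show ?thesis using \<U> by blast
    qed
    then obtain V where V: "\<And>n. V n \<in> \<U>" "\<And>n. \<sigma> n \<in> V n" by metis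
    have "K \<subseteq> \<Union>(\<F> \<union> V ` {..<N})"
    proof
      fix x assume "x \<in> K"
      then consider "x \<in> barycenters c G P" | n where "x = \<sigma> n" by (auto simp: K_def)
      then show "x \<in> \<Union>(\<F> \<union> V ` {..<N})"
      proof cases
        case 2
        then show ?thesis using N[of n] V(2)[of n] by (cases "n < N") auto
      qed (use \<F>(3) in auto)
    qed
    then show "\<exists>\<F>. finite \<F> \<and> \<F> \<subseteq> \<U> \<and> K \<subseteq> \<Union>\<F>"
      using \<F> V(1) by (intro exI[of _ "\<F> \<union> V ` {..<N}"]) auto
  qed
  moreover from this have "closedin (transport_topology c) K"
    using Hausdorff_transport_topology by (intro compactin_imp_closedin)
  then have "transport_topology c closure_of range \<sigma> \<subseteq> K"
    by (intro closure_of_minimal) (auto simp: K_def)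
  ultimately have "compactin (transport_topology c) (transport_topology c closure_of range \<sigma>)"
    by (rule closed_compactin) simp
  then show ?thesis
    using s by (auto simp: precompact_in_def topspace_transport_topology)
qed

lemma minimizing_exists: "\<exists>\<sigma>. minimizing \<sigma>"
proof -
  obtain i where i: "infimum = ereal i" using infimum_finite by (cases infimum) auto
  have "\<exists>\<nu>\<in>borel_probs. objective \<nu> < ereal (i + inverse (real (Suc n)))" for n
    using i unfolding infimum_def by (intro INF_less_iff[THEN iffD1]) simp
  then obtain \<sigma> where \<sigma>: "\<And>n. \<sigma> n \<in> borel_probs" "\<And>n. objective (\<sigma> n) < ereal (i + inverse (real (Suc n)))" by metis
  have "(\<lambda>n. i + inverse (real (Suc n))) \<longlonglongrightarrow> i + 0" by (intro tendsto_intros LIMSEQ_inverse_real_of_nat)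
  then have "(\<lambda>n. ereal (i + inverse (real (Suc n)))) \<longlonglongrightarrow> infimum" by (simp add: i)
  then have "(\<lambda>n. objective (\<sigma> n)) \<longlonglongrightarrow> infimum"
    by (rule tendsto_sandwich[OF always_eventually[OF allI] always_eventually[OF allI] tendsto_const, rotated 2])
      (use infimum_le \<sigma>(1) less_imp_le[OF \<sigma>(2)] in blast)+
  with \<sigma>(1) show ?thesis by (auto simp: minimizing_def)
qed

end

theorem theorem5p3:
  fixes c :: "'a::{metric_space, second_countable_topology} \<Rightarrow> 'a \<Rightarrow> real"
    and A B :: real
    and G :: "'a measure \<Rightarrow> ereal"
    and P :: "'a measure measure"
  assumes radon: "\<And>(\<mu> :: 'a measure) \<epsilon> :: real. \<mu> \<in> borel_probs \<Longrightarrow> \<epsilon> > 0 \<Longrightarrow>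
        \<exists>D. compact D \<and> measure \<mu> (UNIV - D) < \<epsilon>"
    and cost_nonneg: "\<And>x y. c x y \<ge> 0"
    and cost_continuous: "continuous_on UNIV (\<lambda>(x, y). c x y)"
    and cost_consistent: "consistent_cost c"
    and growth_consts: "A \<ge> 0" "B \<ge> 0"
    and growth: "\<And>x y z. c x y \<le> A + B * (c x z + c y z)"
        "\<And>x y z. c x y \<le> A + B * (c x z + c z y)"
        "\<And>x y z. c x y \<le> A + B * (c z x + c y z)"
        "\<And>x y z. c x y \<le> A + B * (c z x + c z y)"
    and compact_balls: "\<exists>x0. \<forall>r\<ge>0. compact {y. c x0 y \<le> r}"
    and G_bounded_below: "\<exists>m::real. \<forall>\<nu>\<in>borel_probs. ereal m \<le> G \<nu>"
    and G_lsc: "lower_semicontinuous_map weak_topology G"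
    and P_prob: "prob_space P"
    and P_borel: "sets P = sets (borel_measure_of weak_topology)"
    and finite_inf: "(INF \<nu>\<in>borel_probs. barycenter_objective c G P \<nu>) < \<infinity>"
  shows "barycenters c G P \<noteq> {} \<and>
    (\<forall>\<nu> :: nat \<Rightarrow> 'a measure.
       (\<forall>n. \<nu> n \<in> borel_probs) \<and>
       (\<lambda>n. barycenter_objective c G P (\<nu> n))
          \<longlonglongrightarrow> (INF \<nu>'\<in>borel_probs. barycenter_objective c G P \<nu>') \<longrightarrow>
       precompact_in (transport_topology c) (range \<nu>) \<and>
       (\<forall>s \<nu>'. strict_mono s \<and> limitin (transport_topology c) (\<nu> \<circ> s) \<nu>' sequentially \<longrightarrow>
          \<nu>' \<in> barycenters c G P)) \<and>
    compactin (transport_topology c) (barycenters c G P)"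
proof -
  interpret barycenter_problem c A B G P
    by (intro barycenter_problem.intro growth_cost.intro barycenter_problem_axioms.intro) (fact assms)+
  obtain \<sigma> where \<sigma>: "minimizing \<sigma>" using minimizing_exists by blast
  obtain r \<nu> where r: "strict_mono r" "\<nu> \<in> borel_probs" "weakly_conv (\<sigma> \<circ> r) \<nu>"
    using \<sigma> by (rule minimizing_imp_weakly_conv_subseq)
  have ne: "\<nu> \<in> barycenters c G P"
    using minimizing_weak_limit(1)[OF minimizing_subseq[OF \<sigma> r(1)] r(3,2)] .
  \<comment> \<open>A limit in the transport topology is also a weak limit, and a subsequence of a
    minimizing sequence is minimizing.\<close>
  have limit: "\<nu>' \<in> barycenters c G P"
    if \<nu>: "minimizing \<nu>" and s: "strict_mono s" "limitin (transport_topology c) (\<nu> \<circ> s) \<nu>' sequentially" for \<nu> s \<nu>'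
  proof -
    have min: "minimizing (\<nu> \<circ> s)" using \<nu> s(1) by (rule minimizing_subseq)
    then have "weakly_conv (\<nu> \<circ> s) \<nu>'" "\<nu>' \<in> borel_probs"
      using weakly_conv_of_limitin_transport_topology[OF s(2)] by (auto simp: minimizing_def)
    with min show ?thesis by (rule minimizing_weak_limit(1))
  qed
  show ?thesis
    using ne limit minimizing_precompact compactin_barycenters
    unfolding minimizing_def infimum_def by blast
qed

end
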